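(* Let $q$ be a power of a prime $p$ with $q\equiv 3\pmod 4$ and $q\ge 7$, let $3\le n\le p$, and let $e$ be an even divisor of $q-1$. If $\mathrm{Rad}(e)=\mathrm{Rad}(q-1)$ set $s=0$ and $\delta=1$; otherwise let $p_1,\dots,p_s$ ($s\ge1$) be the primes dividing $q-1$ but not $e$, and set $\delta=1-n\sum_{i=1}^s p_i^{-1}$. Assume $\delta>0$. If \[ q>\Bigl(\frac{n-1}{2}\Bigl(\frac{ns-1}{\delta}+2\Bigr)W(e)^n\Bigr)^2, \] then there exist $n$ consecutive primitive elements in $\mathbb{F}_q$, i.e., some $g\in\mathbb{F}_q$ with $g,g+1,\dots,g+n-1$ all primitive.
   Context: $\mathrm{Rad}(m)$ is the product of the distinct primes dividing $m$; $\omega(m)$ is the number of distinct prime factors of $m$ and $W(m)=2^{\omega(m)}$. *)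

theory Defs
  imports "HOL-Number_Theory.Number_Theory" "HOL-Library.Cardinality" Complex_Main
begin

definition Rad :: "nat \<Rightarrow> nat" where
  "Rad m = \<Prod>(prime_factors m)"

definition omega :: "nat \<Rightarrow> nat" where
  "omega m = card (prime_factors m)"

definition W :: "nat \<Rightarrow> nat" where
  "W m = 2 ^ omega m"

definition remaining_primes :: "nat \<Rightarrow> nat \<Rightarrow> nat set" where
  "remaining_primes e m = {r. prime r \<and> r dvd m \<and> \<not> r dvd e}"

definition sieve_s :: "nat \<Rightarrow> nat \<Rightarrow> nat" where
  "sieve_s q e =
     (if Rad e = Rad (q - 1) then 0 else card (remaining_primes e (q - 1)))"

definition sieve_delta :: "nat \<Rightarrow> nat \<Rightarrow> nat \<Rightarrow> real" where
  "sieve_delta n q e =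
     (if Rad e = Rad (q - 1) then 1
      else 1 - real n * (\<Sum>r\<in>remaining_primes e (q - 1). 1 / real r))"

text \<open>The nonzero elements are exactly the integer powers of \<open>g\<close>, i.e. \<open>g\<close> generates the
  multiplicative group. In particular \<open>0\<close> is not primitive: \<open>0 powi 0 = 1\<close> and
  \<open>0 powi k = 0\<close> otherwise.\<close>

definition primitive_element :: "'a :: finite_field \<Rightarrow> bool" where
  "primitive_element g \<longleftrightarrow> {x. x \<noteq> 0} = range (\<lambda>k::int. g powi k)"

end

(* Weil's bound for sums of products of multiplicative characters of x, x+1, ..., x+n-1 is
   proved over F_q and then fed into the Cohen sieve.

   For the bound, let L be the generating function of the character sums over monic
   polynomials. It is a polynomial of degree less than n, and its logarithmic derivative generates
   the sums S_m over F_{q^m}. Stepanov's method, applied to y^d = f(x), gives S_m = O(q^{m/2});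
   hence every reciprocal root of L has modulus at most sqrt q, and S_1 is minus their sum.
   Everything takes place in an algebraic closure, where F_{q^m} is the fixed field of x -> x^{q^m}.

   For the sieve, the indicator of being no p-th power for all p in P is a constant times the
   product over p of 1 + w_p, where w_p is minus the average of the characters of order p.
   The reflection x -> -x-(n-1) cancels half of the resulting terms. *)

theory Submission
  imports Defs
    "HOL-Computational_Algebra.Computational_Algebra"
    "HOL-Algebra.Multiplicative_Group"
    "HOL-Algebra.Algebraic_Closure_Type"
begin

hide_const (open) Divisibility.prime Coset.order

section \<open>Polynomials and linear algebra\<close>

text \<open>Constants may be lost freely before the Weil bound:
  \<open>newton_coefficient_bound\<close> sees only the exponential growth of S_m, so Stepanov's
  method may take m large and concede a factor depending on d and f. Upper bounds for point counts
  are enough: the d classes of f(x) modulo d-th powers and the zeros of f exhaust F_{q^m}, so d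
  upper bounds q^m/d + error force lower bounds.

  The delicate point is that Stepanov's auxiliary polynomial is nonzero. It is a sum of s_ij(x)
  x^(iR) f(x)^(jw), where R = dw + 1 is a power of p; multiplied by y^(d-1) it becomes a combination
  of the R-th powers (x^i y^j)^R with coefficients whose nonzero constant combinations vanish to
  order below R. Power series at a point where f is nonzero turn y into an ordinary element and
  order of vanishing into the subdegree.

  In the sieve, the coefficients of w_p in characters have absolute sum 1, so a correlation costs
  one Weil bound (n-1) sqrt q however many primes occur. Only the number of tuples of prime sets
  matters: 2^(n omega(e)) = W(e)^n, halved by the reflection.\<close>

lemma exists_nontrivial_relation:
  fixes v :: "'i \<Rightarrow> 'j \<Rightarrow> 'k::field"
  assumes "finite J" "finite I" "card J < card I"
  shows "\<exists>t. (\<exists>k\<in>I. t k \<noteq> 0) \<and> (\<forall>j\<in>J. (\<Sum>k\<in>I. t k * v k j) = 0)"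
  using assms
proof (induction J arbitrary: I v rule: finite_induct)
  case empty
  then obtain k where "k \<in> I" by fastforce
  thus ?case by (intro exI[of _ "\<lambda>_. 1"]) auto
next
  case (insert j0 J)
  show ?case
  proof (cases "\<forall>k\<in>I. v k j0 = 0")
    case True
    obtain t where "\<exists>k\<in>I. t k \<noteq> 0" "\<forall>j\<in>J. (\<Sum>k\<in>I. t k * v k j) = 0"
      using insert.IH[of I v] insert.prems insert.hyps by auto
    thus ?thesis using True by (intro exI[of _ t]) auto
  next
    case False
    then obtain k0 where k0: "k0 \<in> I" "v k0 j0 \<noteq> 0" by auto
    define v' where "v' k j = v k j - v k j0 / v k0 j0 * v k0 j" for k j
    have "card J < card (I - {k0})"
      using insert.prems insert.hyps k0 by simp
    then obtain t where t: "\<exists>k\<in>I-{k0}. t k \<noteq> 0" "\<forall>j\<in>J. (\<Sum>k\<in>I-{k0}. t k * v' k j) = 0"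
      using insert.IH[of "I-{k0}" v'] insert.prems by auto
    \<comment> \<open>Subtracting multiples of the pivot row \<open>k0\<close> cleared column
      \<open>j0\<close>; this coefficient for \<open>k0\<close> accounts for the subtracted
      multiples in the other columns.\<close>
    define c where "c = (\<Sum>k\<in>I-{k0}. t k * (v k j0 / v k0 j0))"
    define t' where "t' = t(k0 := - c)"
    have *: "(\<Sum>k\<in>I. t' k * v k j) = (\<Sum>k\<in>I-{k0}. t k * v' k j)" for j
    proof -
      have "(\<Sum>k\<in>I. t' k * v k j) = - c * v k0 j + (\<Sum>k\<in>I-{k0}. t' k * v k j)"
        using k0 insert.prems by (subst sum.remove[of _ k0]) (auto simp: t'_def)
      also have "(\<Sum>k\<in>I-{k0}. t' k * v k j) = (\<Sum>k\<in>I-{k0}. t k * v k j)"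
        by (intro sum.cong) (auto simp: t'_def)
      finally show ?thesis
        by (simp add: c_def v'_def algebra_simps sum_subtractf sum_distrib_left sum_distrib_right)
    qed
    have "(\<Sum>k\<in>I. t' k * v k j) = 0" if "j \<in> insert j0 J" for j
      using that t(2) k0 by (auto simp: * v'_def)
    moreover have "\<exists>k\<in>I. t' k \<noteq> 0"
      using t(1) by (auto simp: t'_def)
    ultimately show ?thesis by blast
  qed
qed

text \<open>Counts the d-th roots of unity and the elements of F_{q^m}: both are the zeros of a
  polynomial that shares no zero with its derivative.\<close>

lemma card_roots_separable:
  fixes p :: "'k::alg_closed_field poly"
  assumes "p \<noteq> 0" "\<And>a. poly p a = 0 \<Longrightarrow> poly (pderiv p) a \<noteq> 0"
  shows "card {x. poly p x = 0} = degree p"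
  using assms
proof (induction "degree p" arbitrary: p)
  case 0
  then obtain c where "p = [:c:]" by (metis degree_eq_zeroE)
  thus ?case using 0 by auto
next
  case (Suc n)
  then obtain x where x: "poly p x = 0"
    using alg_closed_imp_poly_has_root[of p] by auto
  then obtain q where q: "p = [:-x, 1:] * q"
    by (auto simp: poly_eq_0_iff_dvd elim: dvdE)
  with Suc.prems have q0: "q \<noteq> 0" by auto
  have deg: "degree p = Suc (degree q)"
    unfolding q by (subst degree_mult_eq) (use q0 in auto)
  have pd: "pderiv p = [:-x, 1:] * pderiv q + q"
    unfolding q by (subst pderiv_mult) (simp add: pderiv_pCons del: mult_pCons_left)
  have qx: "poly q x \<noteq> 0" using Suc.prems(2)[OF x] unfolding pd by auto
  have "poly (pderiv q) a \<noteq> 0" if "poly q a = 0" for a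
    using Suc.prems(2)[of a] that unfolding pd by (auto simp: q)
  hence "card {x. poly q x = 0} = degree q"
    using Suc.hyps(1)[of q] Suc.hyps(2) deg q0 by auto
  moreover have "{x. poly p x = 0} = insert x {x. poly q x = 0}"
    unfolding q by auto
  moreover have "finite {x. poly q x = 0}" using q0 by (rule poly_roots_finite)
  ultimately show ?case using qx deg by simp
qed

text \<open>The coefficients will be power series, so the argument stays with cancellation in a
  domain: each \<open>z\<close> is a root of \<open>p\<close> or of \<open>q\<close>, and the factor
  is stripped there.\<close>

lemma factor_of_prod_linear:
  fixes p q :: "'b::idom poly"
  assumes "finite Z" "p * q = smult c (\<Prod>z\<in>Z. [:-z, 1:])" "c \<noteq> 0"
  shows "\<exists>Z'\<subseteq>Z. \<exists>b. p = smult b (\<Prod>z\<in>Z'. [:-z, 1:])"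
  using assms
proof (induction Z arbitrary: p q rule: finite_induct)
  case empty
  hence "p * q = [:c:]" by simp
  hence "degree p = 0"
    using empty.prems(2) by (metis degree_mult_eq_0 degree_pCons_0 mult_eq_0_iff pCons_eq_0_iff)
  then obtain b where "p = [:b:]" by (elim degree_eq_zeroE)
  thus ?case by (intro exI[of _ "{}"]) auto
next
  case (insert z Z)
  have "poly (p * q) z = 0" using insert.hyps by (simp add: insert.prems poly_prod)
  then consider "poly p z = 0" | "poly q z = 0" by auto
  thus ?case
  proof cases
    case 1
    then obtain p' where p': "p = [:-z, 1:] * p'" by (auto simp: poly_eq_0_iff_dvd elim: dvdE)
    have "[:-z, 1:] * (p' * q) = [:-z, 1:] * smult c (\<Prod>z\<in>Z. [:-z, 1:])"
      using insert.prems insert.hyps by (simp add: p' mult_ac del: mult_pCons_left mult_pCons_right)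
    hence "p' * q = smult c (\<Prod>z\<in>Z. [:-z, 1:])"
      by (subst (asm) mult_cancel_left) auto
    then obtain Z' b where Z': "Z' \<subseteq> Z" "p' = smult b (\<Prod>z\<in>Z'. [:-z, 1:])"
      using insert.IH[of p' q] insert.prems by blast
    have "finite Z'" "z \<notin> Z'" using Z' insert.hyps finite_subset by auto
    thus ?thesis using Z' by (intro exI[of _ "insert z Z'"]) (auto simp: p')
  next
    case 2
    then obtain q' where q': "q = [:-z, 1:] * q'" by (auto simp: poly_eq_0_iff_dvd elim: dvdE)
    have "[:-z, 1:] * (p * q') = [:-z, 1:] * smult c (\<Prod>z\<in>Z. [:-z, 1:])"
      using insert.prems insert.hyps by (simp add: q' mult_ac del: mult_pCons_left mult_pCons_right)
    hence "p * q' = smult c (\<Prod>z\<in>Z. [:-z, 1:])"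
      by (subst (asm) mult_cancel_left) auto
    then show ?thesis
      using insert.IH[of p q'] insert.prems by blast
  qed
qed

text \<open>Expansion at \<open>c\<close> embeds polynomials into power series. If d is invertible,
  f acquires a d-th root there as soon as \<open>poly f c\<close> is nonzero, so the curve y^d =
  f(x) is handled inside one ring.\<close>

definition taylor :: "'k::field \<Rightarrow> 'k poly \<Rightarrow> 'k fps"
  where "taylor c p = fps_of_poly (pcompose p [:c, 1:])"

lemma taylor_0 [simp]: "taylor c 0 = 0"
  and taylor_1 [simp]: "taylor c 1 = 1"
  and taylor_add: "taylor c (p + r) = taylor c p + taylor c r"
  and taylor_diff: "taylor c (p - r) = taylor c p - taylor c r"
  and taylor_mult: "taylor c (p * r) = taylor c p * taylor c r"
  and taylor_smult: "taylor c (smult b p) = fps_const b * taylor c p"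
  and taylor_sum: "taylor c (\<Sum>x\<in>A. h x) = (\<Sum>x\<in>A. taylor c (h x))"
  by (simp_all add: taylor_def pcompose_1 pcompose_add pcompose_diff pcompose_mult
      pcompose_smult pcompose_sum fps_of_poly_add
      fps_of_poly_diff fps_of_poly_mult fps_of_poly_smult fps_of_poly_sum)

lemma taylor_power: "taylor c (p ^ n) = taylor c p ^ n"
  by (induction n) (simp_all add: taylor_mult)

lemma taylor_eq_0_iff [simp]: "taylor c p = 0 \<longleftrightarrow> p = 0"
proof -
  have "taylor c p = 0 \<longleftrightarrow> pcompose p [:c, 1:] = 0"
    using fps_of_poly_eq_iff[of "pcompose p [:c, 1:]" 0] by (simp add: taylor_def)
  also have "\<dots> \<longleftrightarrow> p = 0" by (intro pcompose_eq_0_iff) auto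
  finally show ?thesis .
qed

lemma subdegree_taylor_le: "subdegree (taylor c p) \<le> degree p"
proof (cases "p = 0")
  case False
  hence "pcompose p [:c, 1:] \<noteq> 0" by (subst pcompose_eq_0_iff) auto
  hence "taylor c p $ degree (pcompose p [:c, 1:]) \<noteq> 0" by (simp add: taylor_def)
  hence "subdegree (taylor c p) \<le> degree (pcompose p [:c, 1:])" by (rule subdegree_leI)
  thus ?thesis by (simp add: degree_pcompose)
qed auto

lemma taylor_nth_0: "taylor c p $ 0 = poly p c"
  by (simp add: taylor_def flip: poly_0_coeff_0) (simp add: poly_pcompose)

section \<open>Radicals in power series\<close>

text \<open>First-order expansion for the Newton iteration below: an increment divisible by X^(n+1)
  affects coefficient n+1 of the d-th power only through the linear term.\<close>

lemma power_add_expand: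
  fixes f e :: "'b::comm_ring_1"
  shows "\<exists>g. (f + e) ^ d = f ^ d + of_nat d * f ^ (d - 1) * e + e\<^sup>2 * g"
proof (induction d)
  case (Suc d)
  then obtain g where g: "(f + e) ^ d = f ^ d + of_nat d * f ^ (d - 1) * e + e\<^sup>2 * g" by blast
  have "f * (of_nat d * f ^ (d - 1)) = of_nat d * f ^ d" by (cases d) (simp_all add: algebra_simps)
  hence *: "f * (of_nat d * f ^ (d - 1) * e) = of_nat d * f ^ d * e" by (metis mult.assoc)
  have "(f + e) ^ Suc d = (f + e) * (f ^ d + of_nat d * f ^ (d - 1) * e + e\<^sup>2 * g)"
    by (simp only: power_Suc g)
  also have "\<dots> = f * f ^ d + f * (of_nat d * f ^ (d - 1) * e) + e * f ^ d
      + e\<^sup>2 * (f * g + of_nat d * f ^ (d - 1) + e * g)"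
    by (simp add: algebra_simps power2_eq_square)
  also have "\<dots> = f ^ Suc d + of_nat (Suc d) * f ^ (Suc d - 1) * e
      + e\<^sup>2 * (f * g + of_nat d * f ^ (d - 1) + e * g)"
    unfolding * by (simp add: algebra_simps)
  finally show ?case by blast
qed (auto intro: exI[of _ 0])

lemma fps_power_nth_cong:
  fixes f g :: "'k::comm_ring_1 fps"
  assumes "\<And>i. i \<le> n \<Longrightarrow> f $ i = g $ i" "m \<le> n"
  shows "(f ^ d) $ m = (g ^ d) $ m"
  using assms(2)
proof (induction d arbitrary: m)
  case (Suc d)
  thus ?case by (auto simp: fps_mult_nth assms(1) intro!: sum.cong)
qed auto

lemma fps_root_exists:
  fixes a :: "'k::alg_closed_field fps"
  assumes "a $ 0 \<noteq> 0" "of_nat d \<noteq> (0 :: 'k)"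
  shows "\<exists>y. y ^ d = a"
proof -
  have d: "d > 0" using assms(2) by (cases d) auto
  obtain y0 where y0: "y0 ^ d = a $ 0" using nth_root_exists[OF d] by blast
  hence y0nz: "y0 \<noteq> 0" using assms(1) d by (auto simp: power_0_left)
  \<comment> \<open>\<open>Y n\<close> has the correct d-th power up to degree n. The next
    coefficient is the remaining error divided by the derivative d y0^(d-1), which is nonzero since
    d is nonzero in the field.\<close>
  define Y where "Y = rec_nat (fps_const y0) (\<lambda>n f. f +
    fps_const ((a $ Suc n - (f ^ d) $ Suc n) / (of_nat d * y0 ^ (d - 1))) * fps_X ^ Suc n)"
  define b where "b n = (a $ Suc n - (Y n ^ d) $ Suc n) / (of_nat d * y0 ^ (d - 1))" for n
  have Y0: "Y 0 = fps_const y0"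
    and YS: "Y (Suc n) = Y n + fps_const (b n) * fps_X ^ Suc n" for n
    by (simp_all add: Y_def b_def)
  have YSnth: "Y (Suc n) $ i = Y n $ i" if "i \<le> n" for n i
    using that unfolding YS by (simp add: fps_X_power_mult_right_nth del: power_Suc)
  have Ystab: "Y (n + k) $ i = Y n $ i" if "i \<le> n" for n k i
    using that by (induction k) (simp_all add: YSnth)
  have Ynth0: "Y n $ 0 = y0" for n
    using Ystab[of 0 0 n] by (simp add: Y0)
  have inv: "(Y n ^ d) $ i = a $ i" if "i \<le> n" for n i
    using that
  proof (induction n arbitrary: i)
    case 0
    thus ?case using y0 by (simp add: Y0 fps_const_power)
  next
    case (Suc n)
    show ?case
    proof (cases "i \<le> n")
      case True
      hence "(Y (Suc n) ^ d) $ i = (Y n ^ d) $ i"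
        by (intro fps_power_nth_cong[of n]) (auto simp: YSnth)
      thus ?thesis using Suc.IH True by simp
    next
      case False
      hence i: "i = Suc n" using Suc.prems by simp
      define e where "e = fps_const (b n) * fps_X ^ Suc n"
      obtain g where g: "(Y n + e) ^ d = Y n ^ d + of_nat d * Y n ^ (d - 1) * e + e\<^sup>2 * g"
        using power_add_expand by blast
      have "e\<^sup>2 * g = fps_X ^ (Suc n + Suc n) * (fps_const (b n * b n) * g)"
        unfolding e_def power2_eq_square power_add
        by (simp add: algebra_simps flip: fps_const_mult del: power_Suc)
      hence "(e\<^sup>2 * g) $ Suc n = 0"
        by (simp only: fps_X_power_mult_nth) simp
      moreover have "of_nat d * Y n ^ (d - 1) * e
          = fps_X ^ Suc n * (fps_const (of_nat d * b n) * Y n ^ (d - 1))"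
        unfolding e_def by (simp add: algebra_simps fps_of_nat flip: fps_const_mult del: power_Suc)
      hence "(of_nat d * Y n ^ (d - 1) * e) $ Suc n = of_nat d * b n * y0 ^ (d - 1)"
        by (simp only: fps_X_power_mult_nth) (simp add: fps_nth_power_0 Ynth0)
      moreover have "\<dots> = a $ Suc n - (Y n ^ d) $ Suc n"
        using assms(2) y0nz by (simp add: b_def)
      ultimately show ?thesis
        unfolding i YS e_def[symmetric] g by simp
    qed
  qed
  have "Abs_fps (\<lambda>n. Y n $ n) ^ d = a"
  proof (rule fps_ext)
    fix n
    have "Abs_fps (\<lambda>n. Y n $ n) $ i = Y n $ i" if "i \<le> n" for i
      using Ystab[of i i "n - i"] that by simp
    hence "(Abs_fps (\<lambda>n. Y n $ n) ^ d) $ n = (Y n ^ d) $ n"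
      by (intro fps_power_nth_cong[of n]) auto
    thus "(Abs_fps (\<lambda>n. Y n $ n) ^ d) $ n = a $ n" using inv by simp
  qed
  thus ?thesis by blast
qed

lemma coeff_map_taylor: "coeff (map_poly (taylor c) m) n = taylor c (coeff m n)"
  by (simp add: coeff_map_poly)

lemma map_taylor_mult:
  "map_poly (taylor c) (m * q) = map_poly (taylor c) m * map_poly (taylor c) q"
  by (intro poly_eqI) (simp add: coeff_map_taylor coeff_mult taylor_sum taylor_mult)

lemma prod_roots_of_unity:
  fixes y :: "'k::alg_closed_field fps"
  assumes "of_nat d \<noteq> (0 :: 'k)" "y \<noteq> 0"
  shows "\<exists>Z. finite Z \<and> (\<forall>z\<in>Z. z ^ d = y ^ d) \<and> monom 1 d - [:y ^ d:] = (\<Prod>z\<in>Z. [:-z, 1:])"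
proof -
  have d: "d > 0" using assms(1) by (cases d) auto
  define U where "U = {x::'k. x ^ d = 1}"
  let ?p = "monom 1 d - 1 :: 'k poly"
  have deg: "degree ?p = d"
    using d by (intro antisym degree_le le_degree) (auto simp: coeff_eq_0 degree_monom_eq)
  have "card {x. poly ?p x = 0} = degree ?p"
  proof (rule card_roots_separable)
    show "?p \<noteq> 0" using deg d by auto
    fix a assume "poly ?p a = 0"
    hence "a ^ d = 1" by (simp add: poly_monom)
    hence "a \<noteq> 0" using d by (auto simp: power_0_left)
    thus "poly (pderiv ?p) a \<noteq> 0" using assms(1) by (simp add: pderiv_diff pderiv_monom poly_monom)
  qed
  hence cU: "card U = d" by (simp add: deg U_def poly_monom)
  hence fU: "finite U" using d card_ge_0_finite by force
  define Z where "Z = (\<lambda>x. fps_const x * y) ` U"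
  have cZ: "card Z = d" unfolding Z_def cU[symmetric]
    using assms(2) by (intro card_image inj_onI) auto
  have fZ: "finite Z" unfolding Z_def using fU by simp
  have zd: "z ^ d = y ^ d" if "z \<in> Z" for z
    using that by (auto simp: Z_def U_def power_mult_distrib fps_const_power)
  let ?P = "\<Prod>z\<in>Z. [:-z, 1:]" and ?Q = "monom 1 d - [:y ^ d:]"
  \<comment> \<open>Both are monic of degree d and vanish on the d elements of \<open>Z\<close>; a
    nonzero difference would have degree below d and d zeros.\<close>
  have "?Q - ?P = 0"
  proof (rule ccontr)
    assume nz: "?Q - ?P \<noteq> 0"
    have "degree ?P = d" by (subst degree_prod_eq_sum_degree) (auto simp: cZ)
    moreover have "lead_coeff ?P = 1" by (subst lead_coeff_prod) auto
    moreover have "degree ?Q = d"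
      using d by (intro antisym degree_le le_degree)
        (auto simp: coeff_eq_0 degree_monom_eq coeff_pCons split: nat.splits)
    moreover have "coeff ?Q d = 1" using d by (auto simp: coeff_pCons split: nat.splits)
    ultimately have "degree (?Q - ?P) \<le> d" "coeff (?Q - ?P) d = 0"
      using degree_diff_le[of ?Q d ?P] by auto
    hence "degree (?Q - ?P) < d" using eq_zero_or_degree_less nz by blast
    moreover have "card Z \<le> card {z. poly (?Q - ?P) z = 0}"
    proof (rule card_mono)
      show "finite {z. poly (?Q - ?P) z = 0}" using nz by (rule poly_roots_finite)
      show "Z \<subseteq> {z. poly (?Q - ?P) z = 0}"
        using fZ zd by (auto simp: poly_prod poly_monom)
    qed
    moreover have "card {z. poly (?Q - ?P) z = 0} \<le> degree (?Q - ?P)"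
      using nz by (rule card_poly_roots_bound)
    ultimately show False using cZ by simp
  qed
  thus ?thesis using fZ zd by (intro exI[of _ Z]) auto
qed

text \<open>A minimal polynomial of \<open>y\<close> over \<open>k(x)\<close> divides \<open>Y ^ d - y ^ d\<close>, the product of the
  \<open>Y - \<zeta> y\<close>. If it had degree \<open>e < d\<close>, its constant term would be a constant times \<open>y ^ e\<close>, so \<open>f ^ e\<close>
  would be a \<open>d\<close>-th power up to a constant.\<close>

lemma radical_independent:
  fixes f :: "'k::alg_closed_field poly" and y :: "'k fps"
  assumes y: "y ^ d = taylor c f" and d: "of_nat d \<noteq> (0 :: 'k)" and f: "f \<noteq> 0"
    and nopow: "\<And>e u v b. 0 < e \<Longrightarrow> e < d \<Longrightarrow> v \<noteq> 0 \<Longrightarrow> b \<noteq> 0 \<Longrightarrow> u ^ d \<noteq> smult b (v ^ d * f ^ e)"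
    and rel: "(\<Sum>j<d. taylor c (s j) * y ^ j) = 0" and j: "j < d"
  shows "s j = 0"
proof (rule ccontr)
  assume sj: "s j \<noteq> 0"
  define T where "T = map_poly (taylor c)"
  have d0: "d > 0" using j by simp
  have "y \<noteq> 0" using y f d0 by (metis power_eq_0_iff taylor_eq_0_iff)
  define P where "P m \<longleftrightarrow> m \<noteq> 0 \<and> poly (T m) y = 0" for m
  define m0 where "m0 = (\<Sum>j<d. monom (s j) j)"
  have c0: "coeff m0 i = (if i < d then s i else 0)" for i
    by (simp add: m0_def coeff_sum)
  have m0: "m0 \<noteq> 0" using c0[of j] sj j by auto
  have deg0: "degree m0 < d"
    using d0 by (intro degree_lessI) (auto simp: c0)
  have polyT: "poly (T m) y = (\<Sum>i\<le>degree m. taylor c (coeff m i) * y ^ i)" for m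
    unfolding poly_altdef T_def
    by (subst degree_map_poly) (auto simp: coeff_map_taylor)
  have "poly (T m0) y = (\<Sum>i<d. taylor c (coeff m0 i) * y ^ i)"
    unfolding polyT using deg0 by (intro sum.mono_neutral_left) (auto simp: coeff_eq_0)
  hence Pm0: "P m0" using rel m0 by (simp add: P_def c0)
  define m where "m = arg_min degree P"
  have Pm: "P m" and mmin: "\<And>m'. P m' \<Longrightarrow> degree m \<le> degree m'"
    using arg_min_nat_lemma[of P m0 degree] Pm0 by (auto simp: m_def)
  define e where "e = degree m"
  have ed: "e < d" using mmin[OF Pm0] deg0 by (simp add: e_def)
  have e0: "e > 0"
  proof (rule ccontr)
    assume "\<not> e > 0"
    then obtain a where "m = [:a:]" by (metis e_def degree_eq_zeroE neq0_conv)
    thus False using Pm by (auto simp: P_def T_def map_poly_pCons)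
  qed
  have mnz: "m \<noteq> 0" using Pm by (simp add: P_def)
  define F where "F = monom 1 d - [:f:]"
  have TF: "T F = monom 1 d - [:y ^ d:]"
    by (intro poly_eqI) (auto simp: T_def F_def coeff_map_taylor taylor_diff y coeff_pCons split: nat.splits)
  \<comment> \<open>Pseudo-division, since the leading coefficient of \<open>m\<close> is itself a
    polynomial; minimality of the degree of \<open>m\<close> then forces the remainder to
    vanish.\<close>
  obtain a q r where a: "a \<noteq> 0" "smult a F = m * q + r" and r: "r = 0 \<or> degree r < degree m"
    using pseudo_mod[OF mnz, of F] by metis
  have Tsm: "T (smult a F) = smult (taylor c a) (T F)"
    by (intro poly_eqI) (simp add: T_def coeff_map_taylor taylor_mult)
  have "T (smult a F) = T m * T q + T r"
    unfolding a by (intro poly_eqI) (simp add: T_def coeff_map_taylor taylor_add flip: map_taylor_mult)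
  hence split: "smult (taylor c a) (T F) = T m * T q + T r" using Tsm by simp
  have "poly (smult (taylor c a) (T F)) y = 0" by (simp add: TF poly_monom)
  hence "poly (T r) y = 0" using Pm by (simp add: split P_def)
  hence r0: "r = 0" using r mmin[of r] by (metis P_def leD)
  obtain Z where Z: "finite Z" "\<And>z. z \<in> Z \<Longrightarrow> z ^ d = y ^ d" "monom 1 d - [:y ^ d:] = (\<Prod>z\<in>Z. [:-z, 1:])"
    using prod_roots_of_unity[OF d \<open>y \<noteq> 0\<close>] by blast
  have "T m * T q = smult (taylor c a) (\<Prod>z\<in>Z. [:-z, 1:])"
    using split by (simp add: r0 TF Z(3)) (simp add: T_def)
  then obtain Z' b where Z': "Z' \<subseteq> Z" "T m = smult b (\<Prod>z\<in>Z'. [:-z, 1:])"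
    using factor_of_prod_linear[OF Z(1)] a(1) by (metis taylor_eq_0_iff)
  have fZ': "finite Z'" using Z' Z(1) finite_subset by blast
  have degP: "degree (\<Prod>z\<in>Z'. [:-z, 1:]) = card Z'" by (subst degree_prod_eq_sum_degree) auto
  have "degree (T m) = e" unfolding T_def e_def by (rule degree_map_poly) auto
  moreover have b0: "b \<noteq> 0"
    using Z'(2) mnz by (auto simp: T_def map_poly_eq_0_iff)
  ultimately have cZ': "card Z' = e" using Z'(2) degP by simp
  have "coeff (T m) e = b * coeff (\<Prod>z\<in>Z'. [:-z, 1:]) (degree (\<Prod>z\<in>Z'. [:-z, 1:]))"
    by (simp add: Z'(2) cZ' degP)
  also have "\<dots> = b" by (subst lead_coeff_prod) auto
  finally have bl: "taylor c (coeff m e) = b" by (simp add: T_def coeff_map_taylor)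
  have "taylor c (coeff m 0) = poly (T m) 0" by (simp add: T_def coeff_map_taylor poly_0_coeff_0)
  also have "\<dots> = b * (\<Prod>z\<in>Z'. - z)" by (simp add: Z'(2) poly_prod)
  finally have "taylor c (coeff m 0) ^ d = b ^ d * (\<Prod>z\<in>Z'. (- z) ^ d)"
    by (simp add: power_mult_distrib prod_power_distrib)
  also have "(\<Prod>z\<in>Z'. (- z) ^ d) = (\<Prod>z\<in>Z'. (-1) ^ d * y ^ d)"
    using Z' Z(2) by (intro prod.cong refl) (subst power_minus, auto)
  also have "\<dots> = fps_const ((-1) ^ (d * e)) * (y ^ d) ^ e"
    by (simp add: cZ' power_mult_distrib power_mult flip: fps_const_power fps_const_neg)
  also have "b ^ d * (fps_const ((-1) ^ (d * e)) * (y ^ d) ^ e)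
      = taylor c (smult ((-1) ^ (d * e)) (coeff m e ^ d * f ^ e))"
    by (simp add: bl y taylor_smult taylor_mult taylor_power mult_ac)
  finally have "taylor c (coeff m 0 ^ d - smult ((-1) ^ (d * e)) (coeff m e ^ d * f ^ e)) = 0"
    by (simp add: taylor_diff taylor_power)
  hence "coeff m 0 ^ d = smult ((-1) ^ (d * e)) (coeff m e ^ d * f ^ e)" by simp
  moreover have "coeff m e \<noteq> 0" using mnz by (simp add: e_def)
  ultimately show False using nopow[OF e0 ed] by simp
qed

lemma smult_sum_right: "smult a (\<Sum>x\<in>A. h x) = (\<Sum>x\<in>A. smult a (h x))"
  by (induction A rule: infinite_finite_induct) (simp_all add: smult_add_right)

lemma fps_const_sum: "fps_const (\<Sum>x\<in>A. h x) = (\<Sum>x\<in>A. fps_const (h x))"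
  by (rule fps_ext) (simp add: fps_sum_nth)

text \<open>By counting coefficients there is \<open>\<rho> = (\<Sum>l<d. r l * y ^ l)\<close> with nonzero \<open>r\<close> of degree at most
  \<open>(d - 1) * (A + M)\<close> such that the product of \<open>\<rho>\<close> and the given sum is a polynomial; the order of
  vanishing of a polynomial is at most its degree.\<close>

lemma radical_combination_subdegree:
  fixes f :: "'k::alg_closed_field poly" and y :: "'k fps"
  assumes y: "y ^ d = taylor c f" and M: "degree f \<le> M"
    and indep: "\<And>s j. (\<Sum>j<d. taylor c (s j) * y ^ j) = 0 \<Longrightarrow> j < d \<Longrightarrow> s j = 0"
    and A: "\<And>j. j < d \<Longrightarrow> degree (s j) \<le> A"
  shows "(\<Sum>j<d. taylor c (s j) * y ^ j) = 0 \<or> subdegree (\<Sum>j<d. taylor c (s j) * y ^ j) \<le> d * (A + M)"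
proof (cases "d = 0")
  case False
  hence d0: "d > 0" by simp
  define g where "g = (\<Sum>j<d. taylor c (s j) * y ^ j)"
  define B where "B = (d - 1) * (A + M)"
  \<comment> \<open>\<open>K t m\<close> is the coefficient of y^t in y^m after reduction by y^d =
    f; for m < 2d one reduction suffices. Thus \<open>comp r t\<close> is the coefficient of y^t in
    the product with \<rho>.\<close>
  define K where "K t m = (if m = t then 1 else if m = t + d then f else 0)" for t m :: nat
  define comp where "comp r t = (\<Sum>j<d. \<Sum>l<d. s j * r l * K t (j + l))" for r t
  define I where "I = {..<d} \<times> {..B}"
  define J where "J = {1..<d} \<times> {..A + B + M}"
  define v where "v = (\<lambda>(l, b) (t, n). coeff (\<Sum>j<d. s j * monom 1 b * K t (j + l)) n)"
  \<comment> \<open>The equations kill the coefficients of y^1, ..., y^(d-1) in the product.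
    \<open>B\<close> is chosen so that the unknown coefficients of the \<open>r l\<close> outnumber
    them by exactly one.\<close>
  have "card J = (d - 1) * (A + B + M + 1)" by (simp add: J_def)
  also have "\<dots> = (d - 1) * B + (d - 1) * (A + M) + (d - 1)" by (simp only: distrib_left mult_1_right add_ac)
  also have "\<dots> < d * (B + 1)"
    using d0 by (cases d) (simp_all add: B_def)
  also have "\<dots> = card I" by (simp add: I_def)
  finally have "card J < card I" .
  then obtain \<tau> where \<tau>: "\<exists>k\<in>I. \<tau> k \<noteq> 0" "\<And>j. j \<in> J \<Longrightarrow> (\<Sum>k\<in>I. \<tau> k * v k j) = 0"
    using exists_nontrivial_relation[of J I v] by (auto simp: I_def J_def)
  define r where "r l = (\<Sum>b\<le>B. monom (\<tau> (l, b)) b)" for l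
  have cr: "coeff (r l) b = (if b \<le> B then \<tau> (l, b) else 0)" for l b
    by (simp add: r_def coeff_sum)
  have degr: "degree (r l) \<le> B" for l
    by (intro degree_le) (auto simp: cr)
  have degK: "degree (K t m) \<le> M" for t m using M by (simp add: K_def)
  have degcomp: "degree (comp r t) \<le> A + B + M" for t
    unfolding comp_def
  proof (intro degree_sum_le)
    fix j l assume "j \<in> {..<d}"
    hence "degree (s j) \<le> A" using A by auto
    thus "degree (s j * r l * K t (j + l)) \<le> A + B + M"
      using degr[of l] degK[of t "j + l"] degree_mult_le[of "s j * r l" "K t (j + l)"]
        degree_mult_le[of "s j" "r l"] by linarith
  qed auto
  have comp_eq: "comp r t = (\<Sum>(l, b)\<in>I. smult (\<tau> (l, b)) (\<Sum>j<d. s j * monom 1 b * K t (j + l)))" for t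
  proof -
    have mon: "monom (\<tau> x) b = smult (\<tau> x) (monom 1 b)" for x b
      by (simp add: smult_monom)
    have "comp r t = (\<Sum>j<d. \<Sum>l<d. \<Sum>b\<le>B. smult (\<tau> (l, b)) (s j * monom 1 b * K t (j + l)))"
      unfolding comp_def r_def
      by (intro sum.cong refl) (simp add: mon sum_distrib_left sum_distrib_right del: smult_monom)
    also have "\<dots> = (\<Sum>l<d. \<Sum>b\<le>B. \<Sum>j<d. smult (\<tau> (l, b)) (s j * monom 1 b * K t (j + l)))"
      by (subst sum.swap, rule sum.cong[OF refl], rule sum.swap)
    finally show ?thesis
      by (simp only: I_def smult_sum_right flip: sum.cartesian_product)
  qed
  have comp0: "comp r t = 0" if "t \<in> {1..<d}" for t
  proof (rule poly_eqI)
    fix n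
    show "coeff (comp r t) n = coeff 0 n"
    proof (cases "n \<le> A + B + M")
      case True
      hence "(t, n) \<in> J" using that by (simp add: J_def)
      from \<tau>(2)[OF this] show ?thesis
        by (simp add: comp_eq coeff_sum v_def case_prod_unfold)
    next
      case False
      thus ?thesis using degcomp[of t] by (simp add: coeff_eq_0)
    qed
  qed
  define \<rho> where "\<rho> = (\<Sum>l<d. taylor c (r l) * y ^ l)"
  have ypow: "y ^ m = (\<Sum>t<d. taylor c (K t m) * y ^ t)" if "m < 2 * d" for m
  proof (cases "m < d")
    case True
    have "(\<Sum>t<d. taylor c (K t m) * y ^ t) = (\<Sum>t<d. if t = m then y ^ t else 0)"
      using True by (intro sum.cong) (auto simp: K_def)
    thus ?thesis using True by simp
  next
    case False
    have "(\<Sum>t<d. taylor c (K t m) * y ^ t) = (\<Sum>t<d. if t = m - d then y ^ d * y ^ t else 0)"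
      using False by (intro sum.cong) (auto simp: K_def y)
    also have "\<dots> = y ^ d * y ^ (m - d)" using False that by auto
    finally show ?thesis using False by (simp flip: power_add)
  qed
  have "g * \<rho> = (\<Sum>j<d. \<Sum>l<d. taylor c (s j * r l) * y ^ (j + l))"
    unfolding g_def \<rho>_def sum_product
    by (intro sum.cong refl) (simp add: taylor_mult power_add mult_ac)
  also have "\<dots> = (\<Sum>j<d. \<Sum>l<d. \<Sum>t<d. taylor c (s j * r l * K t (j + l)) * y ^ t)"
    by (intro sum.cong refl, subst ypow) (simp_all add: taylor_mult sum_distrib_left mult_ac)
  also have "\<dots> = (\<Sum>t<d. \<Sum>j<d. \<Sum>l<d. taylor c (s j * r l * K t (j + l)) * y ^ t)"
    by (rule trans[OF sum.cong[OF refl sum.swap] sum.swap])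
  also have "\<dots> = (\<Sum>t<d. taylor c (comp r t) * y ^ t)"
    by (simp add: comp_def taylor_sum sum_distrib_right)
  also have "\<dots> = (\<Sum>t\<in>{0}. taylor c (comp r t) * y ^ t)"
    using comp0 d0 by (intro sum.mono_neutral_right) auto
  finally have g\<rho>: "g * \<rho> = taylor c (comp r 0)" by simp
  have "\<rho> \<noteq> 0"
  proof
    assume "\<rho> = 0"
    hence "r l = 0" if "l < d" for l using indep[of r l] that by (simp add: \<rho>_def)
    hence "\<tau> (l, b) = 0" if "l < d" "b \<le> B" for l b
      using cr[of l b] that by simp
    thus False using \<tau>(1) by (auto simp: I_def)
  qed
  moreover have "A + B + M \<le> d * (A + M)" using d0 by (cases d) (auto simp: B_def)
  moreover have "subdegree (taylor c (comp r 0)) \<le> A + B + M"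
    using subdegree_taylor_le[of c "comp r 0"] degcomp[of 0] by linarith
  ultimately show ?thesis unfolding g_def[symmetric] using g\<rho>
    by (metis add_leD1 le_trans subdegree_mult)
qed auto

text \<open>Gaussian elimination makes the \<open>u k\<close> have distinct subdegrees; then the terms \<open>g k * u k ^ R\<close>
  have distinct subdegrees as well.\<close>

lemma frobenius_independent:
  fixes g u :: "'i \<Rightarrow> 'k::field fps"
  assumes "finite I" and R: "\<And>x y :: 'k fps. (x + y) ^ R = x ^ R + y ^ R"
    and "\<And>t. (\<Sum>k\<in>I. fps_const (t k) * u k) = 0 \<Longrightarrow> \<forall>k\<in>I. t k = 0"
    and "\<And>t. (\<Sum>k\<in>I. fps_const (t k) * g k) = 0 \<or> subdegree (\<Sum>k\<in>I. fps_const (t k) * g k) < R"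
    and "(\<Sum>k\<in>I. g k * u k ^ R) = 0"
  shows "\<forall>k\<in>I. g k = 0"
  using assms(1,3-)
proof (induction "card I" arbitrary: I g u)
  case 0
  thus ?case by auto
next
  case (Suc n)
  have indep: "\<forall>k\<in>I. t k = 0" if "(\<Sum>k\<in>I. fps_const (t k) * u k) = 0" for t
    using Suc.prems(2) that by blast
  have sub: "(\<Sum>k\<in>I. fps_const (t k) * g k) = 0 \<or> subdegree (\<Sum>k\<in>I. fps_const (t k) * g k) < R" for t
    using Suc.prems(3) by blast
  have fin: "finite I" by fact
  have "I \<noteq> {}" using Suc.hyps(2) by auto
  define k0 where "k0 = arg_min_on (\<lambda>k. subdegree (u k)) I"
  have k0: "k0 \<in> I" "\<And>k. k \<in> I \<Longrightarrow> subdegree (u k0) \<le> subdegree (u k)"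
    using arg_min_if_finite[OF fin \<open>I \<noteq> {}\<close>, of "\<lambda>k. subdegree (u k)"]
    by (auto simp: k0_def not_less)
  have fin': "finite (I - {k0})" using fin by simp
  have u0: "u k0 \<noteq> 0"
  proof
    assume "u k0 = 0"
    hence "(\<Sum>k\<in>I. fps_const (if k = k0 then 1 else 0) * u k) = 0" by (intro sum.neutral) auto
    from indep[OF this] k0 show False by auto
  qed
  define N where "N = subdegree (u k0)"
  \<comment> \<open>Since \<open>u k0\<close> has minimal subdegree N, subtracting
    \<open>c k\<close> times it removes coefficient N from every \<open>u k\<close>. Additivity of
    R-th powers moves the removed parts into \<open>g'\<close>, with coefficients
    \<open>c k ^ R\<close>.\<close>
  define c where "c k = u k $ N / u k0 $ N" for k
  define u' where "u' k = u k - fps_const (c k) * u k0" for k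
  define g' where "g' = (\<Sum>k\<in>I. fps_const (c k ^ R) * g k)"
  have uN: "u k0 $ N \<noteq> 0" using u0 by (simp add: N_def)
  have "c k0 = 1" using uN by (simp add: c_def)
  have split: "(\<Sum>k\<in>I. h k) = h k0 + (\<Sum>k\<in>I-{k0}. h k)" for h :: "'i \<Rightarrow> 'k fps"
    using fin k0(1) by (rule sum.remove)
  have uR: "u k ^ R = u' k ^ R + fps_const (c k ^ R) * u k0 ^ R" for k
    using R[of "u' k" "fps_const (c k) * u k0"] by (simp add: u'_def power_mult_distrib fps_const_power)
  have "0 = (\<Sum>k\<in>I. g k * u k ^ R)" using Suc.prems by simp
  also have "\<dots> = g k0 * u k0 ^ R + (\<Sum>k\<in>I-{k0}. g k * u' k ^ R + fps_const (c k ^ R) * g k * u k0 ^ R)"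
    unfolding split by (intro arg_cong2[of _ _ _ _ "(+)"] sum.cong refl)
      (subst uR, simp add: algebra_simps)
  also have "\<dots> = g' * u k0 ^ R + (\<Sum>k\<in>I-{k0}. g k * u' k ^ R)"
    unfolding g'_def split by (simp add: \<open>c k0 = 1\<close> sum.distrib distrib_right add_ac flip: sum_distrib_right)
  finally have rel: "g' * u k0 ^ R + (\<Sum>k\<in>I-{k0}. g k * u' k ^ R) = 0" by simp
  have u'dvd: "fps_X ^ Suc N dvd u' k" if "k \<in> I" for k
  proof -
    have "u' k $ i = 0" if "i < Suc N" for i
    proof (cases "i = N")
      case True
      thus ?thesis using uN by (simp add: u'_def c_def)
    next
      case False
      hence "i < subdegree (u k0)" "i < subdegree (u k)"
        using that k0(2)[OF \<open>k \<in> I\<close>] by (auto simp: N_def)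
      hence "u k0 $ i = 0" "u k $ i = 0" by (auto intro: nth_less_subdegree_zero)
      thus ?thesis by (simp add: u'_def)
    qed
    hence "u' k = 0 \<or> Suc N \<le> subdegree (u' k)" by (metis not_less subdegree_geI)
    thus ?thesis
    proof
      assume "Suc N \<le> subdegree (u' k)"
      hence "u' k = 0 \<or> fps_X ^ Suc N dvd u' k"
        by (subst fps_dvd_iff) (auto simp: fps_X_power_subdegree simp del: power_Suc)
      thus ?thesis by auto
    qed simp
  qed
  \<comment> \<open>All other terms are divisible by X^((N+1)R), while a nonzero
    \<open>g' * u k0 ^ R\<close> has subdegree below R + N R, because \<open>g'\<close> is a
    constant combination of the \<open>g k\<close>.\<close>
  have "g' = 0"
  proof (rule ccontr)
    assume g'0: "g' \<noteq> 0"
    have "fps_X ^ (Suc N * R) dvd (\<Sum>k\<in>I-{k0}. g k * u' k ^ R)"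
    proof (intro dvd_sum dvd_mult)
      fix k assume "k \<in> I - {k0}"
      thus "fps_X ^ (Suc N * R) dvd u' k ^ R"
        using u'dvd dvd_power_same unfolding power_mult by blast
    qed
    hence "fps_X ^ (Suc N * R) dvd g' * u k0 ^ R"
      using rel by (simp only: add_eq_0_iff2 dvd_minus_iff)
    moreover have nz: "g' * u k0 ^ R \<noteq> 0" using g'0 u0 by simp
    ultimately have "subdegree (fps_X ^ (Suc N * R) :: 'k fps) \<le> subdegree (g' * u k0 ^ R)"
      by (intro dvd_imp_subdegree_le)
    hence "Suc N * R \<le> subdegree (g' * u k0 ^ R)" by (simp only: fps_X_power_subdegree)
    also have "\<dots> = subdegree g' + R * N" using g'0 u0 by (simp add: N_def)
    also have "\<dots> < R + R * N"
      using sub[of "\<lambda>k. c k ^ R"] g'0 by (simp add: g'_def)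
    finally show False by (simp add: algebra_simps)
  qed
  have "\<forall>k\<in>I-{k0}. g k = 0"
  proof (rule Suc.hyps(1)[OF _ fin'])
    show "n = card (I - {k0})" using Suc.hyps(2) k0 fin by simp
    show "(\<Sum>k\<in>I-{k0}. g k * u' k ^ R) = 0" using rel \<open>g' = 0\<close> by simp
  next
    fix t assume t: "(\<Sum>k\<in>I-{k0}. fps_const (t k) * u' k) = 0"
    define t' where "t' = t(k0 := - (\<Sum>k\<in>I-{k0}. t k * c k))"
    have "(\<Sum>k\<in>I. fps_const (t' k) * u k)
        = fps_const (t' k0) * u k0 + (\<Sum>k\<in>I-{k0}. fps_const (t k) * u k)"
      unfolding split by (intro arg_cong2[of _ _ _ _ "(+)"] sum.cong refl) (auto simp: t'_def)
    also have "fps_const (t' k0) = - (\<Sum>k\<in>I-{k0}. fps_const (t k * c k))"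
      by (simp add: t'_def fps_const_sum flip: fps_const_neg)
    also have "- (\<Sum>k\<in>I-{k0}. fps_const (t k * c k)) * u k0 + (\<Sum>k\<in>I-{k0}. fps_const (t k) * u k)
       = (\<Sum>k\<in>I-{k0}. fps_const (t k) * u' k)"
      by (simp add: u'_def algebra_simps sum_subtractf sum_distrib_right sum_distrib_left flip: fps_const_mult)
    finally have "\<forall>k\<in>I. t' k = 0" using t indep by simp
    thus "\<forall>k\<in>I-{k0}. t k = 0" by (auto simp: t'_def split: if_splits)
  next
    fix t
    have "(\<Sum>k\<in>I. fps_const ((t(k0 := 0)) k) * g k) = (\<Sum>k\<in>I-{k0}. fps_const (t k) * g k)"
      unfolding split by simp
    thus "(\<Sum>k\<in>I-{k0}. fps_const (t k) * g k) = 0 \<or> subdegree (\<Sum>k\<in>I-{k0}. fps_const (t k) * g k) < R"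
      using sub[of "t(k0 := 0)"] by simp
  qed
  moreover from this have "g' = g k0" unfolding g'_def split using \<open>c k0 = 1\<close> by simp
  ultimately show ?case using \<open>g' = 0\<close> by auto
qed

section \<open>Stepanov's method\<close>

lemma infinite_alg_closed_field: "infinite (UNIV :: 'k::alg_closed_field set)"
proof
  assume fin: "finite (UNIV :: 'k set)"
  let ?P = "\<Prod>a\<in>(UNIV :: 'k set). [:-a, 1:]"
  have "degree ?P = card (UNIV :: 'k set)" by (subst degree_prod_eq_sum_degree) auto
  hence "degree ?P > 0" using fin by (simp add: card_gt_0_iff)
  hence "degree (?P + 1) > 0" by (subst degree_add_eq_left) auto
  then obtain x where "poly (?P + 1) x = 0" using alg_closed_imp_poly_has_root by blast
  moreover have "poly ?P x = 0" using fin by (auto simp: poly_prod prod_zero_iff)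
  ultimately show False by simp
qed

text \<open>Since R = dw + 1, multiplying f^(jw) = y^(djw) by y^(d-1) gives y^(d-1-j) (y^j)^R, and
  x^(iR) is an R-th power too. So \<open>frobenius_independent\<close> applies to the elements x^i
  y^j, which are independent over the constants, with coefficients s_ij y^(d-1-j); \<open>AM\<close>
  keeps nonzero constant combinations of the latter from vanishing to order R.\<close>

lemma stepanov_nonzero:
  fixes f :: "'k::alg_closed_field poly"
  assumes char: "prime CHAR('k)" and R: "R = CHAR('k) ^ a" "R = d * w + 1"
    and d: "of_nat d \<noteq> (0 :: 'k)" and f: "f \<noteq> 0"
    and nopow: "\<And>e u v b. 0 < e \<Longrightarrow> e < d \<Longrightarrow> v \<noteq> 0 \<Longrightarrow> b \<noteq> 0 \<Longrightarrow> u ^ d \<noteq> smult b (v ^ d * f ^ e)"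
    and A: "\<And>i j. degree (s i j) \<le> A" and AM: "d * (A + degree f) < R"
    and rel: "(\<Sum>i\<le>B. \<Sum>j<d. s i j * monom 1 (i * R) * f ^ (j * w)) = 0"
    and ij: "i \<le> B" "j < d"
  shows "s i j = 0"
proof -
  have "infinite (UNIV :: 'k set)" by (rule infinite_alg_closed_field)
  hence "{x. poly f x = 0} \<noteq> UNIV" using poly_roots_finite[OF f] by metis
  then obtain c where c: "poly f c \<noteq> 0" by blast
  then obtain y where y: "y ^ d = taylor c f"
    using fps_root_exists[of "taylor c f" d] d by (auto simp: taylor_nth_0)
  have d0: "d > 0" using ij by simp
  hence ynz: "y \<noteq> 0" using y f by (metis power_eq_0_iff taylor_eq_0_iff)
  have indep: "r j = 0" if "(\<Sum>j<d. taylor c (r j) * y ^ j) = 0" "j < d" for r j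
    by (rule radical_independent[OF y d f nopow that])
  define I where "I = {..B} \<times> {..<d}"
  define u where "u = (\<lambda>(i, j). taylor c (monom 1 i) * y ^ j)"
  define g where "g = (\<lambda>(i, j). taylor c (s i j) * y ^ (d - 1 - j))"
  have "\<forall>k\<in>I. g k = 0"
  proof (rule frobenius_independent)
    show "finite I" by (simp add: I_def)
    show "(x + y) ^ R = x ^ R + y ^ R" for x y :: "'k fps"
      using char R by (intro freshmans_dream') auto
  next
    fix t assume t: "(\<Sum>k\<in>I. fps_const (t k) * u k) = 0"
    have "(\<Sum>k\<in>I. fps_const (t k) * u k) = (\<Sum>j<d. \<Sum>i\<le>B. fps_const (t (i, j)) * (taylor c (monom 1 i) * y ^ j))"
      unfolding I_def by (subst sum.swap) (simp add: u_def sum.cartesian_product case_prod_unfold)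
    also have "\<dots> = (\<Sum>j<d. taylor c (\<Sum>i\<le>B. smult (t (i, j)) (monom 1 i)) * y ^ j)"
      by (simp add: taylor_sum taylor_smult sum_distrib_right sum_distrib_left mult_ac del: smult_monom)
    finally have "(\<Sum>i\<le>B. smult (t (i, j)) (monom 1 i)) = 0" if "j < d" for j
      using indep[of "\<lambda>j. \<Sum>i\<le>B. smult (t (i, j)) (monom 1 i)" j] t that by simp
    hence "coeff (\<Sum>i\<le>B. smult (t (i, j)) (monom 1 i)) i = 0" if "j < d" for i j
      using that by simp
    hence "(if i \<le> B then t (i, j) else 0) = 0" if "j < d" for i j
      using that by (simp add: coeff_sum smult_monom del: coeff_smult)
    hence "t (i, j) = 0" if "j < d" "i \<le> B" for i j
      using that by metis
    thus "\<forall>k\<in>I. t k = 0" by (auto simp: I_def)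
  next
    fix t
    \<comment> \<open>Replacing j by d-1-j presents the combination in the powers y^j, the form that
      \<open>radical_combination_subdegree\<close> bounds.\<close>
    define S where "S j = (\<Sum>i\<le>B. smult (t (i, d - 1 - j)) (s i (d - 1 - j)))" for j
    have "(\<Sum>k\<in>I. fps_const (t k) * g k) = (\<Sum>j<d. \<Sum>i\<le>B. fps_const (t (i, j)) * (taylor c (s i j) * y ^ (d - 1 - j)))"
      unfolding I_def by (subst sum.swap) (simp add: g_def sum.cartesian_product case_prod_unfold)
    also have "\<dots> = (\<Sum>j<d. \<Sum>i\<le>B. fps_const (t (i, d - Suc j)) * (taylor c (s i (d - Suc j)) * y ^ (d - 1 - (d - Suc j))))"
      by (rule sum.nat_diff_reindex[symmetric])
    also have "\<dots> = (\<Sum>j<d. taylor c (S j) * y ^ j)"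
      by (intro sum.cong refl)
        (simp add: S_def taylor_sum taylor_smult sum_distrib_right sum_distrib_left mult_ac)
    finally have *: "(\<Sum>k\<in>I. fps_const (t k) * g k) = (\<Sum>j<d. taylor c (S j) * y ^ j)" .
    have "degree (S j) \<le> A" for j
      unfolding S_def using A by (intro degree_sum_le) (auto intro: le_trans[OF degree_smult_le])
    hence "(\<Sum>j<d. taylor c (S j) * y ^ j) = 0
        \<or> subdegree (\<Sum>j<d. taylor c (S j) * y ^ j) \<le> d * (A + degree f)"
      by (intro radical_combination_subdegree[OF y] indep) auto
    thus "(\<Sum>k\<in>I. fps_const (t k) * g k) = 0 \<or> subdegree (\<Sum>k\<in>I. fps_const (t k) * g k) < R"
      unfolding * using AM by linarith
  next
    have "(\<Sum>k\<in>I. g k * u k ^ R) = (\<Sum>i\<le>B. \<Sum>j<d. y ^ (d - 1) * taylor c (s i j * monom 1 (i * R) * f ^ (j * w)))"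
      unfolding I_def sum.cartesian_product
    proof (intro sum.cong refl)
      fix k assume "k \<in> {..B} \<times> {..<d}"
      then obtain i j where k: "k = (i, j)" "j < d" by auto
      have "y ^ (d - 1 - j) * y ^ (j * R) = y ^ (d - 1) * (y ^ d) ^ (j * w)"
      proof -
        have "d - 1 - j + j * R = d - 1 + d * (j * w)" using k R(2) by (simp add: algebra_simps)
        thus ?thesis by (simp only: flip: power_add power_mult)
      qed
      moreover have "taylor c (monom 1 i) ^ R = taylor c (monom 1 (i * R))"
        by (simp add: monom_power flip: taylor_power)
      ultimately show "g k * u k ^ R = (case k of (i, j) \<Rightarrow> y ^ (d - 1) * taylor c (s i j * monom 1 (i * R) * f ^ (j * w)))"
        by (simp add: k g_def u_def power_mult_distrib taylor_mult y taylor_power mult_ac flip: power_mult)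
    qed
    also have "\<dots> = y ^ (d - 1) * taylor c (\<Sum>i\<le>B. \<Sum>j<d. s i j * monom 1 (i * R) * f ^ (j * w))"
      by (simp add: taylor_sum sum_distrib_left)
    finally show "(\<Sum>k\<in>I. g k * u k ^ R) = 0" by (simp add: rel)
  qed
  hence "g (i, j) = 0" using ij by (auto simp: I_def)
  thus ?thesis using ynz by (simp add: g_def)
qed

text \<open>Raising the auxiliary polynomial \<open>E\<close> to the power \<open>R'\<close> turns \<open>x ^ (i * R)\<close> into \<open>x ^ i\<close> at points
  with \<open>x ^ (R * R') = x\<close>. So \<open>E\<close>, whose degree is about \<open>R * R' / d\<close>, vanishes on the whole set as soon
  as a polynomial of degree about \<open>A * R'\<close> is zero, and no multiplicities are needed.\<close>

lemma stepanov_bound: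
  fixes f :: "'k::alg_closed_field poly"
  assumes char: "prime CHAR('k)" and R: "R = CHAR('k) ^ m" "R = d * w + 1"
    and R': "R' = CHAR('k) ^ m'" "R' = d * w' + 1" "R' \<le> R"
    and d: "of_nat d \<noteq> (0 :: 'k)" and f: "f \<noteq> 0"
    and nopow: "\<And>e u v b. 0 < e \<Longrightarrow> e < d \<Longrightarrow> v \<noteq> 0 \<Longrightarrow> b \<noteq> 0 \<Longrightarrow> u ^ d \<noteq> smult b (v ^ d * f ^ e)"
    and large: "R \<le> 2 * d * (w - degree f)" and a: "a \<noteq> 0"
  shows "d * card {x. x ^ (R * R') = x \<and> poly f x ^ (R' * w + w') = a}
    \<le> R * R' + d * (3 * degree f + 3) * R"
proof -
  define M where "M = degree f"
  \<comment> \<open>\<open>A\<close> is as large as \<open>stepanov_nonzero\<close> permits. In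
    \<open>B\<close>, w' is about R'/d and gives the main term; the surplus \<open>c\<close>
    outweighs the degree M R' of the powers of f, because R' <= R <= 2 d A.\<close>
  define A where "A = w - M"
  define c where "c = 2 * M + 2"
  define B where "B = w' + c"
  define D where "D = A * R' + B + M * R'"
  \<comment> \<open>At the points to be counted x^(RR') = x and f(x)^(R'w + w') = a, where R'w + w'
    = (RR' - 1)/d. There f^(jwR') equals a^j f^(-jw'), and a factor f^((d-1)w') clears the negative
    exponents: \<open>V (i, j, l)\<close> is the resulting term of E^R' f^((d-1)w').\<close>
  define V where "V = (\<lambda>(i, j, l). smult (a ^ j) (monom 1 (l * R' + i) * f ^ ((d - 1 - j) * w')))"
  define I where "I = {..B} \<times> {..<d} \<times> {..A}"
  have d0: "d > 0" using d by (cases d) auto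
  have Rpos: "R > 0" using R(2) by simp
  hence "w - M \<noteq> 0" using large unfolding M_def by (metis le_zero_eq mult_0_right not_gr_zero)
  hence A0: "A > 0" by (simp add: A_def)
  have "(M + 1) * R' \<le> (M + 1) * R" using R'(3) by (rule mult_left_mono) simp
  also have "\<dots> \<le> (M + 1) * (2 * d * A)" using large unfolding A_def M_def by (rule mult_left_mono) simp
  also have "\<dots> = A * d * c" by (simp add: c_def algebra_simps)
  finally have Adc: "A * d * c \<ge> M * R' + R'" by simp
  have "card {..D} < card I"
  proof -
    have "card I = (B + 1) * (d * (A + 1))" by (simp add: I_def)
    also have "\<dots> = A * (d * w') + A * d * c + A * d + d * w' + d * c + d"
      by (simp add: B_def algebra_simps)
    finally have I: "card I = A * (d * w') + A * d * c + A * d + d * w' + d * c + d" .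
    have "A \<le> A * d" "w' \<le> d * w'" "c \<le> d * c" using d0 by simp_all
    moreover have "D = A * (d * w') + A + w' + c + M * R'" by (simp add: D_def B_def R'(2))
    moreover have "R' = d * w' + 1" by (fact R'(2))
    ultimately show ?thesis unfolding I card_atMost using Adc d0 by linarith
  qed
  then obtain \<tau> where \<tau>: "\<exists>k\<in>I. \<tau> k \<noteq> 0" "\<And>n. n \<in> {..D} \<Longrightarrow> (\<Sum>k\<in>I. \<tau> k * coeff (V k) n) = 0"
    using exists_nontrivial_relation[of "{..D}" I "\<lambda>k. coeff (V k)"] by (auto simp: I_def)
  have degV: "degree (V k) \<le> D" if "k \<in> I" for k
  proof -
    obtain i j l where k: "k = (i, j, l)" by (cases k)
    have *: "i \<le> B" "l \<le> A" using that by (auto simp: k I_def)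
    have "(d - 1 - j) * w' \<le> d * w'" by (intro mult_right_mono) auto
    also have "\<dots> \<le> R'" using R'(2) by simp
    finally have "(d - 1 - j) * w' * M \<le> R' * M" by (rule mult_right_mono) auto
    moreover have "degree (V k) \<le> (l * R' + i) + (d - 1 - j) * w' * M"
    proof -
      have "degree (f ^ ((d - 1 - j) * w')) \<le> (d - 1 - j) * w' * M"
        using degree_power_le[of f "(d - 1 - j) * w'"] by (simp add: M_def mult_ac)
      moreover have "degree (monom 1 (l * R' + i) :: 'k poly) = l * R' + i" by (simp add: degree_monom_eq)
      ultimately show ?thesis
        using degree_mult_le[of "monom 1 (l * R' + i)" "f ^ ((d - 1 - j) * w')"]
          degree_smult_le[of "a ^ j" "monom 1 (l * R' + i) * f ^ ((d - 1 - j) * w')"]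
        unfolding k V_def by simp
    qed
    moreover have "l * R' \<le> A * R'" using * by simp
    moreover have "R' * M = M * R'" by simp
    ultimately show ?thesis using * unfolding D_def by linarith
  qed
  have Vsum: "(\<Sum>k\<in>I. smult (\<tau> k) (V k)) = 0"
  proof (rule poly_eqI)
    fix n
    show "coeff (\<Sum>k\<in>I. smult (\<tau> k) (V k)) n = coeff 0 n"
    proof (cases "n \<le> D")
      case True
      thus ?thesis using \<tau>(2)[of n] by (simp add: coeff_sum)
    next
      case False
      have "degree (\<Sum>k\<in>I. smult (\<tau> k) (V k)) \<le> D"
        using degV by (intro degree_sum_le) (auto simp: I_def intro: le_trans[OF degree_smult_le])
      thus ?thesis using False by (simp add: coeff_eq_0)
    qed
  qed
  have R'pos: "R' > 0" using R'(2) by simp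
  \<comment> \<open>Raising to the power R' is additive but not linear, so the system was solved for
    the R'-th powers of the coefficients of \<open>E\<close>; the roots are taken
    afterwards.\<close>
  have "\<exists>z. z ^ R' = \<tau> k" for k using nth_root_exists[OF R'pos] by blast
  then obtain \<sigma> where \<sigma>: "\<And>k. \<sigma> k ^ R' = \<tau> k" by metis
  define s where "s i j = (\<Sum>l\<le>A. monom (\<sigma> (i, j, l)) l)" for i j
  have cs: "coeff (s i j) l = (if l \<le> A then \<sigma> (i, j, l) else 0)" for i j l
    by (simp add: s_def coeff_sum)
  have degs: "degree (s i j) \<le> A" for i j by (intro degree_le) (auto simp: cs)
  define E where "E = (\<Sum>i\<le>B. \<Sum>j<d. s i j * monom 1 (i * R) * f ^ (j * w))"
  have "E \<noteq> 0"
  proof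
    assume E0: "E = 0"
    have "d * (A + degree f) < R"
      using A0 R(2) by (simp add: A_def M_def)
    have "s i j = 0" if "i \<le> B" "j < d" for i j
      by (rule stepanov_nonzero[OF char R d f nopow degs \<open>d * (A + degree f) < R\<close> E0[unfolded E_def] that])
    hence "\<sigma> (i, j, l) = 0" if "i \<le> B" "j < d" "l \<le> A" for i j l
      using cs[of i j l] that by simp
    hence "\<tau> k = 0" if "k \<in> I" for k
      using that \<sigma>[of k] R'pos by (auto simp: I_def power_0_left)
    thus False using \<tau>(1) by blast
  qed
  have "degree E \<le> A + B * R + M * (d * w)"
    unfolding E_def
  proof (intro degree_sum_le)
    fix i j assume ij: "i \<in> {..B}" "j \<in> {..<d}"
    have "degree (f ^ (j * w)) \<le> j * w * M"
      using degree_power_le[of f "j * w"] by (simp add: M_def mult_ac)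
    also have "\<dots> \<le> M * (d * w)" using ij by (simp add: mult_ac)
    finally have 1: "degree (f ^ (j * w)) \<le> M * (d * w)" .
    have "degree (monom 1 (i * R) :: 'k poly) \<le> B * R" using ij by (simp add: degree_monom_eq)
    with 1 degs[of i j] show "degree (s i j * monom 1 (i * R) * f ^ (j * w)) \<le> A + B * R + M * (d * w)"
      using degree_mult_le[of "s i j * monom 1 (i * R)" "f ^ (j * w)"]
        degree_mult_le[of "s i j" "monom 1 (i * R)"] by linarith
  qed auto
  define pts where "pts = {x. x ^ (R * R') = x \<and> poly f x ^ (R' * w + w') = a}"
  have "pts \<subseteq> {x. poly E x = 0}"
  proof
    fix x assume "x \<in> pts"
    hence x: "x ^ (R * R') = x" "poly f x ^ (R' * w + w') = a" by (auto simp: pts_def)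
    have w0: "w > 0" using A0 by (simp add: A_def)
    have fx: "poly f x \<noteq> 0" using x(2) a w0 R'pos by (auto simp: power_0_left)
    have dream: "(\<Sum>i\<in>S. h i) ^ R' = (\<Sum>i\<in>S. h i ^ R')" for h :: "nat \<Rightarrow> 'k" and S
      by (rule freshmans_dream_sum'[OF char R'(1)])
    have "poly E x ^ R' = (\<Sum>i\<le>B. \<Sum>j<d. \<Sum>l\<le>A. \<tau> (i, j, l) * x ^ (l * R') * x ^ i * poly f x ^ (j * w * R'))"
    proof -
      have xi: "x ^ (i * R * R') = x ^ i" for i
        using x(1) by (metis mult.assoc mult.commute power_mult)
      have "(\<sigma> (i, j, l) * x ^ l) ^ R' = \<tau> (i, j, l) * x ^ (l * R')" for i j l
        by (simp add: power_mult_distrib \<sigma> power_mult)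
      hence "poly (s i j) x ^ R' = (\<Sum>l\<le>A. \<tau> (i, j, l) * x ^ (l * R'))" for i j
        by (simp add: s_def poly_sum poly_monom dream)
      thus ?thesis
        by (simp add: E_def poly_sum dream power_mult_distrib poly_monom xi sum_distrib_right
            flip: power_mult)
    qed
    hence "poly E x ^ R' * poly f x ^ ((d - 1) * w')
      = (\<Sum>i\<le>B. \<Sum>j<d. \<Sum>l\<le>A. \<tau> (i, j, l) * x ^ (l * R') * x ^ i * poly f x ^ (j * w * R') * poly f x ^ ((d - 1) * w'))"
      by (simp only: sum_distrib_right)
    also have "\<dots> = (\<Sum>i\<le>B. \<Sum>j<d. \<Sum>l\<le>A. poly (smult (\<tau> (i, j, l)) (V (i, j, l))) x)"
    proof (intro sum.cong refl)
      fix i j l assume "j \<in> {..<d}"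
      hence "(d - 1) * w' = j * w' + (d - 1 - j) * w'" by (simp flip: add_mult_distrib)
      hence "poly f x ^ (j * w * R') * poly f x ^ ((d - 1) * w')
        = (poly f x ^ (R' * w + w')) ^ j * poly f x ^ ((d - 1 - j) * w')"
        by (simp add: algebra_simps flip: power_add power_mult)
      thus "\<tau> (i, j, l) * x ^ (l * R') * x ^ i * poly f x ^ (j * w * R') * poly f x ^ ((d - 1) * w')
        = poly (smult (\<tau> (i, j, l)) (V (i, j, l))) x"
        unfolding x(2) by (simp add: V_def poly_monom power_add mult_ac)
    qed
    also have "\<dots> = poly (\<Sum>k\<in>I. smult (\<tau> k) (V k)) x"
      by (simp only: I_def poly_sum sum.cartesian_product case_prod_unfold prod.collapse)
    also have "\<dots> = 0" by (simp add: Vsum)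
    finally show "x \<in> {x. poly E x = 0}" using fx by simp
  qed
  hence "card pts \<le> card {x. poly E x = 0}"
    using \<open>E \<noteq> 0\<close> by (intro card_mono poly_roots_finite)
  also have "\<dots> \<le> degree E" using \<open>E \<noteq> 0\<close> by (rule card_poly_roots_bound)
  also have "\<dots> \<le> A + B * R + M * (d * w)" by fact
  \<comment> \<open>Beyond w' R, one R comes from \<open>A\<close>, 2M + 2 from the surplus
    \<open>c\<close>, and M from the powers of f.\<close>
  also have "\<dots> \<le> w' * R + (3 * M + 3) * R"
  proof -
    have "w \<le> d * w" using d0 by simp
    hence "A \<le> R" using R(2) diff_le_self[of w M] unfolding A_def by linarith
    moreover have "M * (d * w) \<le> M * R" using R(2) by simp
    ultimately have "A + B * R + M * (d * w) \<le> R + B * R + M * R" by linarith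
    also have "\<dots> = w' * R + (3 * M + 3) * R" by (simp add: B_def c_def algebra_simps)
    finally show ?thesis .
  qed
  finally have "d * card pts \<le> d * (w' * R + (3 * M + 3) * R)" by simp
  also have "\<dots> = (d * w') * R + d * (3 * M + 3) * R" by (simp add: algebra_simps)
  also have "\<dots> \<le> R * R' + d * (3 * M + 3) * R" by (simp add: R'(2))
  finally show ?thesis by (simp add: pts_def M_def)
qed

section \<open>The L-function of a character family\<close>

lemma sum_order_alg_closed:
  fixes p :: "'k::alg_closed_field poly"
  assumes "p \<noteq> 0"
  shows "(\<Sum>x | poly p x = 0. order x p) = degree p"
proof -
  obtain A where A: "size A = degree p" "p = smult (lead_coeff p) (\<Prod>x\<in>#A. [:-x, 1:])"
    using alg_closed_imp_factorization[OF assms] by blast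
  have "(\<Prod>x\<in>#A. [:-x, 1:]) \<noteq> 0 \<and> proots (\<Prod>x\<in>#A. [:-x, 1:]) = A" for A :: "'k multiset"
    by (induction A) (auto simp: proots_mult simp del: mult_pCons_left)
  moreover have "proots p = proots (\<Prod>x\<in>#A. [:-x, 1:])"
    by (subst A(2)) (use assms in simp)
  ultimately have "size (proots p) = degree p" using A by simp
  thus ?thesis using assms by (simp add: size_multiset_overloaded_eq)
qed

lemma prod_lessThan_add: "(\<Prod>i<m+n. h i) = (\<Prod>i<m. h i) * (\<Prod>i<n. h (m + i))" for m n :: nat
  by (induction n) (simp_all add: mult.assoc)

section \<open>Frobenius acting on polynomials and on their roots\<close>

locale frobenius_field =
  fixes q r :: nat and ty :: "'k::alg_closed_field itself"
  assumes char: "prime CHAR('k)" and q_def: "q = CHAR('k) ^ r" and r: "r > 0"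
begin

text \<open>The condition \<open>frob h = h\<close> encodes that h has coefficients in F_q.\<close>

definition frob :: "'k poly \<Rightarrow> 'k poly" where "frob = map_poly (\<lambda>z. z ^ q)"

definition fixed :: "nat \<Rightarrow> 'k set" where "fixed m = {x. x ^ (q ^ m) = x}"

lemma q_gt_1: "q > 1"
  unfolding q_def using prime_gt_1_nat[OF char] r by (rule one_less_power)

lemma q_power: "q ^ m = CHAR('k) ^ (r * m)"
  by (simp add: q_def power_mult)

lemma add_power_q: "(x + y :: 'k) ^ (q ^ m) = x ^ (q ^ m) + y ^ (q ^ m)"
  by (rule freshmans_dream'[OF char q_power])

lemma sum_power_q: "(\<Sum>x\<in>A. h x :: 'k) ^ (q ^ m) = (\<Sum>x\<in>A. h x ^ (q ^ m))"
  by (rule freshmans_dream_sum'[OF char q_power])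

lemma uminus_power_q: "(- x :: 'k) ^ (q ^ m) = - (x ^ (q ^ m))"
proof -
  have "x ^ (q ^ m) + (- x) ^ (q ^ m) = 0"
    using add_power_q[of x "-x" m] q_gt_1 by (simp add: power_0_left)
  thus ?thesis by (simp add: eq_neg_iff_add_eq_0 add.commute)
qed

lemma diff_power_q: "(x - y :: 'k) ^ (q ^ m) = x ^ (q ^ m) - y ^ (q ^ m)"
  using add_power_q[of x "-y" m] by (simp add: uminus_power_q)

lemma power_q_inj: "(x :: 'k) ^ (q ^ m) = y ^ (q ^ m) \<Longrightarrow> x = y"
  using diff_power_q[of x y m] by simp

lemmas add_power_q1 = add_power_q[where m = 1, unfolded power_one_right]
  and sum_power_q1 = sum_power_q[where m = 1, unfolded power_one_right]
  and uminus_power_q1 = uminus_power_q[where m = 1, unfolded power_one_right]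

lemma fixed_closed:
  "0 \<in> fixed m" "1 \<in> fixed m" "x \<in> fixed m \<Longrightarrow> - x \<in> fixed m"
  "x \<in> fixed m \<Longrightarrow> y \<in> fixed m \<Longrightarrow> x + y \<in> fixed m"
  "x \<in> fixed m \<Longrightarrow> y \<in> fixed m \<Longrightarrow> x - y \<in> fixed m"
  "x \<in> fixed m \<Longrightarrow> y \<in> fixed m \<Longrightarrow> x * y \<in> fixed m"
  "x \<in> fixed m \<Longrightarrow> y \<in> fixed m \<Longrightarrow> x / y \<in> fixed m"
  "x \<in> fixed m \<Longrightarrow> x ^ k \<in> fixed m"
  using q_gt_1
  by (auto simp: fixed_def add_power_q diff_power_q uminus_power_q power_0_left power_mult_distrib
      power_divide power_commutes) (metis mult.commute power_mult)

lemma card_fixed: "m > 0 \<Longrightarrow> card (fixed m) = q ^ m"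
proof -
  assume m: "m > 0"
  let ?p = "monom 1 (q ^ m) - [:0, 1:] :: 'k poly"
  have Q: "q ^ m > 1" using q_gt_1 m by (rule one_less_power)
  have deg: "degree ?p = q ^ m"
    using Q q_gt_1 m by (intro antisym degree_le le_degree)
      (auto simp: coeff_eq_0 coeff_pCons degree_monom_eq split: nat.splits)
  have "of_nat (q ^ m) = (0 :: 'k)"
    using r m by (auto simp: q_def of_nat_eq_0_iff_char_dvd simp flip: power_mult intro!: dvd_power)
  hence "pderiv ?p = -1"
    by (simp add: pderiv_diff pderiv_monom pderiv_pCons one_pCons del: of_nat_power)
  hence "card {x. poly ?p x = 0} = degree ?p"
    using q_gt_1 m deg by (intro card_roots_separable) auto
  thus ?thesis by (simp add: deg fixed_def poly_monom)
qed

lemma finite_fixed: "m > 0 \<Longrightarrow> finite (fixed m)"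
  using card_fixed[of m] q_gt_1 card_ge_0_finite[of "fixed m"] by simp

lemma coeff_frob: "coeff (frob h) k = coeff h k ^ q"
  using q_gt_1 by (simp add: frob_def coeff_map_poly power_0_left)

lemma frob_mult: "frob (g * h) = frob g * frob h"
  by (intro poly_eqI) (simp add: coeff_frob coeff_mult power_mult_distrib sum_power_q1)

lemma frob_prod: "frob (\<Prod>x\<in>A. h x) = (\<Prod>x\<in>A. frob (h x))"
proof (induction A rule: infinite_finite_induct)
  case (insert x A)
  thus ?case by (simp add: frob_mult)
qed (use q_gt_1 in \<open>auto intro!: poly_eqI simp: coeff_frob power_0_left\<close>)

lemma frob_power: "frob (h ^ k) = frob h ^ k"
  using frob_prod[of "\<lambda>_. h" "{..<k}"] by simp

lemma frob_add: "frob (g + h) = frob g + frob h"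
  by (intro poly_eqI) (simp add: coeff_frob add_power_q1)

lemma frob_linear: "frob [:- x, 1:] = [:- (x ^ q), 1:]"
  using q_gt_1
  by (intro poly_eqI) (auto simp: coeff_frob coeff_pCons power_0_left uminus_power_q1 split: nat.splits)

lemma poly_frob: "poly (frob h) (x ^ q) = poly h x ^ q"
proof -
  have "degree (frob h) = degree h"
    unfolding frob_def by (rule degree_map_poly) auto
  thus ?thesis
    by (simp add: poly_altdef coeff_frob power_mult_distrib sum_power_q1 mult.commute flip: power_mult)
qed

text \<open>Applying \<open>frob\<close> to h = (Y - x)^k g gives h = (Y - x^q)^k times another
  polynomial, so the order cannot drop along a Frobenius orbit.\<close>

lemma order_frob_le:
  assumes "frob h = h" "h \<noteq> 0"
  shows "order x h \<le> order (x ^ (q ^ i)) h"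
proof (induction i)
  case (Suc i)
  have "[:- (x ^ (q ^ i)), 1:] ^ order (x ^ (q ^ i)) h dvd h" by (rule order_1)
  then obtain g where "h = [:- (x ^ (q ^ i)), 1:] ^ order (x ^ (q ^ i)) h * g" by (elim dvdE)
  hence "frob h = frob ([:- (x ^ (q ^ i)), 1:] ^ order (x ^ (q ^ i)) h) * frob g"
    by (metis frob_mult)
  hence "h = [:- (x ^ (q ^ Suc i)), 1:] ^ order (x ^ (q ^ i)) h * frob g"
    by (simp add: assms frob_power frob_linear mult.commute flip: power_mult)
  hence "[:- (x ^ (q ^ Suc i)), 1:] ^ order (x ^ (q ^ i)) h dvd h" by (metis dvd_triv_left)
  hence "order (x ^ (q ^ i)) h \<le> order (x ^ (q ^ Suc i)) h"
    using assms by (simp add: order_divides)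
  thus ?case using Suc by simp
qed auto

text \<open>For x in F_{q^m} with m > 0 this is the norm of Y - x, a power of the minimal polynomial
  of x over F_q.\<close>

definition orbit_poly :: "nat \<Rightarrow> 'k \<Rightarrow> 'k poly"
  where "orbit_poly m x = (\<Prod>i<m. [:- (x ^ (q ^ i)), 1:])"

lemma degree_orbit_poly: "degree (orbit_poly m x) = m"
  unfolding orbit_poly_def by (subst degree_prod_eq_sum_degree) auto

lemma lead_coeff_orbit_poly: "lead_coeff (orbit_poly m x) = 1"
  unfolding orbit_poly_def by (subst lead_coeff_prod) auto

lemma frob_orbit_poly:
  assumes "x \<in> fixed m"
  shows "frob (orbit_poly m x) = orbit_poly m x"
proof (cases m)
  case (Suc k)
  have "frob (orbit_poly m x) = (\<Prod>i<m. [:- (x ^ (q ^ Suc i)), 1:])"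
    by (simp add: orbit_poly_def frob_prod frob_linear mult.commute flip: power_mult)
  also have "\<dots> = (\<Prod>i<k. [:- (x ^ (q ^ Suc i)), 1:]) * [:- x, 1:]"
    using assms by (simp add: Suc fixed_def)
  also have "\<dots> = orbit_poly m x"
    unfolding orbit_poly_def Suc prod.lessThan_Suc_shift by (simp add: mult.commute)
  finally show ?thesis .
qed (simp add: orbit_poly_def poly_eq_iff coeff_frob power_0_left, use q_gt_1 in simp)

lemma fixed_period:
  assumes "\<And>i. 0 < i \<Longrightarrow> i < D \<Longrightarrow> x \<notin> fixed i" "x \<in> fixed D" "D > 0"
  shows "x ^ (q ^ (a * D + i)) = x ^ (q ^ i)"
    and "inj_on (\<lambda>i. x ^ (q ^ i)) {..<D}"
    and "x \<in> fixed j \<longleftrightarrow> D dvd j"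
proof -
  have "x ^ (q ^ (a * D)) = x" for a
    by (induction a) (use assms(2) in \<open>auto simp: fixed_def power_add power_mult\<close>)
  thus shift: "x ^ (q ^ (a * D + i)) = x ^ (q ^ i)" for a i
    by (simp add: power_add power_mult)
  have inj: "x ^ (q ^ i) \<noteq> x ^ (q ^ j)" if "i < j" "j < D" for i j
  proof
    assume "x ^ (q ^ i) = x ^ (q ^ j)"
    moreover have "q ^ j = q ^ (j - i) * q ^ i" using that by (simp flip: power_add)
    ultimately have "(x ^ (q ^ (j - i))) ^ (q ^ i) = x ^ (q ^ i)" by (simp add: power_mult)
    hence "x ^ (q ^ (j - i)) = x" by (rule power_q_inj)
    moreover have "0 < j - i" "j - i < D" using that by linarith+
    ultimately show False using assms(1) by (auto simp: fixed_def)
  qed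
  show "inj_on (\<lambda>i. x ^ (q ^ i)) {..<D}"
    by (rule inj_onI) (metis inj lessThan_iff linorder_neqE_nat)
  have "x ^ (q ^ j) = x ^ (q ^ (j mod D))"
    using shift[of "j div D" "j mod D"] by simp
  hence "x \<in> fixed j \<longleftrightarrow> x ^ (q ^ (j mod D)) = x" by (simp add: fixed_def)
  also have "\<dots> \<longleftrightarrow> j mod D = 0"
    using assms(1)[of "j mod D"] assms(3) by (cases "j mod D = 0") (auto simp: fixed_def)
  finally show "x \<in> fixed j \<longleftrightarrow> D dvd j" by (simp add: dvd_eq_mod_eq_0)
qed

lemma prod_linear_powers_dvd:
  assumes "finite Z" "h \<noteq> 0" "\<And>z. z \<in> Z \<Longrightarrow> a \<le> order z h"
  shows "(\<Prod>z\<in>Z. [:- z, 1:]) ^ a dvd (h :: 'k poly)"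
  using assms
proof (induction Z arbitrary: h rule: finite_induct)
  case (insert z Z)
  have "[:- z, 1:] ^ a dvd h" using insert.prems by (simp add: order_divides)
  then obtain h' where h': "h = [:- z, 1:] ^ a * h'" by (elim dvdE)
  have "order w h' = order w h" if "w \<in> Z" for w
  proof -
    have "order w ([:- z, 1:] ^ a) = 0"
      using that insert.hyps by (intro order_0I) auto
    thus ?thesis using insert.prems(1) unfolding h' by (subst order_mult) auto
  qed
  hence "(\<Prod>z\<in>Z. [:- z, 1:]) ^ a dvd h'"
    using insert.prems by (intro insert.IH) (auto simp: h')
  thus ?case unfolding h' using insert.hyps
    by (simp add: power_mult_distrib mult_dvd_mono del: mult_pCons_left mult_pCons_right)
qed simp

text \<open>For a root x of degree D over F_q, the admissible j are multiples a D, and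
  \<open>orbit_poly (a * D) x\<close> is the a-th power of the minimal polynomial of x; it divides h
  exactly when a is at most the order of x. Summed over the roots, the count is the degree of
  h.\<close>

lemma card_orbit_poly_dvd:
  assumes h: "frob h = h" "h \<noteq> 0"
  shows "card {j \<in> {1..degree h}. x \<in> fixed j \<and> orbit_poly j x dvd h} = order x h"
proof (cases "poly h x = 0")
  case False
  have "\<not> orbit_poly j x dvd h" if "j \<ge> 1" for j
  proof
    assume "orbit_poly j x dvd h"
    then obtain g where g: "h = orbit_poly j x * g" by (elim dvdE)
    have "poly (orbit_poly j x) x = 0"
      unfolding orbit_poly_def poly_prod using that by (intro prod_zero bexI[of _ 0]) auto
    thus False using False g by simp
  qed
  hence "{j \<in> {1..degree h}. x \<in> fixed j \<and> orbit_poly j x dvd h} = {}" by auto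
  moreover have "order x h = 0" using False by (rule order_0I)
  ultimately show ?thesis by simp
next
  case True
  have "poly h (x ^ (q ^ i)) = 0" for i
  proof -
    have "order x h \<noteq> 0" using True h order_root[of h x] by auto
    hence "order (x ^ (q ^ i)) h \<noteq> 0" using order_frob_le[OF h, of x i] by simp
    thus ?thesis using h order_root by blast
  qed
  \<comment> \<open>The ambient field may contain elements transcendental over F_q, so periodicity
    of x under Frobenius is derived from h having finitely many roots.\<close>
  hence "range (\<lambda>i. x ^ (q ^ i)) \<subseteq> {x. poly h x = 0}" by auto
  hence "finite (range (\<lambda>i. x ^ (q ^ i)))" using h poly_roots_finite finite_subset by blast
  hence "\<not> inj (\<lambda>i. x ^ (q ^ i))" using finite_imageD[of _ "UNIV :: nat set"] by blast
  then obtain i j where "x ^ (q ^ i) = x ^ (q ^ j)" "i < j"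
    unfolding inj_def by (metis linorder_neqE_nat)
  moreover from this have "q ^ j = q ^ (j - i) * q ^ i" by (simp flip: power_add)
  ultimately have "(x ^ (q ^ (j - i))) ^ (q ^ i) = x ^ (q ^ i)" "j - i > 0"
    by (simp_all add: power_mult)
  hence "x \<in> fixed (j - i)" "j - i > 0" by (auto simp: fixed_def intro: power_q_inj)
  hence ex: "\<exists>D>0. x \<in> fixed D" by blast
  define D where "D = (LEAST D. D > 0 \<and> x \<in> fixed D)"
  have D: "x \<in> fixed D" "D > 0" and Dmin: "\<And>i. 0 < i \<Longrightarrow> i < D \<Longrightarrow> x \<notin> fixed i"
    using LeastI_ex[OF ex] not_less_Least unfolding D_def by blast+
  note per = fixed_period[OF Dmin D]
  have orb: "orbit_poly (a * D) x = orbit_poly D x ^ a" for a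
  proof (induction a)
    case (Suc a)
    have "orbit_poly (Suc a * D) x = orbit_poly (a * D) x * (\<Prod>i<D. [:- (x ^ (q ^ (a * D + i))), 1:])"
      unfolding orbit_poly_def mult_Suc add.commute[of D] by (rule prod_lessThan_add)
    also have "(\<Prod>i<D. [:- (x ^ (q ^ (a * D + i))), 1:]) = orbit_poly D x"
      by (simp only: per(1) orbit_poly_def)
    finally show ?case by (simp only: Suc power_Suc2)
  qed (simp add: orbit_poly_def)
  have dvd_iff: "orbit_poly (a * D) x dvd h \<longleftrightarrow> a \<le> order x h" for a
  proof
    assume "orbit_poly (a * D) x dvd h"
    moreover have "[:- x, 1:] dvd orbit_poly D x"
      unfolding orbit_poly_def using D dvd_prodI[of "{..<D}" 0 "\<lambda>i. [:- (x ^ (q ^ i)), 1:]"] by simp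
    hence "[:- x, 1:] ^ a dvd orbit_poly (a * D) x" unfolding orb by (rule dvd_power_same)
    ultimately have "[:- x, 1:] ^ a dvd h" by (rule dvd_trans[rotated])
    thus "a \<le> order x h" using h by (simp add: order_divides)
  next
    assume a: "a \<le> order x h"
    have "(\<Prod>z\<in>(\<lambda>i. x ^ (q ^ i)) ` {..<D}. [:- z, 1:]) ^ a dvd h"
      using a order_frob_le[OF h, of x] h by (intro prod_linear_powers_dvd) (auto intro: order_trans)
    thus "orbit_poly (a * D) x dvd h"
      unfolding orb by (simp add: orbit_poly_def prod.reindex[OF per(2)])
  qed
  have "{j \<in> {1..degree h}. x \<in> fixed j \<and> orbit_poly j x dvd h} = (\<lambda>a. a * D) ` {1..order x h}"
  proof (intro equalityI subsetI)
    fix j assume "j \<in> {j \<in> {1..degree h}. x \<in> fixed j \<and> orbit_poly j x dvd h}"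
    hence j: "j \<ge> 1" "x \<in> fixed j" "orbit_poly j x dvd h" by auto
    then obtain a where a: "j = a * D" using per(3) by (auto elim!: dvdE simp: mult.commute)
    moreover have "a \<le> order x h" using j(3) dvd_iff a by simp
    moreover have "a \<ge> 1" using a j(1) by (cases a) auto
    ultimately show "j \<in> (\<lambda>a. a * D) ` {1..order x h}" by auto
  next
    fix j assume "j \<in> (\<lambda>a. a * D) ` {1..order x h}"
    then obtain a where a: "j = a * D" "a \<in> {1..order x h}" by blast
    hence "orbit_poly j x dvd h" using dvd_iff[of a] by simp
    moreover from this have "j \<le> degree h"
      using dvd_imp_degree_le h degree_orbit_poly by metis
    ultimately show "j \<in> {j \<in> {1..degree h}. x \<in> fixed j \<and> orbit_poly j x dvd h}"
      using a D per(3) by auto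
  qed
  moreover have "inj_on (\<lambda>a. a * D) {1..order x h}" using D by (auto intro: inj_onI)
  ultimately show ?thesis by (simp add: card_image)
qed

end

section \<open>The L-function as a polynomial, and Newton's identities\<close>

locale character_family = frobenius_field q r ty
  for q r :: nat and ty :: "'k::alg_closed_field itself" +
  fixes n :: nat and cs :: "nat \<Rightarrow> 'k" and \<chi> :: "nat \<Rightarrow> 'k \<Rightarrow> complex" and i0 :: nat
  assumes cs_fixed: "\<And>i. i < n \<Longrightarrow> cs i \<in> fixed 1"
    and cs_inj: "inj_on cs {..<n}"
    and \<chi>_mult: "\<And>i x y. x \<in> fixed 1 \<Longrightarrow> y \<in> fixed 1 \<Longrightarrow> \<chi> i (x * y) = \<chi> i x * \<chi> i y"
    and \<chi>_1: "\<And>i. \<chi> i 1 = 1"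
    and i0: "i0 < n" and \<chi>_i0: "(\<Sum>v\<in>fixed 1. \<chi> i0 v) = 0"
begin

text \<open>Depends only on h modulo the product of the Y - \<open>cs i\<close>: a Dirichlet
  character for polynomials.\<close>

definition poly_char :: "'k poly \<Rightarrow> complex"
  where "poly_char h = (\<Prod>i<n. \<chi> i (poly h (cs i)))"

definition monics :: "nat \<Rightarrow> 'k poly set"
  where "monics N = {h. degree h = N \<and> lead_coeff h = 1 \<and> frob h = h}"

definition L_coeff :: "nat \<Rightarrow> complex"
  where "L_coeff N = (\<Sum>h\<in>monics N. poly_char h)"

text \<open>For x in F_{q^m} the inner product is the norm of \<open>cs i - x\<close> to F_q, so
  this is the character lifted to F_{q^m}, in the form that \<open>poly_char\<close> takes on
  \<open>orbit_poly m x\<close>.\<close>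

definition norm_char :: "nat \<Rightarrow> 'k \<Rightarrow> complex"
  where "norm_char m x = (\<Prod>i<n. \<chi> i (\<Prod>j<m. (cs i - x) ^ (q ^ j)))"

definition char_sum :: "nat \<Rightarrow> complex"
  where "char_sum m = (\<Sum>x\<in>fixed m. norm_char m x)"

lemma coeff_monics: "h \<in> monics N \<Longrightarrow> coeff h k \<in> fixed 1"
  by (auto simp: monics_def fixed_def simp flip: coeff_frob)

lemma finite_monics: "finite (monics N)"
proof (rule finite_subset)
  show "monics N \<subseteq> Poly ` {l. set l \<subseteq> fixed 1 \<and> length l = Suc N}"
  proof
    fix h assume h: "h \<in> monics N"
    hence "h \<noteq> 0" by (auto simp: monics_def)
    hence "length (coeffs h) = Suc N" using h by (simp add: monics_def length_coeffs)
    moreover have "set (coeffs h) \<subseteq> fixed 1"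
      using coeff_monics[OF h] by (auto simp: coeffs_def)
    ultimately show "h \<in> Poly ` {l. set l \<subseteq> fixed 1 \<and> length l = Suc N}"
      by (intro image_eqI[of _ _ "coeffs h"]) auto
  qed
  show "finite (Poly ` {l. set l \<subseteq> fixed 1 \<and> length l = Suc N})"
    using finite_lists_length_eq[OF finite_fixed[of 1]] by simp
qed

lemma poly_in_fixed:
  assumes "frob h = h" "x \<in> fixed 1"
  shows "poly h x \<in> fixed 1"
  using poly_frob[of h x] assms by (simp add: fixed_def)

lemma poly_char_mult:
  assumes "frob g = g" "frob h = h"
  shows "poly_char (g * h) = poly_char g * poly_char h"
  unfolding poly_char_def prod.distrib[symmetric]
proof (intro prod.cong refl)
  fix i assume "i \<in> {..<n}"
  hence "cs i \<in> fixed 1" using cs_fixed by blast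
  thus "\<chi> i (poly (g * h) (cs i)) = \<chi> i (poly g (cs i)) * \<chi> i (poly h (cs i))"
    unfolding poly_mult using assms by (intro \<chi>_mult poly_in_fixed)
qed

lemma poly_char_orbit_poly:
  "poly_char (orbit_poly m x) = norm_char m x"
  unfolding poly_char_def norm_char_def orbit_poly_def poly_prod
proof (intro prod.cong refl arg_cong[of _ _ "\<chi> _"])
  fix i j assume "i \<in> {..<n}"
  hence "cs i ^ (q ^ j) = cs i"
    by (induction j) (use cs_fixed in \<open>auto simp: fixed_def power_mult\<close>)
  thus "poly [:- (x ^ (q ^ j)), 1:] (cs i) = (cs i - x) ^ (q ^ j)"
    by (simp add: diff_power_q)
qed

lemma L_coeff_0: "L_coeff 0 = 1"
proof -
  have "frob 1 = 1" using frob_power[of 1 0] by simp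
  hence "monics 0 = {1}"
    by (auto simp: monics_def elim!: degree_eq_zeroE)
  thus ?thesis by (simp add: L_coeff_def poly_char_def \<chi>_1)
qed

text \<open>Let l vanish at every \<open>cs i\<close> except \<open>cs i0\<close>. Its degree n - 1
  is below N, so h + u l is again monic of degree N and only the value at \<open>cs i0\<close>
  changes; as u runs through F_q, that value runs through the whole field, where
  \<open>\<chi> i0\<close> sums to zero.\<close>

lemma L_coeff_eq_0:
  assumes "N \<ge> n"
  shows "L_coeff N = 0"
proof -
  define l where "l = (\<Prod>i\<in>{..<n}-{i0}. [:- cs i, 1:])"
  have fl: "frob l = l" unfolding l_def frob_prod frob_linear
    using cs_fixed by (intro prod.cong) (auto simp: fixed_def)
  have degl: "degree l < N"
    unfolding l_def using assms i0 by (subst degree_prod_eq_sum_degree) auto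
  have l0: "poly l (cs i) = 0" if "i < n" "i \<noteq> i0" for i
    unfolding l_def poly_prod using that by (intro prod_zero) auto
  have l1: "poly l (cs i0) \<noteq> 0"
    unfolding l_def poly_prod using cs_inj i0 by (auto simp: inj_on_def)
  have l1f: "poly l (cs i0) \<in> fixed 1" using fl i0 cs_fixed by (intro poly_in_fixed)
  have frob_smult: "frob (smult u h) = smult (u ^ q) (frob h)" for u h
    by (intro poly_eqI) (simp add: coeff_frob power_mult_distrib)
  have mem: "h + smult u l \<in> monics N" if "h \<in> monics N" "u \<in> fixed 1" for h u
  proof -
    have "degree (smult u l) < degree h" using that degl degree_smult_le[of u l] by (simp add: monics_def)
    hence "degree (h + smult u l) = degree h" "coeff (smult u l) (degree h) = 0"
      by (rule degree_add_eq_left, rule coeff_eq_0)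
    moreover have "u ^ q = u" using that(2) by (simp add: fixed_def)
    moreover have "degree h = N" "lead_coeff h = 1" "frob h = h" using that(1) by (auto simp: monics_def)
    ultimately have "degree (h + smult u l) = N" "lead_coeff (h + smult u l) = 1"
        "frob (h + smult u l) = h + smult u l"
      using fl by (simp_all only: coeff_add frob_add frob_smult add_0_right)
    thus ?thesis by (simp only: monics_def mem_Collect_eq)
  qed
  have shift: "L_coeff N = (\<Sum>h\<in>monics N. poly_char (h + smult u l))" if "u \<in> fixed 1" for u
    unfolding L_coeff_def
  proof (rule sum.reindex_bij_witness[where j = "\<lambda>h. h + smult (-u) l" and i = "\<lambda>h. h + smult u l"])
    fix h assume h: "h \<in> monics N"
    show "h + smult (-u) l \<in> monics N" using mem[OF h] that fixed_closed(3) by blast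
    show "h + smult u l \<in> monics N" using mem[OF h] that by blast
  qed auto
  have "of_nat (card (fixed 1)) * L_coeff N = (\<Sum>u\<in>fixed 1. L_coeff N)" by (rule sum_constant[symmetric])
  also have "\<dots> = (\<Sum>u\<in>fixed 1. \<Sum>h\<in>monics N. poly_char (h + smult u l))"
    by (intro sum.cong refl shift)
  also have "\<dots> = (\<Sum>h\<in>monics N. \<Sum>u\<in>fixed 1. poly_char (h + smult u l))" by (rule sum.swap)
  also have "\<dots> = 0"
  proof (rule sum.neutral, rule ballI)
    fix h assume h: "h \<in> monics N"
    have hf: "poly h (cs i0) \<in> fixed 1"
      using h i0 cs_fixed by (intro poly_in_fixed) (auto simp: monics_def)
    define C where "C = (\<Prod>i\<in>{..<n}-{i0}. \<chi> i (poly h (cs i)))"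
    have "poly_char (h + smult u l) = \<chi> i0 (poly h (cs i0) + u * poly l (cs i0)) * C" for u
      unfolding poly_char_def C_def using i0 l0
      by (subst prod.remove[of _ i0]) (auto intro!: prod.cong)
    hence "(\<Sum>u\<in>fixed 1. poly_char (h + smult u l))
        = (\<Sum>u\<in>fixed 1. \<chi> i0 (poly h (cs i0) + u * poly l (cs i0))) * C"
      by (simp add: sum_distrib_right)
    also have "(\<Sum>u\<in>fixed 1. \<chi> i0 (poly h (cs i0) + u * poly l (cs i0))) = (\<Sum>v\<in>fixed 1. \<chi> i0 v)"
      by (rule sum.reindex_bij_witness[where i = "\<lambda>v. (v - poly h (cs i0)) / poly l (cs i0)"
            and j = "\<lambda>u. poly h (cs i0) + u * poly l (cs i0)"])
        (use l1 l1f hf in \<open>auto intro!: fixed_closed simp: field_simps\<close>)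
    finally show "(\<Sum>u\<in>fixed 1. poly_char (h + smult u l)) = 0" by (simp only: \<chi>_i0 mult_zero_left)
  qed
  finally show ?thesis using card_fixed[of 1] q_gt_1 by simp
qed

text \<open>Multiplication by the norm polynomial, which is defined over F_q, maps the monic
  polynomials of degree N - j bijectively onto its monic multiples of degree N.\<close>

lemma sum_multiples_orbit_poly:
  assumes "j \<le> N" "x \<in> fixed j"
  shows "norm_char j x * L_coeff (N - j) = (\<Sum>h | h \<in> monics N \<and> orbit_poly j x dvd h. poly_char h)"
proof -
  let ?g = "orbit_poly j x"
  have fg: "frob ?g = ?g" by (rule frob_orbit_poly) fact
  have g0: "?g \<noteq> 0" using lead_coeff_orbit_poly[of j x] by auto
  have "norm_char j x * L_coeff (N - j) = (\<Sum>h\<in>monics (N - j). poly_char (?g * h))"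
    unfolding L_coeff_def sum_distrib_left
    by (intro sum.cong refl) (auto simp: poly_char_mult fg monics_def poly_char_orbit_poly)
  also have "\<dots> = (\<Sum>h\<in>(\<lambda>h. ?g * h) ` monics (N - j). poly_char h)"
    using g0 by (subst sum.reindex) (auto intro!: inj_onI)
  also have "(\<lambda>h. ?g * h) ` monics (N - j) = {h. h \<in> monics N \<and> ?g dvd h}"
  proof (intro equalityI subsetI)
    fix h assume "h \<in> (\<lambda>h. ?g * h) ` monics (N - j)"
    then obtain h' where h': "h = ?g * h'" "h' \<in> monics (N - j)" by auto
    hence "h' \<noteq> 0" by (auto simp: monics_def)
    hence "degree h = j + degree h'" using g0 by (simp add: h' degree_mult_eq degree_orbit_poly)
    moreover have "lead_coeff h' = 1" using h'(2) by (auto simp: monics_def)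
    hence "lead_coeff h = 1" unfolding h'(1) lead_coeff_mult lead_coeff_orbit_poly by simp
    ultimately show "h \<in> {h. h \<in> monics N \<and> ?g dvd h}"
      using h' assms by (auto simp: monics_def frob_mult fg)
  next
    fix h assume "h \<in> {h. h \<in> monics N \<and> ?g dvd h}"
    then obtain h' where h': "h = ?g * h'" and h: "h \<in> monics N" by (auto elim: dvdE)
    have h0: "h' \<noteq> 0" using h h' by (auto simp: monics_def)
    have "?g * frob h' = ?g * h'" using h fg by (simp add: monics_def h' frob_mult)
    hence "frob h' = h'" using g0 by simp
    moreover have "degree h' = N - j"
      using h h0 g0 by (auto simp: h' monics_def degree_mult_eq degree_orbit_poly)
    moreover have "lead_coeff h' = 1"
      using h lead_coeff_orbit_poly[of j x] unfolding monics_def h' by (simp add: lead_coeff_mult)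
    ultimately have "h' \<in> monics (N - j)" by (simp add: monics_def)
    thus "h \<in> (\<lambda>h. ?g * h) ` monics (N - j)" using h' by blast
  qed
  finally show ?thesis .
qed

text \<open>Each monic \<open>h\<close> of degree \<open>N\<close> has exactly \<open>N\<close> pairs \<open>(j, x)\<close> for which the product of the first \<open>j\<close>
  conjugates of \<open>Y - x\<close> is defined over the ground field and divides \<open>h\<close>.\<close>

lemma newton_identity:
  "of_nat N * L_coeff N = (\<Sum>j\<in>{1..N}. char_sum j * L_coeff (N - j))"
proof -
  have fin: "finite (fixed j)" if "j \<in> {1..N}" for j using that by (intro finite_fixed) auto
  have "(\<Sum>j\<in>{1..N}. char_sum j * L_coeff (N - j))
    = (\<Sum>j\<in>{1..N}. \<Sum>x\<in>fixed j. \<Sum>h\<in>monics N. if orbit_poly j x dvd h then poly_char h else 0)"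
  proof (intro sum.cong refl)
    fix j assume j: "j \<in> {1..N}"
    have "char_sum j * L_coeff (N - j)
      = (\<Sum>x\<in>fixed j. \<Sum>h | h \<in> monics N \<and> orbit_poly j x dvd h. poly_char h)"
      unfolding char_sum_def sum_distrib_right
      using j by (intro sum.cong refl sum_multiples_orbit_poly) auto
    thus "char_sum j * L_coeff (N - j)
      = (\<Sum>x\<in>fixed j. \<Sum>h\<in>monics N. if orbit_poly j x dvd h then poly_char h else 0)"
      by (simp add: sum.inter_filter finite_monics)
  qed
  also have "\<dots> = (\<Sum>p\<in>Sigma {1..N} fixed. \<Sum>h\<in>monics N. if orbit_poly (fst p) (snd p) dvd h then poly_char h else 0)"
    using fin by (subst sum.Sigma) (auto simp: case_prod_unfold)
  also have "\<dots> = (\<Sum>h\<in>monics N. \<Sum>p\<in>Sigma {1..N} fixed. if orbit_poly (fst p) (snd p) dvd h then poly_char h else 0)"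
    by (rule sum.swap)
  also have "\<dots> = (\<Sum>h\<in>monics N. of_nat N * poly_char h)"
  proof (intro sum.cong refl)
    fix h assume h: "h \<in> monics N"
    hence hN: "degree h = N" and fh: "frob h = h" and h0: "h \<noteq> 0" by (auto simp: monics_def)
    define P where "P = {p \<in> Sigma {1..N} fixed. orbit_poly (fst p) (snd p) dvd h}"
    define Z where "Z = {x. poly h x = 0}"
    have root: "poly h x = 0" if "j \<ge> 1" "orbit_poly j x dvd h" for j x
    proof -
      have "poly (orbit_poly j x) x = 0"
        unfolding orbit_poly_def poly_prod using that by (intro prod_zero bexI[of _ 0]) auto
      thus ?thesis using that(2) by (auto elim!: dvdE)
    qed
    \<comment> \<open>Grouping the pairs by the root x instead of by j lets
      \<open>card_orbit_poly_dvd\<close> count the j belonging to each root.\<close>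
    have "P = (\<lambda>(x, j). (j, x)) ` Sigma Z (\<lambda>x. {j \<in> {1..degree h}. x \<in> fixed j \<and> orbit_poly j x dvd h})"
      using root by (force simp: P_def Z_def hN)
    hence "card P = card (Sigma Z (\<lambda>x. {j \<in> {1..degree h}. x \<in> fixed j \<and> orbit_poly j x dvd h}))"
      by (simp only:) (intro card_image, auto intro!: inj_onI)
    also have "\<dots> = (\<Sum>x\<in>Z. card {j \<in> {1..degree h}. x \<in> fixed j \<and> orbit_poly j x dvd h})"
      using poly_roots_finite[OF h0] by (intro card_SigmaI) (auto simp: Z_def)
    also have "\<dots> = (\<Sum>x\<in>Z. order x h)"
      using card_orbit_poly_dvd[OF fh h0] by (simp only:)
    also have "\<dots> = N" using sum_order_alg_closed[OF h0] by (simp add: Z_def hN)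
    finally have "card P = N" .
    moreover have "finite (Sigma {1..N} fixed)" using fin by blast
    ultimately show "(\<Sum>p\<in>Sigma {1..N} fixed. if orbit_poly (fst p) (snd p) dvd h then poly_char h else 0)
      = of_nat N * poly_char h"
      by (simp add: P_def flip: sum.inter_filter)
  qed
  finally show ?thesis by (simp add: L_coeff_def sum_distrib_left)
qed

end

section \<open>From the growth of power sums to the size of reciprocal roots\<close>

lemma prod_reciprocal_coeffs:
  fixes A :: "complex multiset" and \<rho> :: real
  assumes "\<And>w. w \<in># A \<Longrightarrow> norm w \<le> \<rho>"
  shows "coeff (\<Prod>w\<in>#A. [:1, - w:]) 0 = 1 \<and> norm (coeff (\<Prod>w\<in>#A. [:1, - w:]) 1) \<le> size A * \<rho>"
  using assms
proof (induction A)
  case (add w A)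
  let ?P = "\<Prod>w\<in>#A. [:1, - w:]"
  have IH: "coeff ?P 0 = 1" "norm (coeff ?P 1) \<le> size A * \<rho>" using add by auto
  have "norm (coeff ?P 1 - w) \<le> norm (coeff ?P 1) + norm w" by (rule norm_triangle_ineq4)
  also have "\<dots> \<le> size A * \<rho> + \<rho>" using IH add.prems by (intro add_mono) auto
  finally show ?case using IH by (simp add: algebra_simps coeff_pCons)
qed auto

text \<open>The identity says \<open>t * L' = L * s\<close> with \<open>s\<close> analytic for \<open>\<bar>t\<bar> < 1 / \<rho>\<close>. A zero of \<open>L\<close> there would have
  smaller order on the left than on the right. So all reciprocal roots have modulus at most \<open>\<rho>\<close>.\<close>

lemma newton_coefficient_bound:
  fixes c S :: "nat \<Rightarrow> complex" and \<rho> K :: real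
  assumes c0: "c 0 = 1" and cn: "\<And>N. N \<ge> n \<Longrightarrow> c N = 0"
    and newton: "\<And>N. of_nat N * c N = (\<Sum>j\<in>{1..N}. S j * c (N - j))"
    and S: "\<And>m. m \<ge> m0 \<Longrightarrow> norm (S m) \<le> K * \<rho> ^ m" and \<rho>: "\<rho> > 0"
  shows "norm (c 1) \<le> (real n - 1) * \<rho>"
proof -
  have n: "n > 0" using c0 cn[of 0] by (cases n) auto
  define L where "L = (\<Sum>N<n. monom (c N) N)"
  have cL: "coeff L N = c N" for N
    using cn[of N] by (simp add: L_def coeff_sum)
  have L0: "L \<noteq> 0" using cL[of 0] c0 by auto
  have degL: "degree L \<le> n - 1"
    using cn by (intro degree_le) (auto simp: cL)
  have root: "norm (inverse x) \<le> \<rho>" if x: "poly L x = 0" for x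
  proof (rule ccontr)
    assume "\<not> norm (inverse x) \<le> \<rho>"
    have x0: "x \<noteq> 0" using x cL[of 0] c0 by (auto simp: poly_0_coeff_0)
    hence small: "\<rho> * norm x < 1"
      using \<open>\<not> norm (inverse x) \<le> \<rho>\<close> by (simp add: norm_inverse norm_divide field_simps)
    \<comment> \<open>Newton's identity starts at j = 1 and says nothing about \<open>S 0\<close>;
      the value 0 lets the Cauchy product start at index 0.\<close>
    define S' where "S' m = (if m = 0 then 0 else S m)" for m
    have summ: "summable (\<lambda>m. norm (S' m) * norm x ^ m)"
    proof (rule summable_comparison_test)
      show "\<exists>N. \<forall>m\<ge>N. norm (norm (S' m) * norm x ^ m) \<le> K * (\<rho> * norm x) ^ m"
      proof (intro exI[of _ "max m0 1"] allI impI)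
        fix m assume "m \<ge> max m0 1"
        hence "norm (S' m) \<le> K * \<rho> ^ m" using S by (auto simp: S'_def)
        hence "norm (S' m) * norm x ^ m \<le> K * \<rho> ^ m * norm x ^ m" by (rule mult_right_mono) simp
        thus "norm (norm (S' m) * norm x ^ m) \<le> K * (\<rho> * norm x) ^ m"
          by (simp add: power_mult_distrib mult_ac)
      qed
      show "summable (\<lambda>m. K * (\<rho> * norm x) ^ m)"
        using small \<rho> by (intro summable_mult summable_geometric) (simp add: abs_mult)
    qed
    define B where "B = (\<Sum>m. norm (S' m) * norm x ^ m)"
    define s where "s t = (\<Sum>m. S' m * t ^ m)" for t
    have sums': "summable (\<lambda>m. norm (S' m * t ^ m)) \<and> norm (s t) \<le> B" if "norm t \<le> norm x" for t
    proof -
      have le: "norm (S' m * t ^ m) \<le> norm (S' m) * norm x ^ m" for m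
        using that by (simp add: norm_mult norm_power mult_left_mono power_mono)
      have 1: "summable (\<lambda>m. norm (S' m * t ^ m))"
        by (rule summable_comparison_test[OF _ summ]) (use le in auto)
      have "norm (s t) \<le> (\<Sum>m. norm (S' m * t ^ m))" unfolding s_def by (rule summable_norm[OF 1])
      also have "\<dots> \<le> B" unfolding B_def by (rule suminf_le[OF le 1 summ])
      finally show ?thesis using 1 by simp
    qed
    have ident: "t * poly (pderiv L) t = poly L t * s t" if t: "norm t \<le> norm x" for t
    proof -
      have polyL: "poly L t = (\<Sum>N. c N * t ^ N)"
        by (subst suminf_finite[of "{..<n}"]) (auto simp: L_def poly_sum poly_monom cn)
      have 2: "summable (\<lambda>N. norm (c N * t ^ N))"
        by (rule summable_finite[of "{..<n}"]) (auto simp: cn)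
      have "poly L t * s t = (\<Sum>k. \<Sum>i\<le>k. (c i * t ^ i) * (S' (k - i) * t ^ (k - i)))"
        unfolding polyL s_def using 2 sums'[OF t] by (intro Cauchy_product) auto
      also have "(\<lambda>k. \<Sum>i\<le>k. (c i * t ^ i) * (S' (k - i) * t ^ (k - i))) = (\<lambda>k. of_nat k * c k * t ^ k)"
      proof
        fix k
        have "(\<Sum>i\<le>k. (c i * t ^ i) * (S' (k - i) * t ^ (k - i))) = (\<Sum>i\<le>k. S' (k - i) * c i) * t ^ k"
          unfolding sum_distrib_right
          by (intro sum.cong refl) (simp add: mult_ac flip: power_add)
        also have "(\<Sum>i\<le>k. S' (k - i) * c i) = (\<Sum>j\<le>k. S' j * c (k - j))"
          by (rule sum.reindex_bij_witness[of _ "\<lambda>j. k - j" "\<lambda>j. k - j"]) auto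
        also have "\<dots> = (\<Sum>j\<in>{1..k}. S' j * c (k - j))"
          by (intro sum.mono_neutral_right) (auto simp: S'_def)
        also have "\<dots> = of_nat k * c k" unfolding newton by (intro sum.cong) (auto simp: S'_def)
        finally show "(\<Sum>i\<le>k. (c i * t ^ i) * (S' (k - i) * t ^ (k - i))) = of_nat k * c k * t ^ k" .
      qed
      also have "(\<Sum>k. of_nat k * c k * t ^ k) = (\<Sum>k<n. of_nat k * c k * t ^ k)"
        by (rule suminf_finite) (auto simp: cn)
      also have "\<dots> = t * poly (pderiv L) t"
      proof -
        have "pderiv L = (\<Sum>N<n. pderiv (monom (c N) N))"
          unfolding L_def by (induction n) (simp_all add: pderiv_add)
        hence "t * poly (pderiv L) t = (\<Sum>N<n. t * (of_nat N * c N * t ^ (N - 1)))"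
          by (simp add: pderiv_monom poly_sum poly_monom sum_distrib_left)
        also have "\<dots> = (\<Sum>N<n. of_nat N * c N * t ^ N)"
        proof (intro sum.cong refl)
          fix N show "t * (of_nat N * c N * t ^ (N - 1)) = of_nat N * c N * t ^ N"
            by (cases N) (simp_all add: mult_ac)
        qed
        finally show ?thesis by simp
      qed
      finally show ?thesis by simp
    qed
    define k where "k = order x L"
    have k0: "k > 0" using x L0 order_root[of L x] by (simp add: k_def)
    obtain M where M: "L = [:-x, 1:] ^ k * M" "\<not> [:-x, 1:] dvd M"
      using order_decomp[OF L0, of x] by (auto simp: k_def)
    have Mx: "poly M x \<noteq> 0" using M(2) by (simp add: poly_eq_0_iff_dvd)
    obtain k' where k': "k = Suc k'" using k0 by (cases k) auto
    have "pderiv ([:-x, 1:] ^ k) = smult (of_nat k) ([:-x, 1:] ^ k')"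
      unfolding k' pderiv_power_Suc by (simp add: pderiv_pCons del: of_nat_Suc)
    hence pdL: "pderiv L = [:-x, 1:] ^ k' * (smult (of_nat k) M + [:-x, 1:] * pderiv M)"
      by (subst M(1), subst pderiv_mult)
        (simp add: k' algebra_simps del: mult_pCons_left mult_pCons_right of_nat_Suc)
    \<comment> \<open>A radial sequence in the closed disc of radius |x|, where \<open>s\<close> is
      bounded by \<open>B\<close>. After division by (t - x)^(k-1) the left side tends to k x M(x),
      which is nonzero, and the right side to 0.\<close>
    define t where "t j = (1 - complex_of_real (inverse (real (Suc j)))) * x" for j
    have tx: "t \<longlonglongrightarrow> x"
    proof -
      have "(\<lambda>j. complex_of_real (inverse (real (Suc j)))) \<longlonglongrightarrow> complex_of_real 0"
        by (intro tendsto_of_real LIMSEQ_inverse_real_of_nat)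
      hence "(\<lambda>j. (1 - complex_of_real (inverse (real (Suc j)))) * x) \<longlonglongrightarrow> (1 - complex_of_real 0) * x"
        by (intro tendsto_mult tendsto_diff tendsto_const)
      thus ?thesis by (simp add: t_def[abs_def])
    qed
    have tne: "t j \<noteq> x" for j
      using x0 unfolding t_def by (simp add: field_simps flip: of_nat_Suc)
    have tle: "norm (t j) \<le> norm x" for j
    proof -
      have "1 - complex_of_real (inverse (real (Suc j))) = complex_of_real (1 - inverse (real (Suc j)))"
        by simp
      hence "norm (1 - complex_of_real (inverse (real (Suc j)))) = \<bar>1 - inverse (real (Suc j))\<bar>"
        by (simp only: norm_of_real)
      also have "\<dots> = 1 - inverse (real (Suc j))" by (simp add: field_simps)
      also have "\<dots> \<le> 1" by simp
      finally show ?thesis unfolding t_def norm_mult by (rule mult_left_le_one_le[OF norm_ge_zero norm_ge_zero])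
    qed
    have lin: "poly [:-x, 1:] (t j) = t j - x" for j by simp
    have eq: "t j * poly (smult (of_nat k) M + [:-x, 1:] * pderiv M) (t j) = (t j - x) * (poly M (t j) * s (t j))" for j
    proof -
      have "(t j - x) ^ k' * (t j * poly (smult (of_nat k) M + [:-x, 1:] * pderiv M) (t j))
          = (t j - x) ^ k' * ((t j - x) * (poly M (t j) * s (t j)))"
        using ident[OF tle[of j]] unfolding pdL
        by (subst (asm) M(1)) (simp only: poly_mult poly_power lin k' power_Suc mult_ac)
      thus ?thesis using tne[of j] by simp
    qed
    have lim1: "(\<lambda>j. t j * poly (smult (of_nat k) M + [:-x, 1:] * pderiv M) (t j))
        \<longlonglongrightarrow> x * poly (smult (of_nat k) M + [:-x, 1:] * pderiv M) x"
      by (intro tendsto_mult tx tendsto_poly)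
    have lim2: "(\<lambda>j. (t j - x) * (poly M (t j) * s (t j))) \<longlonglongrightarrow> 0"
    proof (rule tendsto_0_le[where K = B])
      show "(\<lambda>j. (t j - x) * poly M (t j)) \<longlonglongrightarrow> 0"
        using tendsto_mult[OF tendsto_diff[OF tx tendsto_const[of x]] tendsto_poly[OF tx, of M]] by simp
      show "\<forall>\<^sub>F j in sequentially. norm ((t j - x) * (poly M (t j) * s (t j))) \<le> norm ((t j - x) * poly M (t j)) * B"
        using sums'[OF tle] by (intro always_eventually allI) (simp add: norm_mult mult_left_mono mult.assoc)
    qed
    have "x * poly (smult (of_nat k) M + [:-x, 1:] * pderiv M) x = 0"
      using LIMSEQ_unique[OF lim1[unfolded eq] lim2] .
    thus False using x0 Mx k0 by simp
  qed
  obtain A where A: "size A = degree L" "L = smult (lead_coeff L) (\<Prod>x\<in>#A. [:-x, 1:])"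
    using alg_closed_imp_factorization[OF L0] by blast
  have A_root: "poly L x = 0" if "x \<in># A" for x
  proof -
    have "poly (\<Prod>x\<in>#A. [:-x, 1:]) x = 0"
      using that by (induction A) auto
    thus ?thesis by (subst A(2)) simp
  qed
  have A0: "x \<noteq> 0" if "x \<in># A" for x
    using A_root[OF that] cL[of 0] c0 by (auto simp: poly_0_coeff_0)
  define A' where "A' = image_mset inverse A"
  \<comment> \<open>Rewrites T - x as -x (1 - T/x); the scalars collect to 1 because L(0) =
    1.\<close>
  have "(\<Prod>x\<in>#A. [:-x, 1:]) = smult (\<Prod>x\<in>#A. - x) (\<Prod>w\<in>#A'. [:1, - w:])"
    unfolding A'_def using A0
  proof (induction A)
    case (add x A)
    have "[:-x, 1:] = smult (- x) [:1, - inverse x:]" using add.prems by simp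
    moreover have "(\<Prod>x\<in>#A. [:-x, 1:]) = smult (\<Prod>x\<in>#A. - x) (\<Prod>w\<in>#image_mset inverse A. [:1, - w:])"
      using add by simp
    ultimately show ?case
      by (simp only: image_mset_add_mset prod_mset.add_mset mult_smult_left mult_smult_right smult_smult mult.commute[of "- x"])
  qed simp
  hence L_eq: "L = smult (lead_coeff L * (\<Prod>x\<in>#A. - x)) (\<Prod>w\<in>#A'. [:1, - w:])"
    using A(2) by simp
  have P: "coeff (\<Prod>w\<in>#A'. [:1, - w:]) 0 = 1" "norm (coeff (\<Prod>w\<in>#A'. [:1, - w:]) 1) \<le> size A' * \<rho>"
    using prod_reciprocal_coeffs[of A' \<rho>] root A_root by (auto simp: A'_def)
  have "lead_coeff L * (\<Prod>x\<in>#A. - x) = 1"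
    using arg_cong[OF L_eq, of "\<lambda>p. coeff p 0"] P(1) by (simp add: cL c0)
  hence "L = (\<Prod>w\<in>#A'. [:1, - w:])" using L_eq by simp
  hence "norm (c 1) \<le> size A' * \<rho>" using P(2) cL[of 1] by simp
  also have "size A' \<le> n - 1" using A(1) degL by (simp add: A'_def)
  hence "size A' * \<rho> \<le> (real n - 1) * \<rho>" using n \<rho> by (intro mult_right_mono) linarith+
  finally show ?thesis .
qed

section \<open>The Weil bound\<close>

text \<open>All factors are powers \<open>\<alpha> i\<close> of one character sending \<gamma> to
  \<omega>, so their product is that character at f(x), the product of the (cs i - x)^(\<alpha> i),
  and the curve is y^d = f(x). \<open>coprime_exponents\<close> says that d and the
  \<open>\<alpha> i\<close> have no common factor; positive exponents make every \<open>cs i\<close>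
  a root of f, matching the value 0 of the i-th factor there.\<close>

locale cyclic_characters = frobenius_field q r ty
  for q r :: nat and ty :: "'k::alg_closed_field itself" +
  fixes n :: nat and cs :: "nat \<Rightarrow> 'k" and \<gamma> :: 'k and d t i0 :: nat and \<alpha> :: "nat \<Rightarrow> nat" and \<omega> :: complex
  assumes cs_fixed: "\<And>i. i < n \<Longrightarrow> cs i \<in> fixed 1"
    and cs_inj: "inj_on cs {..<n}"
    and \<gamma>_eq: "\<And>l l'. \<gamma> ^ l = \<gamma> ^ l' \<longleftrightarrow> l mod (q - 1) = l' mod (q - 1)"
    and \<gamma>_gen: "\<And>z. z \<in> fixed 1 \<longleftrightarrow> z = 0 \<or> (\<exists>l. z = \<gamma> ^ l)"
    and \<gamma>_0: "\<gamma> \<noteq> 0"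
    and dt: "q - 1 = d * t"
    and \<alpha>_pos: "\<And>i. i < n \<Longrightarrow> \<alpha> i > 0"
    and \<omega>: "\<omega> ^ d = 1" and \<omega>_sum: "(\<Sum>k<d. \<omega> ^ k) = 0"
    and i0: "i0 < n" and \<omega>_i0: "\<omega> ^ \<alpha> i0 \<noteq> 1"
    and coprime_exponents: "\<And>e. (\<And>i. i < n \<Longrightarrow> d dvd e * \<alpha> i) \<Longrightarrow> d dvd e"
begin

lemma d_pos: "d > 0" and t_pos: "t > 0"
  using dt q_gt_1 by (auto intro!: gr0I)

definition dlog :: "'k \<Rightarrow> nat" where "dlog z = (SOME l. z = \<gamma> ^ l)"

definition chr :: "nat \<Rightarrow> 'k \<Rightarrow> complex"
  where "chr i z = (if z = 0 then 0 else \<omega> ^ (\<alpha> i * dlog z))"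

lemma omega_mod: "\<omega> ^ l = \<omega> ^ (l mod d)"
proof -
  have "\<omega> ^ l = \<omega> ^ (d * (l div d) + l mod d)" by simp
  also have "\<dots> = \<omega> ^ (l mod d)" unfolding power_add power_mult by (simp add: \<omega>)
  finally show ?thesis .
qed

lemma norm_omega: "norm \<omega> = 1"
  using power_eq_1_iff[of "norm \<omega>" d] \<omega> d_pos by (metis norm_ge_zero norm_one norm_power power_eq_1_iff less_numeral_extra(3))

lemma chr_gamma: "chr i (\<gamma> ^ l) = \<omega> ^ (\<alpha> i * l)"
proof -
  have "\<gamma> ^ l = \<gamma> ^ dlog (\<gamma> ^ l)" unfolding dlog_def by (rule someI[of _ l]) simp
  hence "l mod (q - 1) = dlog (\<gamma> ^ l) mod (q - 1)" using \<gamma>_eq by simp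
  hence "l mod d = dlog (\<gamma> ^ l) mod d" unfolding dt by (metis mod_mod_cancel dvd_triv_left)
  hence "(\<alpha> i * l) mod d = (\<alpha> i * dlog (\<gamma> ^ l)) mod d" by (metis mod_mult_right_eq)
  thus ?thesis using omega_mod \<gamma>_0 by (metis chr_def power_not_zero)
qed

lemma gamma_range: "fixed 1 - {0} = (\<lambda>l. \<gamma> ^ l) ` {..<q - 1}"
proof (intro equalityI subsetI)
  fix z assume "z \<in> fixed 1 - {0}"
  then obtain l where "z = \<gamma> ^ l" using \<gamma>_gen by auto
  also have "\<dots> = \<gamma> ^ (l mod (q - 1))" by (subst \<gamma>_eq) simp
  finally show "z \<in> (\<lambda>l. \<gamma> ^ l) ` {..<q - 1}" using q_gt_1 by auto
qed (use \<gamma>_gen \<gamma>_0 in auto)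

lemma gamma_inj: "inj_on (\<lambda>l. \<gamma> ^ l) {..<q - 1}"
  by (rule inj_onI) (simp add: \<gamma>_eq)

sublocale character_family q r ty n cs chr i0
proof
  fix i x y assume xy: "x \<in> fixed 1" "y \<in> fixed 1"
  show "chr i (x * y) = chr i x * chr i y"
  proof (cases "x = 0 \<or> y = 0")
    case False
    then obtain l l' where "x = \<gamma> ^ l" "y = \<gamma> ^ l'" using xy \<gamma>_gen by auto
    thus ?thesis by (simp add: chr_gamma add_mult_distrib2 flip: power_add)
  qed (auto simp: chr_def)
next
  show "chr i 1 = 1" for i using chr_gamma[of i 0] by simp
next
  have "(\<Sum>v\<in>fixed 1. chr i0 v) = (\<Sum>v\<in>fixed 1 - {0}. chr i0 v)"
    using finite_fixed[of 1] by (intro sum.mono_neutral_right) (auto simp: chr_def)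
  also have "\<dots> = (\<Sum>l<q - 1. (\<omega> ^ \<alpha> i0) ^ l)"
    unfolding gamma_range sum.reindex[OF gamma_inj] by (simp add: chr_gamma power_mult)
  also have "\<dots> = 0"
  proof -
    have "(\<omega> ^ \<alpha> i0) ^ (q - 1) = (\<omega> ^ d) ^ (\<alpha> i0 * t)"
      unfolding dt by (simp add: mult_ac flip: power_mult)
    thus ?thesis using \<omega>_i0 by (simp add: geometric_sum \<omega>)
  qed
  finally show "(\<Sum>v\<in>fixed 1. chr i0 v) = 0" .
qed (use cs_fixed cs_inj i0 in auto)

definition kummer_poly :: "'k poly" where "kummer_poly = (\<Prod>i<n. [:cs i, -1:] ^ \<alpha> i)"

text \<open>This is (q^m - 1)/d, factored as the norm exponent 1 + q + ... + q^(m-1) times t = (q -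
  1)/d.\<close>

definition wt :: "nat \<Rightarrow> nat" where "wt m = (\<Sum>j<m. q ^ j) * t"

lemma geometric_q: "(q - 1) * (\<Sum>j<m. q ^ j) + 1 = q ^ m"
proof (induction m)
  case (Suc m)
  have "(q - 1) * (\<Sum>j<Suc m. q ^ j) + 1 = ((q - 1) * (\<Sum>j<m. q ^ j) + 1) + (q - 1) * q ^ m"
    by (simp add: algebra_simps)
  also have "\<dots> = q ^ m + (q - 1) * q ^ m" by (simp only: Suc)
  also have "\<dots> = (1 + (q - 1)) * q ^ m" by (simp only: distrib_right mult_1)
  also have "1 + (q - 1) = q" using q_gt_1 by simp
  finally show ?case by simp
qed simp

lemma wt: "q ^ m = d * wt m + 1"
  using geometric_q[of m] unfolding wt_def dt by (simp add: mult_ac)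

lemma kummer_poly_nonzero: "kummer_poly \<noteq> 0"
  by (simp add: kummer_poly_def)

lemma poly_kummer_poly: "poly kummer_poly x = (\<Prod>i<n. (cs i - x) ^ \<alpha> i)"
  by (simp add: kummer_poly_def poly_prod)

lemma order_kummer_poly:
  assumes "i < n"
  shows "order (cs i) kummer_poly = \<alpha> i"
proof -
  define g where "g = (\<Prod>j\<in>{..<n}-{i}. [:cs j, -1:] ^ \<alpha> j)"
  have "kummer_poly = [:cs i, -1:] ^ \<alpha> i * g"
    unfolding kummer_poly_def g_def using assms by (subst prod.remove[of _ i]) auto
  moreover have "[:cs i, -1:] ^ \<alpha> i = smult ((-1) ^ \<alpha> i) ([:- cs i, 1:] ^ \<alpha> i)"
    by (simp flip: smult_power)
  moreover have "order (cs i) g = 0"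
    using cs_inj assms by (intro order_0I) (auto simp: g_def poly_prod inj_on_def)
  moreover have "g \<noteq> 0" by (simp add: g_def)
  ultimately show ?thesis by (simp add: order_mult order_smult order_power_n_n del: smult_power)
qed

text \<open>Comparing orders at \<open>cs i\<close> gives d ord(u) = d ord(v) + e
  \<open>\<alpha> i\<close>, so d divides every e \<open>\<alpha> i\<close> and hence e, which is
  impossible for 0 < e < d.\<close>

lemma kummer_poly_not_power:
  assumes "0 < e" "e < d" "v \<noteq> 0" "b \<noteq> 0"
  shows "u ^ d \<noteq> smult b (v ^ d * kummer_poly ^ e)"
proof
  assume eq: "u ^ d = smult b (v ^ d * kummer_poly ^ e)"
  hence "u ^ d \<noteq> 0" using assms kummer_poly_nonzero by simp
  have order_power: "order x (p ^ k) = k * order x p" if "p \<noteq> 0" for x :: 'k and p k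
    using that by (induction k) (simp_all add: order_mult)
  have "d dvd e * \<alpha> i" if "i < n" for i
  proof -
    have "d * order (cs i) u = d * order (cs i) v + e * \<alpha> i"
      using arg_cong[OF eq, of "order (cs i)"] \<open>u ^ d \<noteq> 0\<close> assms kummer_poly_nonzero d_pos
      by (simp add: order_smult order_mult order_power order_kummer_poly[OF that])
    thus ?thesis by (metis dvd_add_right_iff dvd_triv_left)
  qed
  hence "d dvd e" by (rule coprime_exponents)
  thus False using assms by (auto dest: dvd_imp_le)
qed

lemma norm_char_zero:
  assumes "poly kummer_poly x = 0" "m > 0"
  shows "norm_char m x = 0"
proof -
  obtain i where i: "i < n" "cs i = x"
    using assms \<alpha>_pos by (auto simp: poly_kummer_poly)
  have "(\<Prod>j<m. (cs i - x) ^ q ^ j) = 0"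
    using i assms q_gt_1 by (intro prod_zero bexI[of _ 0]) auto
  thus ?thesis unfolding norm_char_def using i by (intro prod_zero bexI[of _ i]) (auto simp: chr_def)
qed

text \<open>The exponent 1 + q + ... + q^(m-1) sends each \<open>cs i - x\<close> to its norm in
  F_q, a power of \<gamma>. The logarithm l of the norm of f(x) then serves both formulas.\<close>

lemma norm_char_nonzero:
  assumes "poly kummer_poly x \<noteq> 0" "x \<in> fixed m" "m > 0"
  shows "\<exists>l. norm_char m x = \<omega> ^ l \<and> poly kummer_poly x ^ wt m = \<gamma> ^ (l * t)"
proof -
  define s where "s = (\<Sum>j<m. q ^ j)"
  have "\<exists>l. (cs i - x) ^ s = \<gamma> ^ l" if i: "i < n" for i
  proof -
    have nz: "cs i - x \<noteq> 0" using assms(1) i \<alpha>_pos by (auto simp: poly_kummer_poly)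
    have "cs i ^ (q ^ m) = cs i"
      by (induction m) (use cs_fixed[OF i] in \<open>auto simp: fixed_def power_mult\<close>)
    hence "(cs i - x) ^ (q ^ m) = cs i - x" using assms(2) by (simp add: diff_power_q fixed_def)
    moreover have "q ^ m = (q - 1) * s + 1" using geometric_q[of m] by (simp add: s_def)
    ultimately have "(cs i - x) ^ ((q - 1) * s) * (cs i - x) = 1 * (cs i - x)"
      by (simp add: power_add)
    hence "(cs i - x) ^ ((q - 1) * s) = 1" using nz by (metis mult_right_cancel)
    hence "((cs i - x) ^ s) ^ (q - 1) * (cs i - x) ^ s = (cs i - x) ^ s"
      by (simp add: mult.commute flip: power_mult)
    hence "((cs i - x) ^ s) ^ Suc (q - 1) = (cs i - x) ^ s" by (simp only: power_Suc2)
    hence "(cs i - x) ^ s \<in> fixed 1" using q_gt_1 by (simp add: fixed_def)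
    thus ?thesis using \<gamma>_gen nz by simp
  qed
  then obtain l where l: "\<And>i. i < n \<Longrightarrow> (cs i - x) ^ s = \<gamma> ^ l i" by metis
  have "norm_char m x = (\<Prod>i<n. chr i (\<gamma> ^ l i))"
    unfolding norm_char_def by (intro prod.cong) (auto simp: l[unfolded s_def] simp flip: power_sum)
  also have "\<dots> = \<omega> ^ (\<Sum>i<n. \<alpha> i * l i)" by (simp add: chr_gamma power_sum)
  finally have 1: "norm_char m x = \<omega> ^ (\<Sum>i<n. \<alpha> i * l i)" .
  have "poly kummer_poly x ^ wt m = (\<Prod>i<n. (((cs i - x) ^ s) ^ \<alpha> i)) ^ t"
    by (simp add: poly_kummer_poly wt_def s_def prod_power_distrib mult_ac flip: power_mult)
  also have "(\<Prod>i<n. (((cs i - x) ^ s) ^ \<alpha> i)) = \<gamma> ^ (\<Sum>i<n. \<alpha> i * l i)"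
    unfolding power_sum by (intro prod.cong) (auto simp: l mult.commute simp flip: power_mult)
  finally show ?thesis using 1 by (auto simp: power_mult)
qed

lemma gamma_t: "\<gamma> ^ (l * t) = \<gamma> ^ (l' * t) \<longleftrightarrow> l mod d = l' mod d"
  unfolding \<gamma>_eq dt using t_pos by (simp add: mult_mod_left flip: mult_mod_left)

text \<open>\<gamma>^t has order d, so for k < d and m > 0 these are the classes of nonzero f(x)
  modulo d-th powers in F_{q^m}; \<open>norm_char m\<close> is constantly \<omega>^k on the
  class.\<close>

definition fibre :: "nat \<Rightarrow> nat \<Rightarrow> 'k set"
  where "fibre m k = {x \<in> fixed m. poly kummer_poly x ^ wt m = \<gamma> ^ (k * t)}"

text \<open>Splits q^m as R R' with R and R' powers of q as equal as the parity of m allows; the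
  error in \<open>stepanov_bound\<close> is then a constant times R <= q^((m+1)/2).\<close>

lemma fibre_card_le:
  assumes "m \<ge> 4 * d * degree kummer_poly + 4"
  shows "real (card (fibre m k)) \<le> q ^ m / d + (3 * degree kummer_poly + 3) * sqrt q * sqrt q ^ m"
proof -
  define M where "M = degree kummer_poly"
  define \<mu> where "\<mu> = (m + 1) div 2"
  define \<nu> where "\<nu> = m div 2"
  have m: "m = \<mu> + \<nu>" "\<nu> \<le> \<mu>" "2 * \<mu> \<le> m + 1" by (auto simp: \<mu>_def \<nu>_def)
  have "q ^ \<mu> * q ^ \<nu> = q ^ m" by (simp add: m power_add)
  moreover have "wt m = q ^ \<nu> * wt \<mu> + wt \<nu>"
  proof -
    have "d * wt m + 1 = q ^ \<nu> * q ^ \<mu>" using wt[of m] by (simp add: m(1) power_add mult.commute)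
    also have "\<dots> = q ^ \<nu> * (d * wt \<mu>) + q ^ \<nu>" by (subst wt[of \<mu>]) (simp only: distrib_left mult_1_right)
    also have "\<dots> = q ^ \<nu> * (d * wt \<mu>) + (d * wt \<nu> + 1)" by (simp only: wt[of \<nu>, symmetric])
    also have "\<dots> = d * (q ^ \<nu> * wt \<mu> + wt \<nu>) + 1" by (simp only: distrib_left mult.left_commute add.assoc)
    finally show ?thesis using d_pos by simp
  qed
  ultimately have fib: "fibre m k = {x. x ^ (q ^ \<mu> * q ^ \<nu>) = x \<and> poly kummer_poly x ^ (q ^ \<nu> * wt \<mu> + wt \<nu>) = \<gamma> ^ (k * t)}"
    by (simp add: fibre_def fixed_def)
  have "of_nat d \<noteq> (0 :: 'k)"
  proof
    assume "of_nat d = (0 :: 'k)"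
    hence "CHAR('k) dvd d * t" by (simp add: of_nat_eq_0_iff_char_dvd)
    hence "CHAR('k) dvd q - 1" by (simp only: dt)
    moreover have "CHAR('k) dvd q" using r by (simp add: q_def)
    ultimately have "CHAR('k) dvd 1" using q_gt_1 by (metis dvd_diffD1 less_imp_le)
    thus False using char by (metis not_prime_unit)
  qed
  \<comment> \<open>The lower bound on m gives q^\<mu> > \<mu> >= 2dM + 2, hence 2 (q^\<mu> - 1) -
    2dM >= q^\<mu>.\<close>
  moreover have "q ^ \<mu> \<le> 2 * d * (wt \<mu> - M)"
  proof -
    have "\<mu> < q ^ \<mu>" using power_gt_expt[of q \<mu>] q_gt_1 by simp
    moreover have "m \<ge> 4 * (d * M) + 4" using assms by (simp add: M_def)
    ultimately have "q ^ \<mu> \<ge> 2 * (d * M) + 2" unfolding \<mu>_def by linarith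
    moreover have "2 * d * (wt \<mu> - M) = 2 * (d * wt \<mu>) - 2 * (d * M)" by (simp add: diff_mult_distrib2)
    ultimately show ?thesis using wt[of \<mu>] by linarith
  qed
  ultimately have "d * card (fibre m k) \<le> q ^ \<mu> * q ^ \<nu> + d * (3 * M + 3) * q ^ \<mu>"
    unfolding fib M_def using m(2) q_gt_1 \<gamma>_0
    by (intro stepanov_bound[OF char q_power wt q_power wt _ _ kummer_poly_nonzero kummer_poly_not_power]) auto
  hence "d * card (fibre m k) \<le> q ^ m + d * ((3 * M + 3) * q ^ \<mu>)"
    by (simp add: m(1) power_add mult.assoc)
  hence "real (d * card (fibre m k)) \<le> real (q ^ m + d * ((3 * M + 3) * q ^ \<mu>))"
    by (simp only: of_nat_le_iff)
  hence "real d * real (card (fibre m k)) \<le> real q ^ m + real d * ((3 * real M + 3) * real q ^ \<mu>)"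
    by (simp only: of_nat_mult of_nat_add of_nat_power of_nat_numeral)
  also have "real q ^ \<mu> = sqrt q ^ (2 * \<mu>)" by (simp add: power_mult)
  also have "real d * ((3 * real M + 3) * sqrt q ^ (2 * \<mu>)) \<le> real d * ((3 * real M + 3) * sqrt q ^ (m + 1))"
    using m(3) q_gt_1 by (intro mult_left_mono power_increasing) auto
  finally have "real d * real (card (fibre m k)) \<le> real q ^ m + real d * ((3 * real M + 3) * sqrt q ^ (m + 1))"
    by simp
  thus ?thesis using d_pos by (simp add: M_def field_simps)
qed

text \<open>Since the \<omega>^k sum to zero, a common value u may be subtracted from all fibre
  counts. With u the upper bound, the differences have one sign, so their absolute sum is d u minus
  the total count, that is, at most d times the error plus the at most n zeros of f.\<close>

lemma char_sum_bound:
  assumes m: "m \<ge> 4 * d * degree kummer_poly + 4"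
  shows "norm (char_sum m) \<le> (d * (3 * degree kummer_poly + 3) * sqrt q + n) * sqrt q ^ m"
proof -
  have m0: "m > 0" using m by simp
  define \<epsilon> where "\<epsilon> = (3 * degree kummer_poly + 3) * sqrt q * sqrt q ^ m"
  define u where "u = real q ^ m / d + \<epsilon>"
  define Z where "Z = {x \<in> fixed m. poly kummer_poly x = 0}"
  note fin = finite_fixed[OF m0]
  have finf: "finite (fibre m k)" for k using fin by (simp add: fibre_def)
  have finZ: "finite Z" using fin by (simp add: Z_def)
  have wt0: "wt m > 0"
  proof (rule gr0I)
    assume "wt m = 0"
    hence "q ^ m = 1" using wt[of m] by simp
    thus False using one_less_power[OF q_gt_1 m0] by linarith
  qed
  have nc: "norm_char m x = \<omega> ^ k" if "x \<in> fibre m k" for x k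
  proof -
    have x: "x \<in> fixed m" "poly kummer_poly x ^ wt m = \<gamma> ^ (k * t)" using that by (auto simp: fibre_def)
    hence "poly kummer_poly x \<noteq> 0" using \<gamma>_0 wt0 by (auto simp: power_0_left)
    then obtain l where "norm_char m x = \<omega> ^ l" "poly kummer_poly x ^ wt m = \<gamma> ^ (l * t)"
      using norm_char_nonzero x(1) m0 by blast
    thus ?thesis using x(2) gamma_t omega_mod by metis
  qed
  have un: "fixed m = Z \<union> (\<Union>k<d. fibre m k)"
  proof (intro equalityI subsetI)
    fix x assume x: "x \<in> fixed m"
    show "x \<in> Z \<union> (\<Union>k<d. fibre m k)"
    proof (cases "poly kummer_poly x = 0")
      case False
      then obtain l where "poly kummer_poly x ^ wt m = \<gamma> ^ (l * t)" using norm_char_nonzero x m0 by blast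
      hence "x \<in> fibre m (l mod d)" using x gamma_t[of l "l mod d"] by (simp add: fibre_def)
      thus ?thesis using d_pos by auto
    qed (use x in \<open>auto simp: Z_def\<close>)
  qed (auto simp: Z_def fibre_def)
  have disj: "Z \<inter> (\<Union>k<d. fibre m k) = {}"
    using \<gamma>_0 wt0 by (auto simp: Z_def fibre_def power_0_left)
  have disj2: "fibre m k \<inter> fibre m k' = {}" if "k < d" "k' < d" "k \<noteq> k'" for k k'
    using gamma_t[of k k'] that by (auto simp: fibre_def)
  have "char_sum m = (\<Sum>x\<in>Z. norm_char m x) + (\<Sum>x\<in>(\<Union>k<d. fibre m k). norm_char m x)"
    unfolding char_sum_def un using disj finf finZ by (intro sum.union_disjoint) auto
  also have "(\<Sum>x\<in>Z. norm_char m x) = 0"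
    using norm_char_zero m0 by (intro sum.neutral) (auto simp: Z_def)
  also have "(\<Sum>x\<in>(\<Union>k<d. fibre m k). norm_char m x) = (\<Sum>k<d. \<Sum>x\<in>fibre m k. norm_char m x)"
    using finf disj2 by (intro sum.UNION_disjoint) auto
  also have "\<dots> = (\<Sum>k<d. of_nat (card (fibre m k)) * \<omega> ^ k)" by (simp add: nc)
  also have "\<dots> = (\<Sum>k<d. of_real (real (card (fibre m k)) - u) * \<omega> ^ k)"
    using \<omega>_sum by (simp add: algebra_simps sum_subtractf flip: sum_distrib_left)
  finally have cs: "char_sum m = (\<Sum>k<d. of_real (real (card (fibre m k)) - u) * \<omega> ^ k)" by simp
  have cardZ: "card Z \<le> n"
  proof -
    have "Z \<subseteq> cs ` {..<n}" by (auto simp: Z_def poly_kummer_poly)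
    thus ?thesis by (metis card_image_le card_lessThan card_mono finite_imageI finite_lessThan le_trans)
  qed
  have "q ^ m = card Z + (\<Sum>k<d. card (fibre m k))"
    unfolding card_fixed[OF m0, symmetric] un using disj finf finZ disj2
    by (subst card_Un_disjoint) (auto simp: card_UN_disjoint)
  hence tot: "real q ^ m \<le> n + (\<Sum>k<d. real (card (fibre m k)))"
    using cardZ by (simp flip: of_nat_power of_nat_sum of_nat_add)
  have "norm (char_sum m) \<le> (\<Sum>k<d. norm (of_real (real (card (fibre m k)) - u) * \<omega> ^ k))"
    unfolding cs by (rule norm_sum)
  also have "\<dots> = (\<Sum>k<d. u - real (card (fibre m k)))"
  proof (intro sum.cong refl)
    fix k
    show "norm (of_real (real (card (fibre m k)) - u) * \<omega> ^ k) = u - real (card (fibre m k))"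
      using fibre_card_le[OF m, of k]
      by (simp only: norm_mult norm_power norm_omega norm_of_real power_one mult_1_right of_nat_power u_def \<epsilon>_def)
  qed
  also have "\<dots> = real q ^ m + d * \<epsilon> - (\<Sum>k<d. real (card (fibre m k)))"
  proof -
    have "real d * u = real q ^ m + d * \<epsilon>"
      unfolding u_def distrib_left using d_pos by simp
    thus ?thesis by (simp only: sum_subtractf sum_constant card_lessThan)
  qed
  also have "\<dots> \<le> d * \<epsilon> + real n * 1" using tot by simp
  also have "\<dots> \<le> d * \<epsilon> + real n * sqrt q ^ m"
    using q_gt_1 by (intro add_left_mono mult_left_mono one_le_power) auto
  finally show ?thesis by (simp add: \<epsilon>_def algebra_simps)
qed

theorem weil_bound: "norm (\<Sum>x\<in>fixed 1. \<Prod>i<n. chr i (cs i - x)) \<le> (real n - 1) * sqrt q"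
proof -
  have "norm (L_coeff 1) \<le> (real n - 1) * sqrt q"
    using q_gt_1
    by (intro newton_coefficient_bound[OF L_coeff_0 L_coeff_eq_0 newton_identity char_sum_bound]) auto
  also have "L_coeff 1 = char_sum 1" using newton_identity[of 1] by (simp add: L_coeff_0)
  finally show ?thesis by (simp add: char_sum_def norm_char_def)
qed

end

section \<open>Transfer to a finite field and consecutive arguments\<close>

lemma finite_field_generator:
  "\<exists>g :: 'a::finite_field. g \<noteq> 0 \<and> (\<forall>x. x \<noteq> 0 \<longrightarrow> (\<exists>l. x = g ^ l))"
proof -
  define R where "R = (ring_of_type_algebra :: 'a ring)"
  interpret field R unfolding R_def by (rule field_from_type_algebra)
  have car: "carrier R = UNIV" and zero: "\<zero>\<^bsub>R\<^esub> = 0"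
    and one: "\<one>\<^bsub>R\<^esub> = 1" and mult: "x \<otimes>\<^bsub>R\<^esub> y = x * y" for x y
    by (simp_all add: R_def ring_of_type_algebra_def)
  have pow: "x [^]\<^bsub>R\<^esub> l = x ^ l" for x :: 'a and l :: nat
    by (induction l) (simp_all add: nat_pow_Suc mult one mult_ac)
  obtain g where g: "g \<in> carrier (mult_of R)" "carrier (mult_of R) = {g [^]\<^bsub>R\<^esub> i | i::nat. i \<in> UNIV}"
    using finite_field_mult_group_has_gen by (auto simp: car)
  have "x = 0 \<or> (\<exists>l. x = g ^ l)" for x
    using g(2) by (auto simp: car zero pow carrier_mult_of)
  moreover have "g \<noteq> 0" using g(1) by (simp add: zero carrier_mult_of)
  ultimately show ?thesis by blast
qed

lemma generator_power_eq_iff: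
  fixes g :: "'a::finite_field"
  assumes g: "g \<noteq> 0" "\<And>x. x \<noteq> 0 \<Longrightarrow> \<exists>l. x = g ^ l"
  shows "g ^ l = g ^ l' \<longleftrightarrow> l mod (CARD('a) - 1) = l' mod (CARD('a) - 1)"
proof -
  define h where "h = CARD('a) - 1"
  have "CARD('a) > 1"
    using card_mono[of UNIV "{0, 1 :: 'a}"] by simp
  hence h0: "h > 0" and q: "CARD('a) = Suc h" by (simp_all add: h_def)
  have "g ^ h * g = 1 * g"
    using finite_field_power_card_eq_same[of g] unfolding q by (simp add: mult.commute)
  hence gh: "g ^ h = 1" using g(1) by simp
  have gmod: "g ^ l = g ^ (l mod h)" for l
  proof -
    have "g ^ l = g ^ (h * (l div h) + l mod h)" by simp
    thus ?thesis unfolding power_add power_mult by (simp add: gh)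
  qed
  have "UNIV - {0} \<subseteq> (\<lambda>l. g ^ l) ` {..<h}"
  proof
    fix x :: 'a assume "x \<in> UNIV - {0}"
    then obtain l where "x = g ^ (l mod h)" using g(2)[of x] gmod by auto
    thus "x \<in> (\<lambda>l. g ^ l) ` {..<h}" using h0 by auto
  qed
  hence "card (UNIV - {0 :: 'a}) \<le> card ((\<lambda>l. g ^ l) ` {..<h})" by (intro card_mono) auto
  hence "card ((\<lambda>l. g ^ l) ` {..<h}) = card {..<h}"
    using card_image_le[of "{..<h}" "\<lambda>l. g ^ l"] by (simp add: card_Diff_singleton q)
  hence inj: "inj_on (\<lambda>l. g ^ l) {..<h}" by (intro eq_card_imp_inj_on) auto
  show ?thesis unfolding h_def[symmetric]
    using gmod[of l] gmod[of l'] inj_onD[OF inj, of "l mod h" "l' mod h"] h0 by auto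
qed

definition mult_char :: "('a::field \<Rightarrow> complex) \<Rightarrow> bool"
  where "mult_char \<chi> \<longleftrightarrow> \<chi> 0 = 0 \<and> \<chi> 1 = 1 \<and> (\<forall>x y. \<chi> (x * y) = \<chi> x * \<chi> y)"

lemma mult_char_power: "mult_char \<chi> \<Longrightarrow> \<chi> (x ^ l) = \<chi> x ^ l"
  by (induction l) (auto simp: mult_char_def)

text \<open>The field becomes the fixed field of Frobenius in its algebraic closure, with
  \<open>cs i\<close> equal to i; these are distinct since n <= p. The substitution x -> -x turns i
  - x into x + i.\<close>

theorem weil_consecutive:
  fixes \<chi> :: "nat \<Rightarrow> 'a::finite_field \<Rightarrow> complex"
  assumes card: "CARD('a) = CHAR('a) ^ r" "r > 0" and n: "n \<le> CHAR('a)"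
    and \<chi>: "\<And>i. i < n \<Longrightarrow> mult_char (\<chi> i)"
    and i0: "i0 < n" and nontriv: "\<exists>x. x \<noteq> 0 \<and> \<chi> i0 x \<noteq> 1"
  shows "norm (\<Sum>x\<in>UNIV. \<Prod>i<n. \<chi> i (x + of_nat i)) \<le> (real n - 1) * sqrt (CARD('a))"
proof -
  define q where "q = CARD('a)"
  define h where "h = q - 1"
  interpret K: frobenius_field q r "TYPE('a alg_closure)"
    by standard (use card in \<open>simp_all add: q_def\<close>)
  have q1: "q > 1" by (rule K.q_gt_1)
  hence h0: "h > 0" by (simp add: h_def)
  obtain g :: 'a where g: "g \<noteq> 0" "\<And>x. x \<noteq> 0 \<Longrightarrow> \<exists>l. x = g ^ l"
    using finite_field_generator by blast
  have geq: "g ^ l = g ^ l' \<longleftrightarrow> l mod h = l' mod h" for l l'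
    using generator_power_eq_iff[OF g] by (simp add: h_def q_def)
  have gh: "g ^ h = 1" using geq[of h 0] by simp
  have fixed: "K.fixed 1 = range to_ac"
  proof (rule sym, rule card_subset_eq)
    show "finite (K.fixed 1)" by (rule K.finite_fixed) simp
    show "range to_ac \<subseteq> K.fixed 1"
    proof -
      have "x ^ q = x" for x :: 'a unfolding q_def by (rule finite_field_power_card_eq_same)
      thus ?thesis by (auto simp: K.fixed_def simp flip: to_ac_power)
    qed
    show "card (range (to_ac :: 'a \<Rightarrow> _)) = card (K.fixed 1)"
      by (subst K.card_fixed) (simp_all add: card_image inj_to_ac q_def)
  qed
  have "\<exists>A<h. \<chi> i g = cis (2 * pi * real A / real h)" if "i < n" for i
  proof -
    have "\<chi> i g ^ h = 1"
      using mult_char_power[OF \<chi>[OF that], of g h] \<chi>[OF that] by (simp add: gh mult_char_def)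
    thus ?thesis using bij_betw_imp_surj_on[OF bij_betw_roots_unity[OF h0]] by auto
  qed
  then obtain A where A: "\<And>i. i < n \<Longrightarrow> A i < h" "\<And>i. i < n \<Longrightarrow> \<chi> i g = cis (2 * pi * real (A i) / real h)"
    by metis
  \<comment> \<open>Dividing h and the exponents by their common divisor t makes the exponents
    jointly coprime to d = h / t, as \<open>coprime_exponents\<close> requires.\<close>
  define t where "t = Gcd (insert h (A ` {..<n}))"
  define d where "d = h div t"
  have th: "t dvd h" and tA: "\<And>i. i < n \<Longrightarrow> t dvd A i"
    unfolding t_def by (rule Gcd_dvd, simp)+
  have hdt: "h = d * t" using th by (simp add: d_def)
  have d0: "d > 0" "t > 0" using h0 hdt by (auto intro!: gr0I)
  \<comment> \<open>Adding d makes the exponent positive and leaves the power of \<omega> unchanged,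
    as \<omega>^d = 1.\<close>
  define \<alpha> where "\<alpha> i = A i div t + d" for i
  define \<omega> where "\<omega> = cis (2 * pi / real d)"
  have \<omega>d: "\<omega> ^ d = 1" using d0 by (simp add: \<omega>_def DeMoivre)
  have \<omega>\<alpha>: "\<omega> ^ \<alpha> i = \<chi> i g" if "i < n" for i
  proof -
    have "real (A i) = real t * real (A i div t)" using tA[OF that] by (simp flip: of_nat_mult)
    hence "2 * pi * real (A i) / real h = real (A i div t) * (2 * pi / real d)"
      using d0 by (simp add: hdt field_simps)
    thus ?thesis unfolding \<alpha>_def power_add \<omega>d A(2)[OF that] by (simp add: \<omega>_def DeMoivre)
  qed
  have \<chi>pow: "\<chi> i (g ^ l) = \<omega> ^ (\<alpha> i * l)" if "i < n" for i l
    by (simp add: mult_char_power[OF \<chi>[OF that]] \<omega>\<alpha>[OF that] power_mult)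
  obtain x where "x \<noteq> 0" "\<chi> i0 x \<noteq> 1" using nontriv by blast
  then obtain l where "\<chi> i0 (g ^ l) \<noteq> 1" using g(2) by metis
  hence \<omega>i0: "\<omega> ^ \<alpha> i0 \<noteq> 1" using \<chi>pow[OF i0, of l] by (auto simp: power_mult)
  have "\<omega> \<noteq> 1" using \<omega>i0 by auto
  hence \<omega>sum: "(\<Sum>k<d. \<omega> ^ k) = 0" by (simp add: geometric_sum \<omega>d)
  interpret K: cyclic_characters q r "TYPE('a alg_closure)" n "\<lambda>i. of_nat i" "to_ac g" d t i0 \<alpha> \<omega>
  proof
    show "of_nat i \<in> K.fixed 1" for i unfolding fixed by (rule image_eqI[of _ _ "of_nat i"]) simp_all
    show "inj_on (\<lambda>i. of_nat i :: 'a alg_closure) {..<n}"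
    proof (rule linorder_inj_onI)
      fix i j :: nat assume "i < j" "i \<in> {..<n}" "j \<in> {..<n}"
      hence "\<not> CHAR('a) dvd j - i" using n by (auto dest: dvd_imp_le)
      hence "of_nat (j - i) \<noteq> (0 :: 'a alg_closure)" by (simp add: of_nat_eq_0_iff_char_dvd)
      thus "of_nat i \<noteq> (of_nat j :: 'a alg_closure)" using \<open>i < j\<close> by (simp add: of_nat_diff)
    qed auto
    show "to_ac g ^ l = to_ac g ^ l' \<longleftrightarrow> l mod (q - 1) = l' mod (q - 1)" for l l'
      using geq[of l l'] by (simp add: h_def flip: to_ac_power)
    show "z \<in> K.fixed 1 \<longleftrightarrow> z = 0 \<or> (\<exists>l. z = to_ac g ^ l)" for z
    proof -
      have "z \<in> range to_ac \<longleftrightarrow> z = 0 \<or> (\<exists>l. z = to_ac (g ^ l))"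
        using g(2) by (metis rangeE rangeI to_ac_0)
      thus ?thesis unfolding fixed by simp
    qed
    show "to_ac g \<noteq> 0" using g by simp
    show "q - 1 = d * t" using hdt by (simp add: h_def)
    show "\<alpha> i > 0" for i using d0 by (simp add: \<alpha>_def)
    fix e assume e: "\<And>i. i < n \<Longrightarrow> d dvd e * \<alpha> i"
    have "h dvd e * A i" if "i < n" for i
    proof -
      have "d dvd e * (A i div t)" using e[OF that] by (simp add: \<alpha>_def distrib_left dvd_add_left_iff)
      hence "d * t dvd e * (A i div t) * t" by simp
      thus ?thesis using tA[OF that] by (simp add: hdt mult.assoc)
    qed
    hence "h dvd Gcd ((*) e ` insert h (A ` {..<n}))" by (intro Gcd_greatest) auto
    hence "h dvd e * t" unfolding Gcd_mult t_def by simp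
    hence "d * t dvd e * t" by (simp only: hdt)
    thus "d dvd e" using d0 by simp
  qed (use \<omega>d \<omega>sum i0 \<omega>i0 in auto)
  have chr: "K.chr i (to_ac v) = \<chi> i v" if "i < n" for i v
  proof (cases "v = 0")
    case True
    thus ?thesis using \<chi>[OF that] by (simp add: K.chr_def mult_char_def)
  next
    case False
    then obtain l where "v = g ^ l" using g(2) by blast
    thus ?thesis using K.chr_gamma[of i l] \<chi>pow[OF that] by simp
  qed
  have "(\<Sum>x\<in>K.fixed 1. \<Prod>i<n. K.chr i (of_nat i - x)) = (\<Sum>x\<in>UNIV. \<Prod>i<n. \<chi> i (x + of_nat i))"
  proof -
    have "(\<Sum>x\<in>K.fixed 1. \<Prod>i<n. K.chr i (of_nat i - x)) = (\<Sum>y\<in>UNIV. \<Prod>i<n. K.chr i (to_ac (of_nat i - y)))"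
      unfolding fixed by (subst sum.reindex[OF inj_to_ac]) simp
    also have "\<dots> = (\<Sum>y\<in>UNIV. \<Prod>i<n. \<chi> i (of_nat i - y))"
      by (intro sum.cong prod.cong refl chr) auto
    also have "\<dots> = (\<Sum>x\<in>UNIV. \<Prod>i<n. \<chi> i (x + of_nat i))"
      by (rule sum.reindex_bij_witness[where i = uminus and j = uminus]) auto
    finally show ?thesis .
  qed
  thus ?thesis using K.weil_bound by (simp add: q_def)
qed

section \<open>The sieve\<close>

locale sieve =
  fixes g :: "'a::finite_field" and h r n :: nat
  assumes g: "g \<noteq> 0" "\<And>x. x \<noteq> 0 \<Longrightarrow> \<exists>l. x = g ^ l"
    and g_eq: "\<And>l l'. g ^ l = g ^ l' \<longleftrightarrow> l mod h = l' mod h"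
    and card: "CARD('a) = h + 1" "CARD('a) = CHAR('a) ^ r" "r > 0"
    and h_mod_4: "h mod 4 = 2"
    and n: "n > 0" "n \<le> CHAR('a)"
begin

text \<open>A discrete logarithm, determined only modulo h. For nonzero x and a prime p dividing h,
  \<open>p dvd ind x\<close> says that x is a p-th power.\<close>

definition ind :: "'a \<Rightarrow> nat" where "ind x = (SOME l. x = g ^ l)"

lemma h_pos: "h > 0" using h_mod_4 by (auto intro!: gr0I)

lemma power_ind: "x \<noteq> 0 \<Longrightarrow> g ^ ind x = x"
  unfolding ind_def using someI_ex[OF g(2), of x] by simp

lemma ind_power: "ind (g ^ l) mod h = l mod h"
  using power_ind[of "g ^ l"] g(1) by (simp add: g_eq)

lemma dvd_ind_power: "p dvd h \<Longrightarrow> p dvd ind (g ^ l) \<longleftrightarrow> p dvd l"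
  using ind_power[of l] by (metis dvd_mod_iff)

text \<open>Normalised to mean zero over the nonzero elements; (1 - 1/p)(1 + weight) is the
  indicator of not being a p-th power.\<close>

definition weight :: "nat \<Rightarrow> 'a \<Rightarrow> real"
  where "weight p x = (if p dvd ind x then -1 else 1 / (real p - 1))"

definition weight_prod :: "nat set \<Rightarrow> 'a \<Rightarrow> real"
  where "weight_prod T x = (\<Prod>p\<in>T. weight p x)"

definition residue_char :: "nat \<Rightarrow> 'a \<Rightarrow> complex"
  where "residue_char p x = cis (2 * pi * real (ind x) / real p)"

lemma cis_eq_mod:
  assumes "k mod p = l mod p" "p > 0"
  shows "cis (2 * pi * real k / real p) = cis (2 * pi * real l / real p)"
proof -
  have *: "cis (2 * pi * real k / real p) = cis (2 * pi * real (k mod p) / real p)" for k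
  proof -
    have "real k = real p * real (k div p) + real (k mod p)"
      by (simp flip: of_nat_mult of_nat_add)
    hence "2 * pi * real k / real p = 2 * pi * real (k div p) + 2 * pi * real (k mod p) / real p"
      using assms(2) by (simp add: field_simps)
    moreover have "cis (2 * pi * real (k div p)) = 1"
      using cis_multiple_2pi[of "real (k div p)"] by simp
    ultimately show ?thesis by (simp flip: cis_mult)
  qed
  show ?thesis using *[of k] *[of l] assms(1) by simp
qed

lemma residue_char_power:
  assumes "p dvd h" "p > 0"
  shows "residue_char p (g ^ l) = cis (2 * pi * real l / real p)"
  unfolding residue_char_def
  by (rule cis_eq_mod) (use assms ind_power[of l] in \<open>auto dest: arg_cong[of _ _ "\<lambda>x. x mod p"] simp: mod_mod_cancel\<close>)

lemma cis_eq_1_iff_dvd: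
  assumes "p > 0"
  shows "cis (2 * pi * real l / real p) = 1 \<longleftrightarrow> p dvd l"
proof
  assume *: "cis (2 * pi * real l / real p) = 1"
  have "cis (2 * pi * real (l mod p) / real p) = cis (2 * pi * real 0 / real p)"
    using cis_eq_mod[of "l mod p" p l] assms * by simp
  moreover have "inj_on (\<lambda>k. cis (2 * pi * real k / real p)) {..<p}"
    using bij_betw_roots_unity[OF assms] by (rule bij_betw_imp_inj_on)
  ultimately have "l mod p = 0"
    using assms by (metis inj_onD lessThan_iff mod_less_divisor)
  thus "p dvd l" by auto
next
  assume "p dvd l"
  thus "cis (2 * pi * real l / real p) = 1" using cis_eq_mod[of l p 0] assms by simp
qed

lemma weight_eq_char_sum:
  assumes "prime p" "p dvd h"
  shows "complex_of_real (weight p x) = (\<Sum>b\<in>{1..<p}. - (1 / (of_nat p - 1)) * residue_char p x ^ b)"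
proof -
  have p: "p > 1" using assms prime_gt_1_nat by blast
  define z where "z = residue_char p x"
  have z1: "z = 1 \<longleftrightarrow> p dvd ind x"
    unfolding z_def residue_char_def using p by (intro cis_eq_1_iff_dvd) simp
  have zp: "z ^ p = 1"
  proof -
    have "z ^ p = cis (2 * pi * real (ind x * p) / real p)"
      unfolding z_def residue_char_def DeMoivre by (simp add: mult_ac)
    thus ?thesis using p cis_eq_1_iff_dvd[of p "ind x * p"] by simp
  qed
  have ne: "of_nat p - 1 \<noteq> (0 :: complex)" using p by simp
  have "(\<Sum>b<p. z ^ b) = z ^ 0 + (\<Sum>b\<in>{1..<p}. z ^ b)"
    using p by (simp add: lessThan_atLeast0 sum.atLeast_Suc_lessThan)
  hence "(\<Sum>b\<in>{1..<p}. z ^ b) = (\<Sum>b<p. z ^ b) - 1" by simp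
  also have "\<dots> = (if p dvd ind x then of_nat p - 1 else -1)"
    using z1 zp by (auto simp: geometric_sum)
  finally have "(\<Sum>b\<in>{1..<p}. z ^ b) = (if p dvd ind x then of_nat p - 1 else -1)" .
  thus ?thesis using ne unfolding z_def sum_distrib_left[symmetric] by (simp add: weight_def)
qed

text \<open>Each \<open>residue_char\<close> is nonzero even at 0, so the value 0 is imposed here;
  for empty \<open>T\<close> this gives the principal character rather than the constant 1.\<close>

definition product_char :: "nat set \<Rightarrow> (nat \<Rightarrow> nat) \<Rightarrow> 'a \<Rightarrow> complex"
  where "product_char T b x = (if x = 0 then 0 else \<Prod>p\<in>T. residue_char p x ^ b p)"

lemma mult_char_product_char:
  assumes "\<And>p. p \<in> T \<Longrightarrow> prime p \<and> p dvd h"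
  shows "mult_char (product_char T b)"
proof -
  have p0: "p > 0" if "p \<in> T" for p using assms[OF that] prime_gt_0_nat by blast
  have "residue_char p (x * y) = residue_char p x * residue_char p y"
    if "p \<in> T" "x \<noteq> 0" "y \<noteq> 0" for p x y
  proof -
    have "x * y = g ^ (ind x + ind y)" using that by (simp add: power_add power_ind)
    hence "residue_char p (x * y) = cis (2 * pi * real (ind x + ind y) / real p)"
      using residue_char_power that(1) assms p0 by metis
    thus ?thesis by (simp add: residue_char_def cis_mult add_divide_distrib distrib_left)
  qed
  hence "product_char T b (x * y) = product_char T b x * product_char T b y" for x y
    by (auto simp: product_char_def power_mult_distrib simp flip: prod.distrib intro!: prod.cong)
  moreover have "residue_char p 1 = 1" if "p \<in> T" for p
    using residue_char_power[of p 0] that assms p0 by simp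
  ultimately show ?thesis by (simp add: mult_char_def product_char_def)
qed

lemma product_char_nontrivial:
  assumes T: "finite T" "\<And>p. p \<in> T \<Longrightarrow> prime p \<and> p dvd h" "T \<noteq> {}"
    and b: "\<And>p. p \<in> T \<Longrightarrow> b p \<in> {1..<p}"
  shows "\<exists>x. x \<noteq> 0 \<and> product_char T b x \<noteq> 1"
proof -
  obtain p where p: "p \<in> T" using T by blast
  have pr: "prime p" "p dvd h" "p > 0" using T(2)[OF p] prime_gt_0_nat by auto
  \<comment> \<open>At g^M the characters belonging to the other primes are trivial, while p divides
    neither M nor \<open>b p\<close>.\<close>
  define M where "M = \<Prod>(T - {p})"
  have 1: "residue_char p' (g ^ M) = 1" if "p' \<in> T - {p}" for p'
  proof -
    have "p' dvd M" unfolding M_def using that T(1) by (intro dvd_prodI[of _ _ "\<lambda>x. x", simplified]) auto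
    moreover have "p' > 0" "p' dvd h" using that T(2) prime_gt_0_nat by auto
    ultimately show ?thesis by (simp add: residue_char_power cis_eq_1_iff_dvd)
  qed
  have "\<not> p dvd M"
  proof
    assume "p dvd M"
    then obtain p' where "p' \<in> T - {p}" "p dvd p'"
      unfolding M_def using prime_dvd_prod_iff[OF _ pr(1), of "T - {p}" "\<lambda>x. x"] T(1) by auto
    thus False using T(2)[of p'] pr by (auto dest: primes_dvd_imp_eq)
  qed
  moreover have "\<not> p dvd b p" using b[OF p] by (auto dest: dvd_imp_le)
  ultimately have "\<not> p dvd M * b p" using pr by (simp add: prime_dvd_mult_iff)
  moreover have "product_char T b (g ^ M) = residue_char p (g ^ M) ^ b p"
    using g(1) p T(1) 1 by (simp add: product_char_def prod.remove[of T p])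
  moreover have "\<dots> = cis (2 * pi * real (M * b p) / real p)"
    using pr by (simp add: residue_char_power DeMoivre mult_ac)
  ultimately have "product_char T b (g ^ M) \<noteq> 1" using pr cis_eq_1_iff_dvd by metis
  thus ?thesis using g(1) by (intro exI[of _ "g ^ M"]) auto
qed

lemma weight_prod_expand:
  assumes T: "finite T" "\<And>p. p \<in> T \<Longrightarrow> prime p \<and> p dvd h" and x: "x \<noteq> 0"
  shows "complex_of_real (weight_prod T x) =
    (\<Sum>b\<in>Pi\<^sub>E T (\<lambda>p. {1..<p}). (\<Prod>p\<in>T. - (1 / (of_nat p - 1))) * product_char T b x)"
proof -
  have "complex_of_real (weight_prod T x) = (\<Prod>p\<in>T. \<Sum>b\<in>{1..<p}. - (1 / (of_nat p - 1)) * residue_char p x ^ b)"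
    unfolding weight_prod_def of_real_prod
    by (intro prod.cong refl weight_eq_char_sum) (use T in auto)
  also have "\<dots> = (\<Sum>b\<in>Pi\<^sub>E T (\<lambda>p. {1..<p}). \<Prod>p\<in>T. - (1 / (of_nat p - 1)) * residue_char p x ^ b p)"
    using T(1) by (intro prod_sum_PiE) auto
  also have "\<dots> = (\<Sum>b\<in>Pi\<^sub>E T (\<lambda>p. {1..<p}). (\<Prod>p\<in>T. - (1 / (of_nat p - 1))) * product_char T b x)"
    using x by (simp only: prod.distrib product_char_def if_False)
  finally show ?thesis .
qed

definition starts :: "'a set" where "starts = {x. \<forall>i<n. x + of_nat i \<noteq> 0}"

definition corr :: "(nat \<Rightarrow> nat set) \<Rightarrow> real"
  where "corr T = (\<Sum>x\<in>starts. \<Prod>i<n. weight_prod (T i) (x + of_nat i))"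

lemma card_starts: "real (card starts) \<ge> real (CARD('a)) - real n"
proof -
  have "UNIV - starts \<subseteq> (\<lambda>i. - of_nat i) ` {..<n}"
    by (auto simp: starts_def eq_neg_iff_add_eq_0)
  hence "card (UNIV - starts) \<le> card ((\<lambda>i. - of_nat i :: 'a) ` {..<n})" by (intro card_mono) auto
  also have "\<dots> \<le> n" using card_image_le[of "{..<n}"] by simp
  finally show ?thesis by (simp add: card_Diff_subset)
qed

text \<open>The coefficients of size 1/(p - 1) are exactly offset by the p - 1 choices of a
  character for each p, so the estimate is that of a single Weil sum. A nonempty \<open>T i0\<close>
  makes the character at position i0 nontrivial.\<close>

lemma corr_bound:
  assumes T: "\<And>i. i < n \<Longrightarrow> finite (T i)" "\<And>i p. i < n \<Longrightarrow> p \<in> T i \<Longrightarrow> prime p \<and> p dvd h"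
    and i0: "i0 < n" "T i0 \<noteq> {}"
  shows "\<bar>corr T\<bar> \<le> (real n - 1) * sqrt (CARD('a))"
proof -
  define B where "B i = Pi\<^sub>E (T i) (\<lambda>p. {1..<p})" for i
  define c where "c i = (\<Prod>p\<in>T i. - (1 / (of_nat p - 1)) :: complex)" for i
  have finB: "finite (B i)" if "i < n" for i unfolding B_def using T(1)[OF that] by (intro finite_PiE) auto
  have cB: "real (card (B i)) * norm (c i) = 1" if i: "i < n" for i
  proof -
    have "real (card (B i)) * norm (c i) = (\<Prod>p\<in>T i. real (p - 1)) * (\<Prod>p\<in>T i. norm (- (1 / (of_nat p - 1)) :: complex))"
      unfolding B_def c_def prod_norm using T(1)[OF i] by (simp add: card_PiE)
    also have "\<dots> = (\<Prod>p\<in>T i. real (p - 1) * norm (- (1 / (of_nat p - 1)) :: complex))"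
      by (rule prod.distrib[symmetric])
    also have "\<dots> = (\<Prod>p\<in>T i. 1)"
    proof (intro prod.cong refl)
      fix p assume "p \<in> T i"
      hence p: "p > 1" using T(2)[OF i] prime_gt_1_nat by blast
      hence "(of_nat p - 1 :: complex) = of_nat (p - 1)" by simp
      hence "norm (- (1 / (of_nat p - 1)) :: complex) = 1 / real (p - 1)"
        by (simp only: norm_minus_cancel norm_divide norm_one norm_of_nat)
      thus "real (p - 1) * norm (- (1 / (of_nat p - 1)) :: complex) = 1" using p by simp
    qed
    finally show ?thesis by simp
  qed
  have "complex_of_real (corr T)
    = (\<Sum>x\<in>starts. \<Prod>i<n. \<Sum>b\<in>B i. c i * product_char (T i) b (x + of_nat i))"
    unfolding corr_def of_real_sum of_real_prod B_def c_def
    by (intro sum.cong prod.cong refl weight_prod_expand) (use T in \<open>auto simp: starts_def\<close>)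
  also have "\<dots> = (\<Sum>x\<in>starts. \<Sum>b\<in>Pi\<^sub>E {..<n} B. \<Prod>i<n. c i * product_char (T i) (b i) (x + of_nat i))"
    using finB by (intro sum.cong refl prod_sum_PiE) auto
  also have "\<dots> = (\<Sum>b\<in>Pi\<^sub>E {..<n} B. \<Sum>x\<in>starts. \<Prod>i<n. c i * product_char (T i) (b i) (x + of_nat i))"
    by (rule sum.swap)
  also have "\<dots> = (\<Sum>b\<in>Pi\<^sub>E {..<n} B. (\<Prod>i<n. c i) * (\<Sum>x\<in>UNIV. \<Prod>i<n. product_char (T i) (b i) (x + of_nat i)))"
  proof (intro sum.cong refl)
    fix b
    have "(\<Sum>x\<in>starts. \<Prod>i<n. c i * product_char (T i) (b i) (x + of_nat i))
        = (\<Prod>i<n. c i) * (\<Sum>x\<in>starts. \<Prod>i<n. product_char (T i) (b i) (x + of_nat i))"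
      by (simp add: prod.distrib sum_distrib_left)
    also have "(\<Sum>x\<in>starts. \<Prod>i<n. product_char (T i) (b i) (x + of_nat i))
        = (\<Sum>x\<in>UNIV. \<Prod>i<n. product_char (T i) (b i) (x + of_nat i))"
    proof (intro sum.mono_neutral_left ballI)
      fix x assume "x \<in> UNIV - starts"
      then obtain i where "i < n" "x + of_nat i = 0" by (auto simp: starts_def)
      thus "(\<Prod>i<n. product_char (T i) (b i) (x + of_nat i)) = 0"
        by (intro prod_zero bexI[of _ i]) (auto simp: product_char_def)
    qed auto
    finally show "(\<Sum>x\<in>starts. \<Prod>i<n. c i * product_char (T i) (b i) (x + of_nat i))
        = (\<Prod>i<n. c i) * (\<Sum>x\<in>UNIV. \<Prod>i<n. product_char (T i) (b i) (x + of_nat i))" .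
  qed
  finally have eq: "complex_of_real (corr T) = \<dots>" .
  have "\<bar>corr T\<bar> = norm (complex_of_real (corr T))" by simp
  also have "\<dots> \<le> (\<Sum>b\<in>Pi\<^sub>E {..<n} B. (\<Prod>i<n. norm (c i)) * ((real n - 1) * sqrt (CARD('a))))"
    unfolding eq
  proof (rule sum_norm_le)
    fix b assume b: "b \<in> Pi\<^sub>E {..<n} B"
    have "norm (\<Sum>x\<in>UNIV. \<Prod>i<n. product_char (T i) (b i) (x + of_nat i)) \<le> (real n - 1) * sqrt (CARD('a))"
    proof (rule weil_consecutive[OF card(2,3) n(2) _ i0(1)])
      show "mult_char (product_char (T i) (b i))" if "i < n" for i
        using T(2)[OF that] by (rule mult_char_product_char)
      show "\<exists>x. x \<noteq> 0 \<and> product_char (T i0) (b i0) x \<noteq> 1"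
        using b i0 T by (intro product_char_nontrivial) (auto simp: B_def PiE_def Pi_def)
    qed
    thus "norm ((\<Prod>i<n. c i) * (\<Sum>x\<in>UNIV. \<Prod>i<n. product_char (T i) (b i) (x + of_nat i)))
        \<le> (\<Prod>i<n. norm (c i)) * ((real n - 1) * sqrt (CARD('a)))"
      unfolding norm_mult prod_norm[symmetric] by (intro mult_left_mono prod_nonneg) auto
  qed
  also have "\<dots> = (\<Prod>i<n. real (card (B i)) * norm (c i)) * ((real n - 1) * sqrt (CARD('a)))"
    by (simp add: card_PiE prod.distrib)
  also have "(\<Prod>i<n. real (card (B i)) * norm (c i)) = 1" using cB by (intro prod.neutral) auto
  finally show ?thesis by simp
qed

end

section \<open>The reflection symmetry\<close>

context sieve
begin

text \<open>-1 = g^(h/2) with h/2 odd, so -1 is not a square but is a p-th power for every odd prime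
  p dividing h.\<close>

lemma dvd_ind_uminus:
  assumes "prime p" "p dvd h" "x \<noteq> 0"
  shows "p dvd ind (- x) \<longleftrightarrow> (if p = 2 then \<not> p dvd ind x else p dvd ind x)"
proof -
  define m where "m = h div 2"
  have m: "h = 2 * m" "odd m" using h_mod_4 unfolding m_def by presburger+
  have "g ^ m * g ^ m = 1" using g_eq[of h 0] by (simp add: m(1) mult_2 flip: power_add)
  moreover have "g ^ m \<noteq> 1" using g_eq[of m 0] m h_pos by (auto dest: dvd_imp_le)
  ultimately have "g ^ m = - 1" by (metis square_eq_1_iff)
  hence "- x = g ^ (ind x + m)" using assms(3) by (simp add: power_add power_ind)
  hence *: "p dvd ind (- x) \<longleftrightarrow> p dvd ind x + m" using dvd_ind_power assms(2) by metis
  show ?thesis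
  proof (cases "p = 2")
    case True
    thus ?thesis using * m by simp
  next
    case False
    hence "p dvd m" using assms(1,2) m(1) by (metis prime_dvd_mult_iff primes_dvd_imp_eq two_is_prime_nat)
    thus ?thesis using * False by (simp add: dvd_add_left_iff)
  qed
qed

definition set_sign :: "nat set \<Rightarrow> real" where "set_sign T = (if 2 \<in> T then - 1 else 1)"

lemma weight_prod_uminus:
  assumes T: "finite T" "\<And>p. p \<in> T \<Longrightarrow> prime p \<and> p dvd h" and x: "x \<noteq> 0"
  shows "weight_prod T (- x) = set_sign T * weight_prod T x"
proof -
  have "weight_prod T (- x) = (\<Prod>p\<in>T. (if p = 2 then - 1 else 1) * weight p x)"
    unfolding weight_prod_def
  proof (intro prod.cong refl)
    fix p assume "p \<in> T"
    thus "weight p (- x) = (if p = 2 then - 1 else 1) * weight p x"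
      using dvd_ind_uminus[of p x] T x by (auto simp: weight_def)
  qed
  thus ?thesis using T(1) by (simp add: prod.distrib weight_prod_def set_sign_def)
qed

definition tuple_sign :: "(nat \<Rightarrow> nat set) \<Rightarrow> real"
  where "tuple_sign T = (\<Prod>i<n. set_sign (T i))"

lemma tuple_sign_cases: "tuple_sign T = 1 \<or> tuple_sign T = - 1"
proof -
  have "(\<Prod>i<k. set_sign (T i)) = 1 \<or> (\<Prod>i<k. set_sign (T i)) = - 1" for k
    by (induction k) (auto simp: set_sign_def)
  thus ?thesis by (simp add: tuple_sign_def)
qed

lemma corr_cong: "(\<And>i. i < n \<Longrightarrow> T i = T' i) \<Longrightarrow> corr T = corr T'"
  unfolding corr_def by (intro sum.cong prod.cong) auto

text \<open>The reflection \<open>x \<mapsto> - x - (n - 1)\<close> makes the tuples with an odd number of quadratic factors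
  cancel in pairs. This saves the factor 2 in the theorem and is where \<open>q \<equiv> 3 (mod 4)\<close> enters.\<close>

lemma corr_reverse:
  assumes T: "\<And>i. i < n \<Longrightarrow> finite (T i)" "\<And>i p. i < n \<Longrightarrow> p \<in> T i \<Longrightarrow> prime p \<and> p dvd h"
  shows "corr T = tuple_sign T * corr (\<lambda>i. T (n - 1 - i))"
proof -
  let ?\<sigma> = "\<lambda>x. - x - of_nat (n - 1) :: 'a"
  have shift: "?\<sigma> x + of_nat i = - (x + of_nat (n - 1 - i))" if "i < n" for x i
  proof -
    have "(of_nat (n - 1) :: 'a) = of_nat i + of_nat (n - 1 - i)"
      using that by (simp flip: of_nat_add)
    thus ?thesis by simp
  qed
  have mem: "?\<sigma> x \<in> starts" if "x \<in> starts" for x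
    unfolding starts_def
  proof (intro CollectI allI impI)
    fix i assume "i < n"
    moreover from this have "n - 1 - i < n" by simp
    hence "x + of_nat (n - 1 - i) \<noteq> 0" using that unfolding starts_def by blast
    ultimately show "?\<sigma> x + of_nat i \<noteq> 0" using shift[of i x] by (simp only: neg_equal_0_iff_equal not_False_eq_True)
  qed
  have "corr T = (\<Sum>x\<in>starts. \<Prod>i<n. weight_prod (T i) (?\<sigma> x + of_nat i))"
    unfolding corr_def by (rule sum.reindex_bij_witness[of _ ?\<sigma> ?\<sigma>]) (use mem in auto)
  also have "\<dots> = (\<Sum>x\<in>starts. tuple_sign T * (\<Prod>i<n. weight_prod (T (n - 1 - i)) (x + of_nat i)))"
  proof (intro sum.cong refl)
    fix x assume x: "x \<in> starts"
    have "(\<Prod>i<n. weight_prod (T i) (?\<sigma> x + of_nat i))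
        = (\<Prod>i<n. set_sign (T i) * weight_prod (T i) (x + of_nat (n - 1 - i)))"
    proof (intro prod.cong refl)
      fix i assume i: "i \<in> {..<n}"
      hence "n - 1 - i < n" by auto
      hence "x + of_nat (n - 1 - i) \<noteq> 0" using x unfolding starts_def by blast
      hence "weight_prod (T i) (- (x + of_nat (n - 1 - i)))
          = set_sign (T i) * weight_prod (T i) (x + of_nat (n - 1 - i))"
        using i T by (intro weight_prod_uminus) auto
      thus "weight_prod (T i) (?\<sigma> x + of_nat i) = set_sign (T i) * weight_prod (T i) (x + of_nat (n - 1 - i))"
        using i shift[of i x] by (simp only: lessThan_iff)
    qed
    also have "\<dots> = tuple_sign T * (\<Prod>i<n. weight_prod (T i) (x + of_nat (n - 1 - i)))"
      by (simp add: prod.distrib tuple_sign_def)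
    also have "(\<Prod>i<n. weight_prod (T i) (x + of_nat (n - 1 - i)))
        = (\<Prod>i<n. weight_prod (T (n - Suc i)) (x + of_nat (n - 1 - (n - Suc i))))"
      by (rule prod.nat_diff_reindex[symmetric])
    also have "\<dots> = (\<Prod>i<n. weight_prod (T (n - 1 - i)) (x + of_nat i))"
      by (intro prod.cong refl) auto
    finally show "(\<Prod>i<n. weight_prod (T i) (?\<sigma> x + of_nat i))
        = tuple_sign T * (\<Prod>i<n. weight_prod (T (n - 1 - i)) (x + of_nat i))" .
  qed
  finally show ?thesis by (simp add: corr_def sum_distrib_left)
qed

end

section \<open>Sieving with tuples of prime sets\<close>

locale sieve_primes = sieve g h r n for g :: "'a::finite_field" and h r n :: nat +
  fixes P :: "nat set"
  assumes P: "finite P" "\<And>p. p \<in> P \<Longrightarrow> prime p \<and> p dvd h" "2 \<in> P"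
begin

definition tuples :: "(nat \<Rightarrow> nat set) set" where "tuples = Pi\<^sub>E {..<n} (\<lambda>_. Pow P)"

definition reversal :: "(nat \<Rightarrow> nat set) \<Rightarrow> nat \<Rightarrow> nat set"
  where "reversal T = restrict (\<lambda>i. T (n - 1 - i)) {..<n}"

text \<open>The number of tuples of sign 1; in the theorem it becomes W(e)^n / 2.\<close>

definition half :: real where "half = 2 ^ (n * card P) / 2"

definition root_bound :: real where "root_bound = (real n - 1) * sqrt (CARD('a))"

definition \<theta> :: real where "\<theta> = (\<Prod>p\<in>P. 1 - 1 / real p)"

definition S0 :: real where "S0 = (\<Sum>T\<in>tuples. corr T)"

text \<open>Up to the factor \<theta>^n, \<open>S0\<close> counts the good starts and
  \<open>S1 p\<close> collects the correction terms of one further prime p imposed at a single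
  position, summed over the n positions.\<close>

definition S1 :: "nat \<Rightarrow> real"
  where "S1 p = (\<Sum>T\<in>tuples. \<Sum>j<n. corr (T(j := insert p (T j))))"

lemma finite_tuples: "finite tuples"
  unfolding tuples_def using P by (intro finite_PiE) auto

lemma tuplesD:
  assumes "T \<in> tuples" "i < n"
  shows "T i \<subseteq> P" "finite (T i)" "\<And>p. p \<in> T i \<Longrightarrow> prime p \<and> p dvd h"
proof -
  show "T i \<subseteq> P" using assms by (auto simp: tuples_def PiE_def Pi_def)
  thus "finite (T i)" "\<And>p. p \<in> T i \<Longrightarrow> prime p \<and> p dvd h"
    using P finite_subset by auto
qed

lemma reversal_tuples: "T \<in> tuples \<Longrightarrow> reversal T \<in> tuples"
  by (auto simp: tuples_def reversal_def PiE_def Pi_def extensional_def)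

lemma reversal_reversal: "T \<in> tuples \<Longrightarrow> reversal (reversal T) = T"
  by (rule ext) (auto simp: reversal_def restrict_def tuples_def PiE_def extensional_def)

lemma tuple_sign_reversal: "tuple_sign (reversal T) = tuple_sign T"
proof -
  have "tuple_sign (reversal T) = (\<Prod>i<n. set_sign (T (n - Suc i)))"
    unfolding tuple_sign_def reversal_def by (intro prod.cong) auto
  also have "\<dots> = tuple_sign T" unfolding tuple_sign_def by (rule prod.nat_diff_reindex)
  finally show ?thesis .
qed

text \<open>Reversal permutes the tuples of sign -1 and \<open>F\<close> changes sign under it
  there, so their total is its own negative.\<close>

lemma sum_tuples_even:
  assumes "\<And>T. T \<in> tuples \<Longrightarrow> F T = tuple_sign T * F (reversal T)"
  shows "(\<Sum>T\<in>tuples. F T) = (\<Sum>T | T \<in> tuples \<and> tuple_sign T = 1. F T :: real)"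
proof -
  let ?O = "{T \<in> tuples. tuple_sign T = - 1}"
  have "(\<Sum>T\<in>?O. F T) = (\<Sum>T\<in>?O. - F (reversal T))"
    by (intro sum.cong refl) (subst assms, auto)
  also have "(\<Sum>T\<in>?O. - F (reversal T)) = (\<Sum>T\<in>?O. - F T)"
    by (rule sum.reindex_bij_witness[of _ reversal reversal])
      (auto simp: reversal_tuples reversal_reversal tuple_sign_reversal)
  finally have "(\<Sum>T\<in>?O. F T) = 0" by (simp add: sum_negf)
  moreover have "tuples = {T \<in> tuples. tuple_sign T = 1} \<union> ?O" using tuple_sign_cases by auto
  hence "(\<Sum>T\<in>tuples. F T) = (\<Sum>T\<in>{T \<in> tuples. tuple_sign T = 1} \<union> ?O. F T)" by (rule arg_cong)
  hence "(\<Sum>T\<in>tuples. F T) = (\<Sum>T | T \<in> tuples \<and> tuple_sign T = 1. F T) + (\<Sum>T\<in>?O. F T)"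
    by (subst (asm) sum.union_disjoint) (use finite_tuples in auto)
  ultimately show ?thesis by simp
qed

text \<open>Because 2 lies in \<open>P\<close>, the signs of the subsets of \<open>P\<close> sum to
  zero, so exactly half of all tuples have sign 1.\<close>

lemma card_even_tuples: "real (card {T \<in> tuples. tuple_sign T = 1}) = half"
proof -
  have "(\<Sum>T\<in>tuples. tuple_sign T) = (\<Prod>i<n. \<Sum>S\<in>Pow P. set_sign S)"
    unfolding tuples_def tuple_sign_def using P(1) by (intro prod_sum_PiE[symmetric]) auto
  also have "(\<Sum>S\<in>Pow P. set_sign S) = (\<Sum>S\<in>Pow P. (\<Prod>p\<in>S. if p = 2 then - 1 else 1) * (\<Prod>p\<in>P-S. 1))"
    using P(1) by (intro sum.cong refl) (auto simp: set_sign_def finite_subset)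
  also have "\<dots> = (\<Prod>p\<in>P. (if p = 2 then - 1 else 1) + 1)"
    by (rule prod_add[symmetric]) (rule P)
  also have "\<dots> = 0" using P by (intro prod_zero bexI[of _ 2]) auto
  finally have sum0: "(\<Sum>T\<in>tuples. tuple_sign T) = 0" using n by (simp add: power_0_left)
  have "real (card tuples) = 2 ^ (n * card P)"
    using P(1) by (simp add: tuples_def card_PiE card_Pow mult.commute[of n] flip: power_mult)
  moreover have "real (card {T \<in> tuples. tuple_sign T = 1}) = (\<Sum>T\<in>tuples. if tuple_sign T = 1 then 1 else 0)"
    using finite_tuples by (simp flip: sum.inter_filter)
  moreover have "\<dots> = (\<Sum>T\<in>tuples. (1 + tuple_sign T) / 2)"
  proof (intro sum.cong refl)
    fix T show "(if tuple_sign T = 1 then 1 else 0) = (1 + tuple_sign T) / 2"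
      using tuple_sign_cases[of T] by auto
  qed
  moreover have "\<dots> = (real (card tuples) + (\<Sum>T\<in>tuples. tuple_sign T)) / 2"
    by (simp add: sum.distrib flip: sum_divide_distrib)
  ultimately show ?thesis by (simp add: sum0 half_def)
qed

text \<open>The tuple of empty sets contributes the main term, at least q - n; each of the remaining
  \<open>half - 1\<close> tuples of sign 1 contains a nontrivial character and costs one Weil
  bound.\<close>

lemma S0_ge: "S0 \<ge> real (CARD('a)) - real n - (half - 1) * root_bound"
proof -
  let ?E = "{T \<in> tuples. tuple_sign T = 1}"
  define T0 :: "nat \<Rightarrow> nat set" where "T0 = restrict (\<lambda>_. {}) {..<n}"
  have T0: "T0 \<in> ?E"
    by (auto simp: T0_def tuples_def tuple_sign_def set_sign_def PiE_def)
  have finE: "finite ?E" using finite_tuples by simp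
  have "S0 = (\<Sum>T\<in>?E. corr T)"
    unfolding S0_def
  proof (rule sum_tuples_even)
    fix T assume T: "T \<in> tuples"
    have "corr T = tuple_sign T * corr (\<lambda>i. T (n - 1 - i))"
      using tuplesD[OF T] by (intro corr_reverse) auto
    also have "corr (\<lambda>i. T (n - 1 - i)) = corr (reversal T)"
      by (intro corr_cong) (simp add: reversal_def)
    finally show "corr T = tuple_sign T * corr (reversal T)" .
  qed
  also have "\<dots> = corr T0 + (\<Sum>T\<in>?E - {T0}. corr T)" using finE T0 by (rule sum.remove)
  also have "corr T0 = real (card starts)"
    by (simp add: corr_def T0_def weight_prod_def)
  finally have eq: "S0 = real (card starts) + (\<Sum>T\<in>?E - {T0}. corr T)" .
  have "\<bar>\<Sum>T\<in>?E - {T0}. corr T\<bar> \<le> (\<Sum>T\<in>?E - {T0}. \<bar>corr T\<bar>)" by (rule sum_abs)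
  also have "\<dots> \<le> (\<Sum>T\<in>?E - {T0}. root_bound)"
  proof (rule sum_mono)
    fix T assume T: "T \<in> ?E - {T0}"
    have "\<exists>i<n. T i \<noteq> {}"
    proof (rule ccontr)
      assume "\<not> (\<exists>i<n. T i \<noteq> {})"
      hence "T i = T0 i" for i
        using T by (cases "i < n") (auto simp: T0_def tuples_def PiE_def extensional_def)
      thus False using T by auto
    qed
    then obtain i where "i < n" "T i \<noteq> {}" by blast
    thus "\<bar>corr T\<bar> \<le> root_bound"
      unfolding root_bound_def using T tuplesD by (intro corr_bound) auto
  qed
  also have "\<dots> = real (card ?E - 1) * root_bound" using T0 by simp
  also have "card ?E > 0" using T0 finE card_gt_0_iff by blast
  hence "real (card ?E - 1) = half - 1" using card_even_tuples by simp
  finally show ?thesis using eq card_starts by linarith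
qed

text \<open>The inserted p makes every correlation nontrivial, so there is no main term. As 2 is in
  \<open>P\<close>, p is odd, and inserting it leaves the sign of a tuple alone.\<close>

lemma S1_le:
  assumes p: "prime p" "p dvd h" "p \<notin> P"
  shows "\<bar>S1 p\<bar> \<le> real n * half * root_bound"
proof -
  let ?E = "{T \<in> tuples. tuple_sign T = 1}"
  have p2: "p \<noteq> 2" using p P by auto
  define F where "F T = (\<Sum>j<n. corr (T(j := insert p (T j))))" for T :: "nat \<Rightarrow> nat set"
  have "S1 p = (\<Sum>T\<in>?E. F T)"
    unfolding S1_def F_def[symmetric]
  proof (rule sum_tuples_even)
    fix T assume T: "T \<in> tuples"
    have "F T = (\<Sum>j<n. tuple_sign T * corr ((reversal T)(n - Suc j := insert p (reversal T (n - Suc j)))))"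
      unfolding F_def
    proof (intro sum.cong refl)
      fix j assume j: "j \<in> {..<n}"
      have "corr (T(j := insert p (T j))) = tuple_sign (T(j := insert p (T j))) * corr (\<lambda>i. (T(j := insert p (T j))) (n - 1 - i))"
        using tuplesD[OF T] p by (intro corr_reverse) (auto split: if_splits)
      also have "tuple_sign (T(j := insert p (T j))) = tuple_sign T"
        unfolding tuple_sign_def using p2 by (intro prod.cong) (auto simp: set_sign_def)
      also have "corr (\<lambda>i. (T(j := insert p (T j))) (n - 1 - i))
        = corr ((reversal T)(n - Suc j := insert p (reversal T (n - Suc j))))"
        using j by (intro corr_cong) (auto simp: reversal_def)
      finally show "corr (T(j := insert p (T j)))
        = tuple_sign T * corr ((reversal T)(n - Suc j := insert p (reversal T (n - Suc j))))" .
    qed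
    \<comment> \<open>Reversal moves the inserted prime from j to n - 1 - j, so the symmetry holds
      for the sum over all positions.\<close>
    also have "\<dots> = (\<Sum>j<n. tuple_sign T * corr ((reversal T)(j := insert p (reversal T j))))"
      by (rule sum.nat_diff_reindex)
    finally show "F T = tuple_sign T * F (reversal T)" by (simp add: F_def sum_distrib_left)
  qed
  also have "\<bar>\<dots>\<bar> \<le> (\<Sum>T\<in>?E. \<bar>F T\<bar>)" by (rule sum_abs)
  also have "\<dots> \<le> (\<Sum>T\<in>?E. real n * root_bound)"
  proof (rule sum_mono)
    fix T assume T: "T \<in> ?E"
    have "\<bar>F T\<bar> \<le> (\<Sum>j<n. \<bar>corr (T(j := insert p (T j)))\<bar>)" unfolding F_def by (rule sum_abs)
    also have "\<dots> \<le> (\<Sum>j<n. root_bound)"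
    proof (rule sum_mono)
      fix j assume "j \<in> {..<n}"
      thus "\<bar>corr (T(j := insert p (T j)))\<bar> \<le> root_bound"
        unfolding root_bound_def using T tuplesD p by (intro corr_bound[of _ j]) (auto split: if_splits)
    qed
    finally show "\<bar>F T\<bar> \<le> real n * root_bound" by simp
  qed
  also have "\<dots> = real n * half * root_bound" using card_even_tuples by simp
  finally show ?thesis .
qed

lemma \<theta>_pos: "\<theta> > 0"
  unfolding \<theta>_def
proof (rule prod_pos)
  fix p assume "p \<in> P"
  hence "p > 1" using P(2) prime_gt_1_nat by blast
  thus "1 - 1 / real p > 0" by (simp add: field_simps)
qed

lemma indicator_expand:
  "(if \<forall>p\<in>P. \<not> p dvd ind x then 1 else 0) = \<theta> * (\<Sum>S\<in>Pow P. weight_prod S x)"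
proof -
  have "\<theta> * (\<Sum>S\<in>Pow P. weight_prod S x) = \<theta> * (\<Prod>p\<in>P. weight p x + 1)"
    unfolding prod_add[OF P(1)] weight_prod_def by simp
  also have "\<dots> = (\<Prod>p\<in>P. (1 - 1 / real p) * (weight p x + 1))"
    by (simp add: \<theta>_def prod.distrib)
  also have "\<dots> = (\<Prod>p\<in>P. if p dvd ind x then 0 else 1)"
  proof (intro prod.cong refl)
    fix p assume "p \<in> P"
    hence "p > 1" using P(2) prime_gt_1_nat by blast
    thus "(1 - 1 / real p) * (weight p x + 1) = (if p dvd ind x then 0 else 1)"
      by (simp add: weight_def field_simps)
  qed
  also have "\<dots> = (if \<forall>p\<in>P. \<not> p dvd ind x then 1 else 0)"
    using P(1) by (auto intro: prod_zero)
  finally show ?thesis by simp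
qed

definition good :: "'a set"
  where "good = {x \<in> starts. \<forall>i<n. \<forall>p\<in>P. \<not> p dvd ind (x + of_nat i)}"

lemma good_indicator:
  assumes "x \<in> starts"
  shows "(if x \<in> good then 1 else 0) = \<theta> ^ n * (\<Sum>T\<in>tuples. \<Prod>i<n. weight_prod (T i) (x + of_nat i))"
proof -
  have "(if x \<in> good then 1 else 0) = (\<Prod>i<n. if \<forall>p\<in>P. \<not> p dvd ind (x + of_nat i) then 1 else 0 :: real)"
  proof (cases "x \<in> good")
    case False
    then obtain i where "i < n" "\<not> (\<forall>p\<in>P. \<not> p dvd ind (x + of_nat i))" using assms by (auto simp: good_def)
    hence "(\<Prod>i<n. if \<forall>p\<in>P. \<not> p dvd ind (x + of_nat i) then 1 else 0 :: real) = 0"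
      by (intro prod_zero bexI[of _ i]) auto
    thus ?thesis using False by simp
  qed (auto simp: good_def)
  also have "\<dots> = \<theta> ^ n * (\<Prod>i<n. \<Sum>S\<in>Pow P. weight_prod S (x + of_nat i))"
    unfolding indicator_expand by (simp add: prod.distrib)
  also have "(\<Prod>i<n. \<Sum>S\<in>Pow P. weight_prod S (x + of_nat i)) = (\<Sum>T\<in>tuples. \<Prod>i<n. weight_prod (T i) (x + of_nat i))"
    unfolding tuples_def using P(1) by (intro prod_sum_PiE) auto
  finally show ?thesis .
qed

lemma card_good: "real (card good) = \<theta> ^ n * S0"
proof -
  have "real (card good) = (\<Sum>x\<in>starts. if x \<in> good then 1 else 0)"
    by (simp add: good_def flip: sum.inter_filter)
  also have "\<dots> = \<theta> ^ n * (\<Sum>x\<in>starts. \<Sum>T\<in>tuples. \<Prod>i<n. weight_prod (T i) (x + of_nat i))"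
    by (simp add: good_indicator sum_distrib_left)
  also have "(\<Sum>x\<in>starts. \<Sum>T\<in>tuples. \<Prod>i<n. weight_prod (T i) (x + of_nat i)) = S0"
    unfolding S0_def corr_def by (rule sum.swap)
  finally show ?thesis .
qed

text \<open>The further condition multiplies the indicator by (1 - 1/p)(1 +
  \<open>weight p\<close>); since p is not in \<open>T j\<close>, the new weight is absorbed by
  inserting p into \<open>T j\<close>.\<close>

lemma card_good_non_residue:
  assumes p: "prime p" "p dvd h" "p \<notin> P" and j: "j < n"
  shows "real (card {x \<in> good. \<not> p dvd ind (x + of_nat j)})
    = (1 - 1 / real p) * (real (card good) + \<theta> ^ n * (\<Sum>T\<in>tuples. corr (T(j := insert p (T j)))))"
proof -
  have p1: "p > 1" using p prime_gt_1_nat by blast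
  have "real (card {x \<in> good. \<not> p dvd ind (x + of_nat j)})
      = (\<Sum>x\<in>starts. if x \<in> good \<and> \<not> p dvd ind (x + of_nat j) then 1 else 0)"
    by (simp add: good_def conj_assoc flip: sum.inter_filter)
  also have "\<dots> = (\<Sum>x\<in>starts. (1 - 1 / real p) * ((if x \<in> good then 1 else 0) * (1 + weight p (x + of_nat j))))"
    using p1 by (intro sum.cong refl) (auto simp: weight_def field_simps)
  also have "\<dots> = (1 - 1 / real p) * ((\<Sum>x\<in>starts. if x \<in> good then 1 else 0)
      + (\<Sum>x\<in>starts. (if x \<in> good then 1 else 0) * weight p (x + of_nat j)))"
    unfolding sum_distrib_left[symmetric] by (simp add: distrib_left sum.distrib)
  also have "(\<Sum>x\<in>starts. if x \<in> good then 1 else 0) = real (card good)"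
    by (simp add: good_def flip: sum.inter_filter)
  also have "(\<Sum>x\<in>starts. (if x \<in> good then 1 else 0) * weight p (x + of_nat j))
      = (\<Sum>x\<in>starts. \<Sum>T\<in>tuples. \<theta> ^ n * (\<Prod>i<n. weight_prod ((T(j := insert p (T j))) i) (x + of_nat i)))"
  proof (intro sum.cong refl)
    fix x assume x: "x \<in> starts"
    have "(\<Prod>i<n. weight_prod (T i) (x + of_nat i)) * weight p (x + of_nat j)
        = (\<Prod>i<n. weight_prod ((T(j := insert p (T j))) i) (x + of_nat i))" if T: "T \<in> tuples" for T
    proof -
      have "p \<notin> T j" "finite (T j)" using tuplesD[OF T j] p by auto
      hence "weight_prod (insert p (T j)) (x + of_nat j) = weight_prod (T j) (x + of_nat j) * weight p (x + of_nat j)"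
        by (simp add: weight_prod_def mult.commute)
      moreover have "(\<Prod>i\<in>{..<n}-{j}. weight_prod ((T(j := insert p (T j))) i) (x + of_nat i))
          = (\<Prod>i\<in>{..<n}-{j}. weight_prod (T i) (x + of_nat i))"
        by (intro prod.cong) auto
      ultimately show ?thesis using j
        by (simp add: prod.remove[of "{..<n}" j] mult_ac)
    qed
    thus "(if x \<in> good then 1 else 0) * weight p (x + of_nat j)
      = (\<Sum>T\<in>tuples. \<theta> ^ n * (\<Prod>i<n. weight_prod ((T(j := insert p (T j))) i) (x + of_nat i)))"
      unfolding good_indicator[OF x] by (simp add: sum_distrib_right sum_distrib_left mult.assoc)
  qed
  also have "\<dots> = (\<Sum>T\<in>tuples. \<Sum>x\<in>starts. \<theta> ^ n * (\<Prod>i<n. weight_prod ((T(j := insert p (T j))) i) (x + of_nat i)))"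
    by (rule sum.swap)
  also have "\<dots> = \<theta> ^ n * (\<Sum>T\<in>tuples. corr (T(j := insert p (T j))))"
    by (simp only: corr_def sum_distrib_left)
  finally show ?thesis .
qed

text \<open>If no good start survives the primes of \<open>Q\<close>, the good set is covered by the
  sets \<open>bad (p, j)\<close>. Each takes a proportion 1/p plus an error weighted by 1 - 1/p. In
  the sum over all pairs, n times the sum of 1/p is 1 - \<delta>, which leaves \<delta> times the
  good count on the left, and n times the sum of 1 - 1/p is n card Q - 1 + \<delta>, the factor on
  the right.\<close>

lemma sieve_inequality:
  assumes Q: "finite Q" "\<And>p. p \<in> Q \<Longrightarrow> prime p \<and> p dvd h \<and> p \<notin> P"
    and \<delta>: "\<delta> = 1 - real n * (\<Sum>p\<in>Q. 1 / real p)"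
    and none: "\<And>x. x \<in> good \<Longrightarrow> \<exists>j<n. \<exists>p\<in>Q. p dvd ind (x + of_nat j)"
  shows "\<delta> * S0 \<le> (real n * real (card Q) - 1 + \<delta>) * (half * root_bound)"
proof -
  define bad where "bad = (\<lambda>(p, j). {x \<in> good. p dvd ind (x + of_nat j)})"
  define C where "C p j = (\<Sum>T\<in>tuples. corr (T(j := insert p (T j))))" for p j
  have fin: "finite good" by simp
  have card_bad: "real (card (bad (p, j))) = real (card good) / p - (1 - 1 / real p) * \<theta> ^ n * C p j"
    if "p \<in> Q" "j < n" for p j
  proof -
    have p: "p > 0" using Q(2)[OF that(1)] prime_gt_0_nat by auto
    have "good = bad (p, j) \<union> {x \<in> good. \<not> p dvd ind (x + of_nat j)}" by (auto simp: bad_def)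
    hence "card good = card (bad (p, j) \<union> {x \<in> good. \<not> p dvd ind (x + of_nat j)})" by (rule arg_cong)
    also have "\<dots> = card (bad (p, j)) + card {x \<in> good. \<not> p dvd ind (x + of_nat j)}"
      by (rule card_Un_disjoint) (auto simp: bad_def)
    finally have "real (card (bad (p, j))) = real (card good) - real (card {x \<in> good. \<not> p dvd ind (x + of_nat j)})"
      by simp
    also have "real (card {x \<in> good. \<not> p dvd ind (x + of_nat j)})
        = (1 - 1 / real p) * (real (card good) + \<theta> ^ n * C p j)"
      unfolding C_def using Q(2)[OF that(1)] that(2) by (intro card_good_non_residue) auto
    finally show ?thesis using p by (simp add: field_simps)
  qed
  have S1C: "(\<Sum>j<n. C p j) = S1 p" for p unfolding C_def S1_def by (rule sum.swap)
  have "good \<subseteq> (\<Union>pj\<in>Q \<times> {..<n}. bad pj)" using none by (fastforce simp: bad_def)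
  hence "card good \<le> card (\<Union>pj\<in>Q \<times> {..<n}. bad pj)" by (intro card_mono) auto
  also have "\<dots> \<le> (\<Sum>pj\<in>Q \<times> {..<n}. card (bad pj))" using Q(1) by (intro card_UN_le) auto
  finally have "real (card good) \<le> (\<Sum>pj\<in>Q \<times> {..<n}. real (card (bad pj)))"
    by (simp flip: of_nat_sum)
  also have "\<dots> = (\<Sum>p\<in>Q. \<Sum>j<n. real (card (bad (p, j))))"
    by (simp add: sum.cartesian_product)
  also have "\<dots> = (\<Sum>p\<in>Q. \<Sum>j<n. real (card good) / p - (1 - 1 / real p) * \<theta> ^ n * C p j)"
    by (intro sum.cong refl card_bad) auto
  also have "\<dots> = (\<Sum>p\<in>Q. real n * real (card good) * (1 / real p) - (1 - 1 / real p) * \<theta> ^ n * S1 p)"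
    by (simp add: sum_subtractf S1C flip: sum_distrib_left)
  also have "\<dots> = real n * real (card good) * (\<Sum>p\<in>Q. 1 / real p) - (\<Sum>p\<in>Q. (1 - 1 / real p) * \<theta> ^ n * S1 p)"
    by (simp only: sum_subtractf sum_distrib_left)
  finally have upper: "real (card good) \<le> real n * real (card good) * (\<Sum>p\<in>Q. 1 / real p)
      - (\<Sum>p\<in>Q. (1 - 1 / real p) * \<theta> ^ n * S1 p)" .
  have "- (\<Sum>p\<in>Q. (1 - 1 / real p) * \<theta> ^ n * S1 p) \<le> (\<Sum>p\<in>Q. (1 - 1 / real p) * \<theta> ^ n * (real n * half * root_bound))"
    unfolding sum_negf[symmetric]
  proof (rule sum_mono)
    fix p assume p: "p \<in> Q"
    have "real p \<ge> 1" using Q(2)[OF p] prime_ge_1_nat by simp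
    hence "(1 - 1 / real p) * \<theta> ^ n \<ge> 0" using \<theta>_pos by (simp add: field_simps)
    moreover have "- S1 p \<le> real n * half * root_bound" using S1_le[of p] Q(2)[OF p] by linarith
    ultimately have "(1 - 1 / real p) * \<theta> ^ n * (- S1 p) \<le> (1 - 1 / real p) * \<theta> ^ n * (real n * half * root_bound)"
      by (rule mult_left_mono[rotated])
    thus "- ((1 - 1 / real p) * \<theta> ^ n * S1 p) \<le> (1 - 1 / real p) * \<theta> ^ n * (real n * half * root_bound)"
      by simp
  qed
  also have "(\<Sum>p\<in>Q. (1 - 1 / real p) * \<theta> ^ n * (real n * half * root_bound))
      = (\<Sum>p\<in>Q. 1 - 1 / real p) * (\<theta> ^ n * (real n * half * root_bound))"
    unfolding sum_distrib_right by (simp only: mult.assoc)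
  also have "(\<Sum>p\<in>Q. 1 - 1 / real p) = real (card Q) - (\<Sum>p\<in>Q. 1 / real p)"
    by (simp add: sum_subtractf)
  finally have "real (card good) \<le> real n * real (card good) * (\<Sum>p\<in>Q. 1 / real p)
      + (real (card Q) - (\<Sum>p\<in>Q. 1 / real p)) * (\<theta> ^ n * (real n * half * root_bound))"
    using upper by linarith
  hence "\<delta> * real (card good) \<le> \<theta> ^ n * ((real n * real (card Q) - 1 + \<delta>) * (half * root_bound))"
    unfolding \<delta> by (simp add: algebra_simps)
  hence "\<theta> ^ n * (\<delta> * S0) \<le> \<theta> ^ n * ((real n * real (card Q) - 1 + \<delta>) * (half * root_bound))"
    by (simp add: card_good mult_ac)
  thus ?thesis using \<theta>_pos by simp
qed

end

section \<open>Primitive elements and the final estimate\<close>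

lemma (in sieve) primitive_elementI:
  assumes "x \<noteq> 0" and free: "\<And>p. prime p \<Longrightarrow> p dvd h \<Longrightarrow> \<not> p dvd ind x"
  shows "primitive_element x"
proof -
  have "coprime (ind x) h"
  proof (rule ccontr)
    assume "\<not> coprime (ind x) h"
    hence "gcd (ind x) h \<noteq> 1" by (metis coprime_iff_gcd_eq_1)
    then obtain p where "prime p" "p dvd gcd (ind x) h" using prime_factor_nat by blast
    thus False using free[of p] by simp
  qed
  then obtain m where m: "[ind x * m = Suc 0] (mod h)" using cong_solve_coprime_nat by blast
  have "x ^ m = g ^ (ind x * m)" using power_ind[OF assms(1)] by (metis power_mult)
  also have "\<dots> = g ^ 1" using m unfolding g_eq by (simp add: cong_def)
  finally have xm: "x ^ m = g" by simp
  have "y \<in> range (\<lambda>k::int. x powi k)" if "y \<noteq> 0" for y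
  proof
    show "y = x powi int (m * ind y)"
      using power_ind[OF that] xm by (simp only: power_int_of_nat power_mult)
  qed simp
  moreover have "x powi k \<noteq> 0" for k using assms(1) by simp
  ultimately show ?thesis unfolding primitive_element_def by auto
qed

theorem theorem6:
  fixes p q n e s :: nat and \<delta> :: real
  assumes "prime p" and "\<exists>k\<ge>1. q = p ^ k" and "CARD('a :: finite_field) = q"
    and "[q = 3] (mod 4)" and "q \<ge> 7"
    and "3 \<le> n" and "n \<le> p"
    and "even e" and "e dvd q - 1"
    and "s = sieve_s q e" and "\<delta> = sieve_delta n q e"
    and "\<delta> > 0"
    and "real q > ((real n - 1) / 2 * ((real n * real s - 1) / \<delta> + 2) * real (W e) ^ n)\<^sup>2"
  shows "\<exists>g :: 'a. \<forall>i<n. primitive_element (g + of_nat i)"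
proof -
  obtain k where k: "k \<ge> 1" "q = p ^ k" using assms(2) by blast
  have "CHAR('a) dvd p ^ k" using CHAR_dvd_CARD[where 'a = 'a] assms(3) k by simp
  hence "CHAR('a) dvd p" using prime_dvd_power CHAR_prime by blast
  hence char: "CHAR('a) = p" using assms(1) by (simp add: primes_dvd_imp_eq)
  define h where "h = q - 1"
  have h: "h > 0" "q = h + 1" using assms(5) by (auto simp: h_def)
  have "q mod 4 = 3" using assms(4) by (simp add: cong_def)
  hence "h = 4 * (q div 4) + 2" using mult_div_mod_eq[of 4 q] h(2) by linarith
  hence hmod: "h mod 4 = 2" by presburger
  obtain g :: 'a where g: "g \<noteq> 0" "\<And>x. x \<noteq> 0 \<Longrightarrow> \<exists>l. x = g ^ l"
    using finite_field_generator by blast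
  have geq: "g ^ l = g ^ l' \<longleftrightarrow> l mod h = l' mod h" for l l'
    using generator_power_eq_iff[OF g] assms(3) by (simp add: h_def)
  define P where "P = prime_factors e"
  define Q where "Q = remaining_primes e h"
  have "e dvd h" using assms(9) by (simp only: h_def)
  moreover from this have "e > 0" using h(1) by (rule dvd_pos_nat[rotated])
  ultimately have e0: "e > 0" "e dvd h" by blast+
  have P: "finite P" "p' \<in> P \<Longrightarrow> prime p' \<and> p' dvd h" "2 \<in> P" for p'
    using e0 assms(8) by (auto simp: P_def in_prime_factors_iff intro: dvd_trans)
  interpret sieve_primes g h k n P
  proof
    show "CARD('a) = CHAR('a) ^ k" using assms(3) k char by simp
  qed (use g geq assms k h hmod char P in auto)
  have "Q \<subseteq> prime_factors h"
    using h by (auto simp: Q_def remaining_primes_def in_prime_factors_iff)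
  hence finQ: "finite Q" using finite_subset by blast
  have Q: "r \<in> Q \<Longrightarrow> prime r \<and> r dvd h \<and> r \<notin> P" for r
    by (auto simp: Q_def remaining_primes_def P_def in_prime_factors_iff)
  \<comment> \<open>Equal radicals leave no remaining primes, so the special case in
    \<open>sieve_s\<close> and \<open>sieve_delta\<close> agrees with the general formula at an
    empty \<open>Q\<close>.\<close>
  have Rad_eq: "Q = {}" if "Rad e = Rad h"
  proof -
    have "r dvd e" if r: "prime r" "r dvd h" for r
    proof -
      have "r \<in> prime_factors h" using r h by (simp add: in_prime_factors_iff)
      hence "r dvd Rad h" unfolding Rad_def by (metis dvd_prod_eqI finite_set_mset)
      hence "r dvd \<Prod>(prime_factors e)" using \<open>Rad e = Rad h\<close> by (simp add: Rad_def)
      then obtain r' where "r' \<in> prime_factors e" "r dvd r'"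
        using prime_dvd_prod_iff[of "prime_factors e" r "\<lambda>x. x"] r(1) by auto
      thus ?thesis by (meson dvd_trans in_prime_factors_imp_dvd)
    qed
    thus ?thesis by (auto simp: Q_def remaining_primes_def)
  qed
  have s: "s = card Q" using Rad_eq by (simp add: assms(10) sieve_s_def Q_def h_def)
  have \<delta>: "\<delta> = 1 - real n * (\<Sum>r\<in>Q. 1 / real r)"
    using Rad_eq by (auto simp: assms(11) sieve_delta_def Q_def h_def)
  have "\<exists>x\<in>good. \<forall>j<n. \<forall>r\<in>Q. \<not> r dvd ind (x + of_nat j)"
  proof (rule ccontr)
    assume "\<not> ?thesis"
    hence "\<exists>j<n. \<exists>r\<in>Q. r dvd ind (x + of_nat j)" if "x \<in> good" for x using that by blast
    from sieve_inequality[OF finQ Q \<delta> this]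
    have 1: "\<delta> * S0 \<le> (real n * real s - 1 + \<delta>) * (half * root_bound)" by (simp add: s)
    have half: "half = real (W e) ^ n / 2"
    proof -
      have "W e = 2 ^ card P" by (simp add: W_def omega_def P_def)
      thus ?thesis by (simp add: half_def mult.commute[of n] flip: power_mult)
    qed
    \<comment> \<open>The sieve inequality costs (ns - 1)/\<delta> + 1 copies of
      \<open>half * root_bound\<close> and \<open>S0_ge\<close> one more, hence the 2. The Weil
      bound spared for the trivial tuple pays for the n excluded starts.\<close>
    define Y where "Y = (real n * real s - 1) / \<delta> + 2"
    have rq: "sqrt q * sqrt q = q" by simp
    have "(real n - 1) * (half * Y) < sqrt q"
    proof (rule real_less_rsqrt)
      show "((real n - 1) * (half * Y))\<^sup>2 < real q"
        using assms(13) by (simp add: half Y_def algebra_simps)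
    qed
    moreover have "sqrt q > 0" using assms(5) by simp
    ultimately have "(real n - 1) * (half * Y) * sqrt q < sqrt q * sqrt q"
      by (rule mult_strict_right_mono)
    hence 2: "root_bound * half * Y < real q"
      using assms(3) by (simp add: root_bound_def mult_ac)
    \<comment> \<open>With sqrt q >= 2 and n >= 3, (n - 1) sqrt q >= 2 (n - 1) >= n, so one Weil
      bound covers the loss of n in \<open>S0_ge\<close>.\<close>
    have "sqrt q \<ge> 2" using assms(5) by (intro real_le_rsqrt) simp
    hence "(real n - 1) * 2 \<le> (real n - 1) * sqrt q" using assms(6) by (intro mult_left_mono) auto
    hence 3: "root_bound \<ge> real n" using assms(3,6) by (simp add: root_bound_def)
    have "S0 > root_bound * half * Y - half * root_bound"
      using S0_ge 2 3 assms(3) by (simp add: algebra_simps)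
    hence "\<delta> * S0 > \<delta> * (root_bound * half * Y - half * root_bound)"
      using assms(12) by simp
    also have "\<delta> * (root_bound * half * Y - half * root_bound)
        = (\<delta> * Y - \<delta>) * (half * root_bound)" by (simp add: algebra_simps)
    also have "\<delta> * Y = real n * real s - 1 + 2 * \<delta>" using assms(12) by (simp add: Y_def field_simps)
    finally show False using 1 by (simp add: algebra_simps)
  qed
  then obtain x where x: "x \<in> good" "\<And>j r. j < n \<Longrightarrow> r \<in> Q \<Longrightarrow> \<not> r dvd ind (x + of_nat j)" by blast
  have "primitive_element (x + of_nat i)" if i: "i < n" for i
  proof (rule primitive_elementI)
    show "x + of_nat i \<noteq> 0" using x(1) i by (auto simp: good_def starts_def)
    fix r assume r: "prime r" "r dvd h"
    show "\<not> r dvd ind (x + of_nat i)"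
    proof (cases "r \<in> P")
      case True
      thus ?thesis using x(1) i by (auto simp: good_def)
    next
      case False
      hence "r \<in> Q" using r e0 by (auto simp: Q_def remaining_primes_def P_def in_prime_factors_iff)
      thus ?thesis using x(2) i by blast
    qed
  qed
  thus ?thesis by blast
qed

end
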